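(* Let $1<p<\infty$ and $g\in L_\infty$. Let $n\ge 1$, and let $B=B_1B_2\cdots B_n$ with $B_j=r_{z_j}^{k_j}$, where $k_j\in\mathbb{N}$ is a positive integer and $z_j\in\mathbb{C}^+$ for $j=1,\dots,n$, and $r_z(\xi)=\frac{\xi-z}{\xi-\overline{z}}$. Let $k=\sum_{j=1}^nk_j$. If $\dim\ker T_g\le k$, then $\ker T_{Bg}=\{0\}$. If $\dim\ker T_g>k$ (possibly infinite), then $$\ker T_g=\ker T_{Bg}\oplus\lambda_{z_1}\phi_+K_B,$$ where $\lambda_{z_1}(\xi)=\xi-z_1$ and $\phi_+$ is a maximal function for $\ker T_{Bg}$, i.e. $\mathcal{K}_{\min}(\phi_+)=\ker T_{Bg}$.
   Context: $H_p^\pm=H^p(\mathbb{C}^\pm)$ are the Hardy spaces of the upper/lower half-plane, identified via boundary values with closed subspaces of $L_p=L^p(\mathbb{R})$; $L_\infty=L^\infty(\mathbb{R})$. $P^+:L_p\to H_p^+$ is the projection with kernel $H_p^-$; for $g\in L_\infty$ the Toeplitz operator is $T_gf_+=P^+(gf_+)$ on $H_p^+$, so $\ker T_g=\{f_+\in H_p^+: gf_+\in H_p^-\}$. A T-kernel is a set of the form $\ker T_g$ with $g\in L_\infty$. For an inner function $\theta$ (in particular for the finite Blaschke product $B$), the model space is $K_\theta:=H_p^+\cap\theta H_p^-$. For $\phi_+\in H_p^+\setminus\{0\}$, $\mathcal{K}_{\min}(\phi_+)$ denotes the smallest T-kernel containing $\phi_+$: it is a T-kernel containing $\phi_+$, and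 for any $g\in L_\infty$, $\phi_+\in\ker T_g$ implies $\mathcal{K}_{\min}(\phi_+)\subset\ker T_g$. It is known to exist, and if $\phi_+=I_+O_+$ is an inner-outer factorisation then $\mathcal{K}_{\min}(\phi_+)=\ker T_{\overline{I}_+\overline{O}_+/O_+}$. If $K=\mathcal{K}_{\min}(\phi_+)$, then $\phi_+$ is called a maximal function for $K$. For a function $f$ and a set $X$ of functions on $\mathbb{R}$, $fX=\{fx:x\in X\}$. The symbol $\oplus$ denotes a (not necessarily orthogonal) direct sum of linear subspaces.
   Formalization: Existence of a maximal function for ker T_{Bg} is asserted only for g ≠ 0, since for g = 0 this kernel is all of H_p^+, which has no maximal function; the decomposition is proved for every maximal function. *)

theory Defs
  imports "HOL-Analysis.Analysis"
begin

section \<open>Functions on the real line modulo null sets\<close>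

definition ae_rel :: "(real \<Rightarrow> complex) \<Rightarrow> (real \<Rightarrow> complex) \<Rightarrow> bool" where
  "ae_rel f g \<longleftrightarrow> f \<in> borel_measurable borel \<and> g \<in> borel_measurable borel
     \<and> (AE x in lborel. f x = g x)"

lemma ae_rel_part_equivp: "part_equivp ae_rel"
proof (rule part_equivpI)
  show "\<exists>f. ae_rel f f"
    by (rule exI[of _ "\<lambda>_. 0"]) (simp add: ae_rel_def)
  show "symp ae_rel"
    by (auto simp: symp_def ae_rel_def elim: eventually_mono)
  show "transp ae_rel"
    unfolding transp_def ae_rel_def by (auto elim: eventually_elim2)
qed

text \<open>The elements of \<^typ>\<open>real \<Rightarrow> complex\<close> that are Borel measurable, up to equality almost
  everywhere; every Lebesgue measurable function has such a representative. All spaces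
  below consist of such classes.\<close>

quotient_type aefun = "real \<Rightarrow> complex" / partial: ae_rel
  morphisms rep_aefun abs_aefun
  by (rule ae_rel_part_equivp)

lemma not_AE_lborel_False: "\<not> (AE x::real in lborel. False)"
proof -
  have "ae_filter (lborel :: real measure) \<noteq> bot"
    by (simp add: ae_filter_eq_bot_iff)
  then show ?thesis
    by (simp add: trivial_limit_def)
qed

instantiation aefun :: comm_ring_1
begin

lift_definition zero_aefun :: aefun is "\<lambda>_. 0" by (simp add: ae_rel_def)
lift_definition one_aefun :: aefun is "\<lambda>_. 1" by (simp add: ae_rel_def)
lift_definition plus_aefun :: "aefun \<Rightarrow> aefun \<Rightarrow> aefun" is "\<lambda>f g x. f x + g x"
  unfolding ae_rel_def by (auto elim: eventually_elim2)
lift_definition minus_aefun :: "aefun \<Rightarrow> aefun \<Rightarrow> aefun" is "\<lambda>f g x. f x - g x"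
  unfolding ae_rel_def by (auto elim: eventually_elim2)
lift_definition uminus_aefun :: "aefun \<Rightarrow> aefun" is "\<lambda>f x. - f x"
  unfolding ae_rel_def by (auto elim: eventually_mono)
lift_definition times_aefun :: "aefun \<Rightarrow> aefun \<Rightarrow> aefun" is "\<lambda>f g x. f x * g x"
  unfolding ae_rel_def by (auto elim: eventually_elim2)

instance
  by (standard; transfer; simp add: ae_rel_def algebra_simps not_AE_lborel_False)

end

lift_definition scale_aefun :: "complex \<Rightarrow> aefun \<Rightarrow> aefun" is "\<lambda>c f x. c * f x"
  unfolding ae_rel_def by (auto elim: eventually_mono)

global_interpretation aefun: vector_space scale_aefun
  by (standard; transfer; simp add: ae_rel_def algebra_simps)

text \<open>The dimension \<^term>\<open>aefun.dim V\<close> of the library is \<open>0\<close> when \<open>V\<close> is infinite dimensional,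
  so finite dimensionality is required separately.\<close>

definition dim_at_most :: "aefun set \<Rightarrow> nat \<Rightarrow> bool" where
  "dim_at_most V m \<longleftrightarrow> (\<exists>S. finite S \<and> V \<subseteq> aefun.span S) \<and> aefun.dim V \<le> m"

definition is_direct_sum :: "aefun set \<Rightarrow> aefun set \<Rightarrow> aefun set \<Rightarrow> bool" where
  "is_direct_sum V U W \<longleftrightarrow> aefun.subspace U \<and> aefun.subspace W \<and> V = U + W \<and> U \<inter> W = {0}"

section \<open>Lebesgue and Hardy spaces\<close>

lift_definition in_Lp :: "real \<Rightarrow> aefun \<Rightarrow> bool" is
  "\<lambda>p f. (\<integral>\<^sup>+ x. ennreal (norm (f x) powr p) \<partial>lborel) < \<infinity>"
  unfolding ae_rel_def by (intro arg_cong[of _ _ "\<lambda>t. t < \<infinity>"] nn_integral_cong_AE)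
    (auto elim: eventually_mono)

lift_definition in_Linf :: "aefun \<Rightarrow> bool" is
  "\<lambda>f. \<exists>C. AE x in lborel. norm (f x) \<le> C"
  unfolding ae_rel_def by (intro ex_cong1) (auto elim: eventually_elim2)

definition Lp :: "real \<Rightarrow> aefun set" where
  "Lp p = {f. in_Lp p f}"

definition Linf :: "aefun set" where
  "Linf = {f. in_Linf f}"

text \<open>The sign \<open>\<sigma>\<close> is \<open>1\<close> for the upper and \<open>-1\<close> for the lower half-plane.\<close>

definition half_plane :: "real \<Rightarrow> complex set" where
  "half_plane \<sigma> = {w. \<sigma> * Im w > 0}"

definition hardy_holomorphic :: "real \<Rightarrow> real \<Rightarrow> (complex \<Rightarrow> complex) set" where
  "hardy_holomorphic \<sigma> p = {F. F holomorphic_on half_plane \<sigma> \<and>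
     (\<exists>C::real. \<forall>y>0. (\<integral>\<^sup>+ x. ennreal (norm (F (Complex x (\<sigma> * y))) powr p) \<partial>lborel) \<le> ennreal C)}"

lift_definition has_boundary_values :: "real \<Rightarrow> (complex \<Rightarrow> complex) \<Rightarrow> aefun \<Rightarrow> bool" is
  "\<lambda>\<sigma> F f. AE x in lborel. ((\<lambda>y. F (Complex x (\<sigma> * y))) \<longlongrightarrow> f x) (at_right 0)"
  unfolding ae_rel_def by (auto elim: eventually_elim2)

definition hardy :: "real \<Rightarrow> real \<Rightarrow> aefun set" where
  "hardy \<sigma> p = {f \<in> Lp p. \<exists>F \<in> hardy_holomorphic \<sigma> p. has_boundary_values \<sigma> F f}"

abbreviation H_plus :: "real \<Rightarrow> aefun set" where
  "H_plus \<equiv> hardy 1"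

abbreviation H_minus :: "real \<Rightarrow> aefun set" where
  "H_minus \<equiv> hardy (- 1)"

section \<open>Toeplitz operators and their kernels\<close>

text \<open>The projection \<open>P\<^sup>+\<close> onto \<^term>\<open>H_plus p\<close> with kernel \<^term>\<open>H_minus p\<close> and the operator
  \<open>T\<^sub>g f = P\<^sup>+ (g f)\<close> are given by their graphs. Thus \<^term>\<open>toeplitz_graph p g f h\<close> reads
  \<open>T\<^sub>g f = h\<close>.\<close>

definition P_plus_graph :: "real \<Rightarrow> aefun \<Rightarrow> aefun \<Rightarrow> bool" where
  "P_plus_graph p f h \<longleftrightarrow> h \<in> H_plus p \<and> f - h \<in> H_minus p"

definition toeplitz_graph :: "real \<Rightarrow> aefun \<Rightarrow> aefun \<Rightarrow> aefun \<Rightarrow> bool" where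
  "toeplitz_graph p g f h \<longleftrightarrow> f \<in> H_plus p \<and> P_plus_graph p (g * f) h"

definition toeplitz_kernel :: "real \<Rightarrow> aefun \<Rightarrow> aefun set" where
  "toeplitz_kernel p g = {f. toeplitz_graph p g f 0}"

lemma zero_mem_hardy: "0 \<in> hardy \<sigma> p"
proof -
  have "in_Lp p 0"
    by transfer simp
  moreover have "has_boundary_values \<sigma> (\<lambda>_. 0) 0"
    by transfer simp
  moreover have "(\<lambda>_. 0) \<in> hardy_holomorphic \<sigma> p"
    by (auto simp: hardy_holomorphic_def)
  ultimately show ?thesis
    by (auto simp: hardy_def Lp_def)
qed

lemma toeplitz_kernel_eq: "toeplitz_kernel p g = {f \<in> H_plus p. g * f \<in> H_minus p}"
  by (auto simp: toeplitz_kernel_def toeplitz_graph_def P_plus_graph_def zero_mem_hardy)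

definition T_kernel :: "real \<Rightarrow> aefun set \<Rightarrow> bool" where
  "T_kernel p K \<longleftrightarrow> (\<exists>g \<in> Linf. K = toeplitz_kernel p g)"

definition is_K_min :: "real \<Rightarrow> aefun \<Rightarrow> aefun set \<Rightarrow> bool" where
  "is_K_min p \<phi> K \<longleftrightarrow> T_kernel p K \<and> \<phi> \<in> K \<and>
     (\<forall>g \<in> Linf. \<phi> \<in> toeplitz_kernel p g \<longrightarrow> K \<subseteq> toeplitz_kernel p g)"

definition maximal_function :: "real \<Rightarrow> aefun \<Rightarrow> aefun set \<Rightarrow> bool" where
  "maximal_function p \<phi> K \<longleftrightarrow> \<phi> \<in> H_plus p - {0} \<and> is_K_min p \<phi> K"

section \<open>Blaschke factors and model spaces\<close>

lift_definition lin :: "complex \<Rightarrow> aefun" is "\<lambda>z \<xi>. complex_of_real \<xi> - z"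
  by (simp add: ae_rel_def)

lift_definition blaschke_factor :: "complex \<Rightarrow> aefun" is
  "\<lambda>z \<xi>. (complex_of_real \<xi> - z) / (complex_of_real \<xi> - cnj z)"
  by (simp add: ae_rel_def)

text \<open>From \<^theory>\<open>HOL-Library.Set_Algebras\<close>: \<open>f *o X\<close> is the set of all products \<open>f * x\<close> with
  \<open>x \<in> X\<close>, and \<open>U + W\<close> for sets is the set of all sums.\<close>

definition model_space :: "real \<Rightarrow> aefun \<Rightarrow> aefun set" where
  "model_space p \<theta> = H_plus p \<inter> \<theta> *o H_minus p"

end

theory Submission
  imports Defs "HOL-Complex_Analysis.Complex_Analysis" "HOL-Probability.Probability"
begin

text \<open>The decomposition rests on one property of a maximal function \<open>\<phi>\<close> of \<open>ker T\<^sub>B\<^sub>g\<close>: the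
extension of \<open>\<psi> = B g \<phi>\<close> to the lower half-plane has no zeros
(\<open>maximal_function_nonvanishing\<close>). A zero would put \<open>\<phi>\<close> into a kernel with one more Blaschke factor
\<open>r\<close> in its symbol, so by minimality the whole of \<open>ker T\<^sub>B\<^sub>g\<close> would lie there, and all \<open>r\<^sup>n \<phi>\<close>
would belong to \<open>ker T\<^sub>B\<^sub>g\<close>; minimality against the symbol \<open>cnj \<phi> / \<phi>\<close> then gives \<open>cnj \<phi>\<close> a
zero of infinite order. For \<open>f\<close> in \<open>ker T\<^sub>g\<close> and \<open>k\<close> in \<open>K\<^sub>B\<close>, the function
\<open>f - \<lambda> \<phi> k\<close> lies in \<open>ker T\<^sub>B\<^sub>g\<close> iff \<open>B (g f) - \<lambda> k \<psi>\<close> lies in \<open>H\<^sup>-\<close>. This is an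
interpolation problem at the reflected zeros of \<open>B\<close>, and it is uniquely solvable because
\<open>\<lambda> \<psi>\<close> does not vanish there: existence is \<open>model_space_interpolation\<close>, which yields the sum, and
uniqueness is \<open>model_space_independent\<close>, which yields that it is direct. Both are inductions
on the list of zeros, since one more factor \<open>r\<^sub>w\<close> enlarges \<open>K\<^sub>B\<close> by one dimension
(\<open>model_space_split\<close>, \<open>model_space_extend\<close>).

The threshold on the dimension comes from \<open>dim_kernel_step_down\<close> and \<open>dim_kernel_step_up\<close>: a
Blaschke factor in the symbol imposes one linear condition on the kernel, and it lowers the
dimension by one until the kernel is zero.

Maximal functions exist (\<open>maximal_function_exists\<close>) by inner-outer factorisation. If \<open>f\<^sub>0\<close>
is a nonzero element of \<open>ker T\<^sub>G\<close> and \<open>cnj (G f\<^sub>0) = \<iota> u\<close> with \<open>\<iota>\<close> inner and \<open>u\<close> outer, take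
\<open>\<phi> = \<iota> f\<^sub>0\<close>, so that \<open>G \<phi> = cnj u\<close>. Whenever \<open>h \<phi>\<close> lies in \<open>H\<^sup>-\<close> and \<open>f\<close> in \<open>ker T\<^sub>G\<close>, the
product of \<open>cnj (h f)\<close> and \<open>u\<close> is the product of the Hardy functions \<open>cnj (h \<phi>)\<close> and
\<open>cnj (G f)\<close>, and dividing by an outer function does not leave the Hardy space as long as the
quotient is in \<open>L\<^sub>p\<close> on the line (\<open>outer_quotient\<close>).

The function theory behind this is developed from the definition by means and vertical limits.
The key is the comparison principle \<open>modulus_le_exp_poisson\<close>: a bounded holomorphic function with
boundary modulus at most \<open>exp l\<close> is at most the exponential of the Poisson integral of \<open>l\<close>. It
gives the Poisson formula for bounded functions and Jensen's inequality. The Poisson formula for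
\<open>H\<^sup>p\<close> follows because averages of a Hardy function over horizontal segments are bounded
(\<open>hardy_means_poisson_shift\<close>). Boundary values of the functions constructed here are supplied by
the almost everywhere convergence of Poisson integrals (\<open>AE_poisson_limit\<close>, a maximal
inequality) and by Fatou's theorem for bounded functions (\<open>bounded_holomorphic_boundary\<close>). Division
by outer functions is Jensen's inequality for the numerator and the equality in it that
characterises outer functions.\<close>

section \<open>Harmonic measure of the upper half-plane\<close>

abbreviation upper :: "complex set" where
  "upper \<equiv> {w. 0 < Im w}"

lemma open_upper: "open upper"
  by (simp add: open_halfspace_Im_gt)

lemma convex_upper: "convex upper"
  by (simp add: convex_halfspace_Im_gt)

definition poisson_kernel :: "complex \<Rightarrow> real \<Rightarrow> real" where
  "poisson_kernel w t = Im w / (pi * ((t - Re w)\<^sup>2 + (Im w)\<^sup>2))"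

text \<open>The harmonic measure of the upper half-plane seen from \<open>w\<close>. It is a probability measure, and Poisson
integrals are expectations with respect to it.\<close>

definition pois :: "complex \<Rightarrow> real measure" where
  "pois w = density lborel (\<lambda>t. ennreal (poisson_kernel w t))"

lemma poisson_kernel_measurable [measurable]: "poisson_kernel w \<in> borel_measurable borel"
  unfolding poisson_kernel_def by measurable

lemma sets_pois [simp, measurable_cong]: "sets (pois w) = sets borel"
  by (simp add: pois_def)

lemma space_pois [simp]: "space (pois w) = UNIV"
  by (simp add: pois_def)

lemma poisson_kernel_pos: "0 < Im w \<Longrightarrow> 0 < poisson_kernel w t"
  unfolding poisson_kernel_def
  by (intro divide_pos_pos mult_pos_pos) (auto intro: add_nonneg_pos)

lemma poisson_kernel_le:
  assumes "0 < Im w"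
  shows "poisson_kernel w t \<le> 1 / (pi * Im w)"
proof -
  have "poisson_kernel w t \<le> Im w / (pi * (Im w)\<^sup>2)"
    unfolding poisson_kernel_def using assms
    by (intro divide_left_mono mult_left_mono mult_pos_pos) (auto intro!: add_nonneg_pos)
  also have "\<dots> = 1 / (pi * Im w)"
    using assms by (simp add: power2_eq_square)
  finally show ?thesis .
qed

lemma AE_pois_iff:
  assumes "0 < Im w"
  shows "(AE t in pois w. P t) \<longleftrightarrow> (AE t in lborel. P t)"
  unfolding pois_def using poisson_kernel_pos[OF assms] by (subst AE_density) auto

lemma has_bochner_integral_cauchy_density:
  "has_bochner_integral lborel (\<lambda>t::real. 1 / (1 + t\<^sup>2)) pi"
proof -
  have half: "has_bochner_integral lborel (\<lambda>t::real. indicator {0..} t *\<^sub>R (1 / (1 + t\<^sup>2))) (pi / 2)"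
  proof (rule has_bochner_integral_nn_integral)
    have "(\<integral>\<^sup>+t. ennreal (1 / (1 + t\<^sup>2)) * indicator {0..} t \<partial>lborel) = ennreal (pi / 2 - arctan 0)"
    proof (rule nn_integral_FTC_atLeast)
      show "DERIV arctan x :> 1 / (1 + x\<^sup>2)" for x
        using DERIV_arctan[of x] by (simp add: inverse_eq_divide)
      show "(arctan \<longlongrightarrow> pi / 2) at_top"
        by (rule tendsto_arctan_at_top)
    qed (auto intro: add_nonneg_nonneg)
    also have "(\<integral>\<^sup>+t. ennreal (1 / (1 + t\<^sup>2)) * indicator {0..} t \<partial>lborel) =
        (\<integral>\<^sup>+t. ennreal (indicator {0..} t *\<^sub>R (1 / (1 + t\<^sup>2))) \<partial>lborel)"
      by (intro nn_integral_cong) (auto simp: indicator_def)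
    finally show "(\<integral>\<^sup>+t. ennreal (indicator {0..} t *\<^sub>R (1 / (1 + t\<^sup>2))) \<partial>lborel) = ennreal (pi / 2)"
      by simp
  qed (auto intro: add_nonneg_nonneg)
  have neg: "has_bochner_integral lborel (\<lambda>t::real. indicator {0..} (- t) *\<^sub>R (1 / (1 + t\<^sup>2))) (pi / 2)"
    using half lborel_has_bochner_integral_real_affine_iff[of "-1" "\<lambda>t::real. indicator {0..} t *\<^sub>R (1 / (1 + t\<^sup>2))" "pi / 2" 0]
    by simp
  have "has_bochner_integral lborel (\<lambda>t::real. indicator {0..} t *\<^sub>R (1 / (1 + t\<^sup>2)) +
      indicator {0..} (- t) *\<^sub>R (1 / (1 + t\<^sup>2))) (pi / 2 + pi / 2)"
    by (rule has_bochner_integral_add[OF half neg])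
  then have "has_bochner_integral lborel (\<lambda>t::real. 1 / (1 + t\<^sup>2)) (pi / 2 + pi / 2)"
  proof (rule has_bochner_integral_cong_AE[THEN iffD1, rotated -1])
    have *: "t \<noteq> 0 \<Longrightarrow> indicator {0..} t *\<^sub>R (1 / (1 + t\<^sup>2)) +
        indicator {0..} (- t) *\<^sub>R (1 / (1 + t\<^sup>2)) = 1 / (1 + t\<^sup>2)" for t :: real
      by (cases "0 < t") auto
    show "AE t in (lborel :: real measure). indicator {0..} t *\<^sub>R (1 / (1 + t\<^sup>2)) +
        indicator {0..} (- t) *\<^sub>R (1 / (1 + t\<^sup>2)) = 1 / (1 + t\<^sup>2)"
      by (rule AE_mp[OF AE_lborel_singleton[of 0]], rule AE_I2, rule impI, rule *)
  qed measurable
  then show ?thesis by simp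
qed

lemma has_bochner_integral_poisson_kernel:
  assumes "0 < Im w"
  shows "has_bochner_integral lborel (poisson_kernel w) 1"
proof -
  have "has_bochner_integral lborel (\<lambda>t. poisson_kernel w (Re w + Im w * t)) (1 /\<^sub>R \<bar>Im w\<bar>)"
  proof -
    have "has_bochner_integral lborel (\<lambda>t::real. (1 / (pi * Im w)) * (1 / (1 + t\<^sup>2))) ((1 / (pi * Im w)) * pi)"
      using has_bochner_integral_cauchy_density by (rule has_bochner_integral_mult_right)
    moreover have "(1 / (pi * Im w)) * (1 / (1 + t\<^sup>2)) = poisson_kernel w (Re w + Im w * t)" for t
    proof -
      have "0 < 1 + t\<^sup>2" by (auto intro: add_pos_nonneg)
      moreover have "(Im w * t)\<^sup>2 + (Im w)\<^sup>2 = (Im w)\<^sup>2 * (1 + t\<^sup>2)"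
        by (simp add: algebra_simps power2_eq_square)
      ultimately show ?thesis
        using assms by (simp add: poisson_kernel_def power2_eq_square)
    qed
    moreover have "(1 / (pi * Im w)) * pi = 1 /\<^sub>R \<bar>Im w\<bar>"
      using assms by (simp add: field_simps)
    ultimately show ?thesis
      by simp
  qed
  then show ?thesis
    using assms lborel_has_bochner_integral_real_affine_iff[of "Im w" "poisson_kernel w" 1 "Re w"]
    by simp
qed

lemma prob_space_pois:
  assumes "0 < Im w"
  shows "prob_space (pois w)"
proof
  have "emeasure (pois w) (space (pois w)) = (\<integral>\<^sup>+t. ennreal (poisson_kernel w t) \<partial>lborel)"
    by (simp add: pois_def emeasure_density)
  also have "\<dots> = ennreal 1"
    using has_bochner_integral_poisson_kernel[OF assms] poisson_kernel_pos[OF assms]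
    by (subst nn_integral_eq_integral)
      (auto simp: has_bochner_integral_iff intro: less_imp_le)
  finally show "emeasure (pois w) (space (pois w)) = 1" by simp
qed

lemma integrable_pois_iff:
  fixes f :: "real \<Rightarrow> 'a :: {banach, second_countable_topology}"
  assumes "0 < Im w" "f \<in> borel_measurable borel"
  shows "integrable (pois w) f \<longleftrightarrow> integrable lborel (\<lambda>t. poisson_kernel w t *\<^sub>R f t)"
  unfolding pois_def using assms poisson_kernel_pos[OF assms(1)]
  by (intro integrable_density) (auto intro: less_imp_le)

lemma integral_pois_eq:
  fixes f :: "real \<Rightarrow> 'a :: {banach, second_countable_topology}"
  assumes "0 < Im w" "f \<in> borel_measurable borel"
  shows "integral\<^sup>L (pois w) f = (\<integral>t. poisson_kernel w t *\<^sub>R f t \<partial>lborel)"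
  unfolding pois_def using assms poisson_kernel_pos[OF assms(1)]
  by (intro integral_density) (auto intro: less_imp_le)

lemma poisson_denominator_compare:
  fixes a b a' b' t :: real
  assumes "0 < b"
  shows "(t - a')\<^sup>2 + b'\<^sup>2 \<le> (2 + (2 * (a - a')\<^sup>2 + b'\<^sup>2) / b\<^sup>2) * ((t - a)\<^sup>2 + b\<^sup>2)"
proof -
  define c where "c = (2 * (a - a')\<^sup>2 + b'\<^sup>2) / b\<^sup>2"
  have "(t - a')\<^sup>2 \<le> 2 * (t - a)\<^sup>2 + 2 * (a - a')\<^sup>2"
  proof -
    have "0 \<le> ((t - a) - (a - a'))\<^sup>2" by simp
    then show ?thesis by (simp add: power2_eq_square algebra_simps)
  qed
  moreover have "0 \<le> c * (t - a)\<^sup>2"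
    unfolding c_def by (intro mult_nonneg_nonneg divide_nonneg_nonneg) auto
  moreover have "c * b\<^sup>2 = 2 * (a - a')\<^sup>2 + b'\<^sup>2"
    using assms by (simp add: c_def)
  moreover have "(2 + c) * ((t - a)\<^sup>2 + b\<^sup>2) = 2 * (t - a)\<^sup>2 + 2 * b\<^sup>2 + c * (t - a)\<^sup>2 + c * b\<^sup>2"
    by (simp add: algebra_simps)
  ultimately show ?thesis
    using zero_le_power2[of b] unfolding c_def by linarith
qed

text \<open>This is Harnack's inequality for the kernel. It makes integrability against harmonic measure
independent of the point of view, and integrability is therefore stated at \<open>\<i>\<close> from here on.\<close>

lemma poisson_kernel_compare:
  assumes "0 < Im w" "0 < Im w'"
  obtains C where "0 < C" "\<And>t. poisson_kernel w t \<le> C * poisson_kernel w' t"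
proof
  define C where "C = 2 + (2 * (Re w - Re w')\<^sup>2 + (Im w')\<^sup>2) / (Im w)\<^sup>2"
  have "0 < C" unfolding C_def by (intro add_pos_nonneg) auto
  then show "0 < C * Im w / Im w'" using assms by simp
  fix t
  have *: "(t - Re w')\<^sup>2 + (Im w')\<^sup>2 \<le> C * ((t - Re w)\<^sup>2 + (Im w)\<^sup>2)"
    unfolding C_def by (rule poisson_denominator_compare[OF assms(1)])
  have pos: "0 < (t - Re w')\<^sup>2 + (Im w')\<^sup>2" "0 < (t - Re w)\<^sup>2 + (Im w)\<^sup>2"
    using assms by (auto intro: add_nonneg_pos)
  have "1 / ((t - Re w)\<^sup>2 + (Im w)\<^sup>2) \<le> C / ((t - Re w')\<^sup>2 + (Im w')\<^sup>2)"
    using * pos by (simp add: field_simps)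
  then have "Im w / pi * (1 / ((t - Re w)\<^sup>2 + (Im w)\<^sup>2)) \<le> Im w / pi * (C / ((t - Re w')\<^sup>2 + (Im w')\<^sup>2))"
    using assms by (intro mult_left_mono) auto
  then show "poisson_kernel w t \<le> C * Im w / Im w' * poisson_kernel w' t"
    using assms by (simp add: poisson_kernel_def mult_ac)
qed

text \<open>Harmonic measure concentrates near \<open>x\<close> as the point approaches \<open>x\<close>, with an error linear in the height.\<close>

lemma poisson_kernel_far:
  assumes "d \<le> \<bar>t - x\<bar>" "0 < d" "0 < s"
  shows "poisson_kernel (Complex x s) t \<le> s * (1 + 1 / d\<^sup>2) * poisson_kernel (Complex x 1) t"
proof -
  have dd: "d\<^sup>2 \<le> (t - x)\<^sup>2" using assms by (metis abs_le_square_iff abs_of_pos)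
  have sq: "0 < (t - x)\<^sup>2" "0 < d\<^sup>2" using dd assms(2) by (auto intro: less_le_trans[of 0 "d\<^sup>2"])
  have "(t - x)\<^sup>2 + 1 \<le> (1 + 1 / d\<^sup>2) * ((t - x)\<^sup>2 + s\<^sup>2)"
  proof -
    have "1 \<le> 1 / d\<^sup>2 * (t - x)\<^sup>2" using dd sq by simp
    moreover have "0 \<le> (1 + 1 / d\<^sup>2) * s\<^sup>2" using sq by simp
    moreover have "(1 + 1 / d\<^sup>2) * ((t - x)\<^sup>2 + s\<^sup>2) =
        (t - x)\<^sup>2 + 1 / d\<^sup>2 * (t - x)\<^sup>2 + (1 + 1 / d\<^sup>2) * s\<^sup>2"
      by (simp add: algebra_simps)
    ultimately show ?thesis by linarith
  qed
  then have "1 / ((t - x)\<^sup>2 + s\<^sup>2) \<le> (1 + 1 / d\<^sup>2) / ((t - x)\<^sup>2 + 1)"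
    using sq add_pos_nonneg[OF sq(1), of 1] add_pos_nonneg[OF sq(1), of "s\<^sup>2"]
    by (simp add: pos_divide_le_eq pos_le_divide_eq mult.commute)
  then have "s / pi * (1 / ((t - x)\<^sup>2 + s\<^sup>2)) \<le> s / pi * ((1 + 1 / d\<^sup>2) / ((t - x)\<^sup>2 + 1))"
    using assms by (intro mult_left_mono) auto
  then show ?thesis
    by (simp add: poisson_kernel_def mult_ac)
qed

lemma integrable_pois_transfer:
  fixes f :: "real \<Rightarrow> 'a :: {banach, second_countable_topology}"
  assumes "integrable (pois w) f" "0 < Im w" "0 < Im w'"
  shows "integrable (pois w') f"
proof -
  have f [measurable]: "f \<in> borel_measurable borel"
    using borel_measurable_integrable[OF assms(1)] by simp
  obtain C where C: "0 < C" "\<And>t. poisson_kernel w' t \<le> C * poisson_kernel w t"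
    using poisson_kernel_compare[OF assms(3,2)] by blast
  have "integrable lborel (\<lambda>t. C *\<^sub>R (poisson_kernel w t *\<^sub>R f t))"
    using assms(1,2) f by (intro integrable_scaleR_right) (simp add: integrable_pois_iff)
  then have "integrable lborel (\<lambda>t. poisson_kernel w' t *\<^sub>R f t)"
  proof (rule Bochner_Integration.integrable_bound)
    show "AE t in lborel. norm (poisson_kernel w' t *\<^sub>R f t) \<le> norm (C *\<^sub>R (poisson_kernel w t *\<^sub>R f t))"
    proof (intro AE_I2)
      fix t
      have "poisson_kernel w' t * norm (f t) \<le> C * poisson_kernel w t * norm (f t)"
        by (intro mult_right_mono C) auto
      then show "norm (poisson_kernel w' t *\<^sub>R f t) \<le> norm (C *\<^sub>R (poisson_kernel w t *\<^sub>R f t))"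
        using poisson_kernel_pos[OF assms(2), of t] poisson_kernel_pos[OF assms(3), of t] C(1)
        by (simp add: abs_mult)
    qed
  qed measurable
  then show ?thesis using assms(3) f by (simp add: integrable_pois_iff)
qed

section \<open>Schwarz integrals\<close>

text \<open>The normalisation is \<open>schwarz_kernel \<i> t = 1\<close>. Relative to harmonic measure at \<open>\<i>\<close> the kernel is bounded in
\<open>t\<close>, and its real part is the density of harmonic measure at \<open>w\<close>; so the Schwarz integral completes the
Poisson integral of \<open>l\<close> to a holomorphic function as soon as the latter converges.\<close>

definition schwarz_kernel :: "complex \<Rightarrow> real \<Rightarrow> complex" where
  "schwarz_kernel w t = - \<i> * (1 + of_real t * w) / (of_real t - w)"

definition schwarz :: "(real \<Rightarrow> real) \<Rightarrow> complex \<Rightarrow> complex" where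
  "schwarz l w = (\<integral>t. schwarz_kernel w t * of_real (l t) \<partial>pois \<i>)"

lemma schwarz_kernel_measurable [measurable]: "schwarz_kernel w \<in> borel_measurable borel"
  unfolding schwarz_kernel_def by measurable

lemma of_real_minus_upper: "0 < Im w \<Longrightarrow> of_real t - w \<noteq> 0"
  by (auto simp: complex_eq_iff)

lemma Re_schwarz_kernel:
  assumes "0 < Im w"
  shows "poisson_kernel \<i> t * Re (schwarz_kernel w t) = poisson_kernel w t"
proof -
  have "1 + t\<^sup>2 > 0" by (auto intro: add_pos_nonneg)
  moreover have "(t - Re w)\<^sup>2 + (Im w)\<^sup>2 > 0" using assms by (auto intro: add_nonneg_pos)
  moreover have "Re (schwarz_kernel w t) = Im w * (1 + t\<^sup>2) / ((t - Re w)\<^sup>2 + (Im w)\<^sup>2)"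
    unfolding schwarz_kernel_def Re_divide
    by (simp add: power2_eq_square algebra_simps)
  ultimately show ?thesis
    by (simp add: poisson_kernel_def add.commute)
qed

lemma norm_of_real_minus_sq: "(norm (of_real t - w))\<^sup>2 = (t - Re w)\<^sup>2 + (Im w)\<^sup>2"
  by (simp add: cmod_power2)

lemma schwarz_kernel_bound:
  assumes "0 < Im w"
  obtains C where "\<And>t. norm (schwarz_kernel w t) \<le> C"
proof -
  define C where "C = norm w + norm (1 + w\<^sup>2) / Im w"
  have "norm (schwarz_kernel w t) \<le> C" for t
  proof -
    have ge: "Im w \<le> norm (of_real t - w)"
      using abs_Im_le_cmod[of "of_real t - w"] assms by simp
    have "1 + of_real t * w = w * (of_real t - w) + (1 + w\<^sup>2)"
      by (simp add: algebra_simps power2_eq_square)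
    then have "(1 + of_real t * w) / (of_real t - w) = w + (1 + w\<^sup>2) / (of_real t - w)"
      using of_real_minus_upper[OF assms, of t] by (simp add: add_divide_distrib)
    moreover have "schwarz_kernel w t = - \<i> * ((1 + of_real t * w) / (of_real t - w))"
      by (simp add: schwarz_kernel_def)
    ultimately have "norm (schwarz_kernel w t) = norm (w + (1 + w\<^sup>2) / (of_real t - w))"
      by (simp add: norm_mult)
    also have "\<dots> \<le> norm w + norm (1 + w\<^sup>2) / norm (of_real t - w)"
      by (metis norm_divide norm_triangle_ineq)
    also have "\<dots> \<le> C" unfolding C_def
      using ge assms by (intro add_left_mono divide_left_mono) (auto intro!: mult_pos_pos)
    finally show ?thesis .
  qed
  then show thesis by (rule that)
qed

lemma integrable_schwarz:
  assumes "0 < Im w" "integrable (pois \<i>) l"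
  shows "integrable (pois \<i>) (\<lambda>t. schwarz_kernel w t * of_real (l t))"
proof -
  obtain C where C: "\<And>t. norm (schwarz_kernel w t) \<le> C" using schwarz_kernel_bound[OF assms(1)] by blast
  have [measurable]: "l \<in> borel_measurable borel"
    using borel_measurable_integrable[OF assms(2)] by simp
  have "integrable (pois \<i>) (\<lambda>t. C * l t)" using assms(2) by simp
  then show ?thesis
  proof (rule Bochner_Integration.integrable_bound)
    show "AE t in pois \<i>. norm (schwarz_kernel w t * of_real (l t)) \<le> norm (C * l t)"
      using C by (intro AE_I2) (auto simp: norm_mult abs_mult intro!: mult_right_mono intro: order_trans[OF C])
  qed measurable
qed

lemma Re_schwarz:
  assumes "0 < Im w" "integrable (pois \<i>) l"
  shows "Re (schwarz l w) = (\<integral>t. l t \<partial>pois w)"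
proof -
  have [measurable]: "l \<in> borel_measurable borel"
    using borel_measurable_integrable[OF assms(2)] by simp
  have "Re (schwarz l w) = (\<integral>t. Re (schwarz_kernel w t * of_real (l t)) \<partial>pois \<i>)"
    unfolding schwarz_def by (rule integral_Re[symmetric]) (rule integrable_schwarz[OF assms])
  also have "\<dots> = (\<integral>t. Re (schwarz_kernel w t) * l t \<partial>pois \<i>)" by simp
  also have "\<dots> = (\<integral>t. poisson_kernel \<i> t *\<^sub>R (Re (schwarz_kernel w t) * l t) \<partial>lborel)"
    by (subst integral_pois_eq) auto
  also have "\<dots> = (\<integral>t. poisson_kernel w t *\<^sub>R l t \<partial>lborel)"
    using Re_schwarz_kernel[OF assms(1)] by (simp add: mult.assoc[symmetric])
  also have "\<dots> = (\<integral>t. l t \<partial>pois w)"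
    using assms(1) by (subst integral_pois_eq) auto
  finally show ?thesis .
qed

lemma schwarz_kernel_diff:
  assumes "0 < Im w" "0 < Im w0"
  shows "schwarz_kernel w t - schwarz_kernel w0 t =
    - \<i> * (1 + (of_real t)\<^sup>2) / ((of_real t - w) * (of_real t - w0)) * (w - w0)"
  unfolding schwarz_kernel_def
  using of_real_minus_upper[OF assms(1), of t] of_real_minus_upper[OF assms(2), of t]
  by (simp add: divide_simps) (simp add: algebra_simps power2_eq_square)

text \<open>The difference quotients of the kernel are bounded uniformly in \<open>t\<close> near a point, so one can
differentiate under the integral sign by dominated convergence.\<close>

lemma holomorphic_schwarz:
  assumes l: "integrable (pois \<i>) l"
  shows "schwarz l holomorphic_on upper"
proof (rule holomorphic_onI)
  fix w0 assume "w0 \<in> upper"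
  then have w0: "0 < Im w0" by simp
  define U where "U = ball w0 (Im w0 / 2)"
  have U: "Im w0 / 2 < Im w" if "w \<in> U" for w
    using that abs_Im_le_cmod[of "w0 - w"] by (auto simp: U_def dist_norm)
  have [measurable]: "l \<in> borel_measurable borel"
    using borel_measurable_integrable[OF l] by simp
  define D where "D = (\<lambda>w t. - \<i> * (1 + (of_real t)\<^sup>2) / ((of_real t - w) * (of_real t - w0)) :: complex)"
  \<comment> \<open>\<open>1 + t\<^sup>2\<close> is at most \<open>C / 2\<close> times the square of \<open>\<bar>t - w0\<bar>\<close>, which is at most \<open>2 \<bar>t - w\<bar>\<close>.\<close>
  define C where "C = 2 * (2 + (2 * (Re w0 - 0)\<^sup>2 + 1\<^sup>2) / (Im w0)\<^sup>2)"
  have C2: "C / 2 = 2 + (2 * (Re w0)\<^sup>2 + 1) / (Im w0)\<^sup>2" by (simp add: C_def)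
  have bound: "norm (D w t) \<le> C" if w: "w \<in> U" for w t
  proof -
    have "norm (of_real t - w0) \<le> norm (of_real t - w) + norm (w - w0)"
      using norm_triangle_ineq[of "of_real t - w" "w - w0"] by simp
    moreover have "norm (w - w0) \<le> Im w0 / 2"
      using w by (simp add: U_def dist_norm norm_minus_commute)
    moreover have "Im w0 / 2 \<le> norm (of_real t - w)"
      using abs_Im_le_cmod[of "of_real t - w"] U[OF w] by simp
    ultimately have le2: "norm (of_real t - w0) \<le> 2 * norm (of_real t - w)" by linarith
    have pos: "0 < norm (of_real t - w0)" using of_real_minus_upper[OF w0] by simp
    have "norm (1 + (of_real t)\<^sup>2 :: complex) = 1 + t\<^sup>2"
    proof -
      have "1 + (of_real t)\<^sup>2 = (of_real (1 + t\<^sup>2) :: complex)" by simp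
      then show ?thesis by (metis norm_of_real abs_of_nonneg add_nonneg_nonneg zero_le_one zero_le_power2)
    qed
    also have "1 + t\<^sup>2 \<le> C / 2 * (norm (of_real t - w0))\<^sup>2"
      using poisson_denominator_compare[OF w0, of t 0 1 "Re w0"]
      by (simp add: C2 norm_of_real_minus_sq add.commute)
    also have "C / 2 * (norm (of_real t - w0))\<^sup>2 \<le> C / 2 * (2 * norm (of_real t - w) * norm (of_real t - w0))"
      using le2 pos unfolding power2_eq_square C_def
      by (intro mult_left_mono mult_right_mono) (auto intro!: add_nonneg_nonneg)
    finally have "norm (1 + (of_real t)\<^sup>2 :: complex) \<le> C * (norm (of_real t - w) * norm (of_real t - w0))"
      by (simp add: mult_ac)
    moreover have "0 < norm (of_real t - w) * norm (of_real t - w0)"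
      using pos le2 by (intro mult_pos_pos) linarith+
    ultimately show ?thesis
      by (simp add: D_def norm_mult norm_divide divide_le_eq)
  qed
  have lim: "((\<lambda>w. \<integral>t. D w t * of_real (l t) \<partial>pois \<i>) \<longlongrightarrow>
     (\<integral>t. D w0 t * of_real (l t) \<partial>pois \<i>)) (at w0 within U)"
    unfolding tendsto_at_iff_sequentially comp_def
  proof (intro allI impI)
    fix X assume X: "\<forall>i. X i \<in> U - {w0}" "X \<longlonglongrightarrow> w0"
    show "(\<lambda>n. \<integral>t. D (X n) t * of_real (l t) \<partial>pois \<i>) \<longlonglongrightarrow> (\<integral>t. D w0 t * of_real (l t) \<partial>pois \<i>)"
    proof (rule integral_dominated_convergence[where w = "\<lambda>t. C * \<bar>l t\<bar>"])
      show "integrable (pois \<i>) (\<lambda>t. C * \<bar>l t\<bar>)" using l by simp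
      show "AE t in pois \<i>. (\<lambda>n. D (X n) t * of_real (l t)) \<longlonglongrightarrow> D w0 t * of_real (l t)"
      proof (intro AE_I2)
        fix t show "(\<lambda>n. D (X n) t * of_real (l t)) \<longlonglongrightarrow> D w0 t * of_real (l t)"
          unfolding D_def using of_real_minus_upper[OF w0, of t]
          by (intro tendsto_intros X) auto
      qed
      show "AE t in pois \<i>. norm (D (X n) t * of_real (l t)) \<le> C * \<bar>l t\<bar>" for n
        using X bound by (intro AE_I2) (auto simp: norm_mult intro!: mult_right_mono)
    qed (unfold D_def, measurable)
  qed
  have "((\<lambda>w. (schwarz l w - schwarz l w0) / (w - w0)) \<longlongrightarrow>
     (\<integral>t. D w0 t * of_real (l t) \<partial>pois \<i>)) (at w0 within U)"
  proof (rule Lim_transform_eventually[OF lim])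
    show "\<forall>\<^sub>F w in at w0 within U. (\<integral>t. D w t * of_real (l t) \<partial>pois \<i>) = (schwarz l w - schwarz l w0) / (w - w0)"
      unfolding eventually_at_filter
    proof (intro always_eventually allI impI)
      fix w assume w: "w \<noteq> w0" "w \<in> U"
      then have Imw: "0 < Im w" using U[of w] w0 by linarith
      have "schwarz l w - schwarz l w0 =
          (\<integral>t. schwarz_kernel w t * of_real (l t) - schwarz_kernel w0 t * of_real (l t) \<partial>pois \<i>)"
        unfolding schwarz_def
        by (rule Bochner_Integration.integral_diff[symmetric]) (intro integrable_schwarz Imw w0 l)+
      also have "\<dots> = (\<integral>t. (D w t * of_real (l t)) * (w - w0) \<partial>pois \<i>)"
      proof (rule Bochner_Integration.integral_cong[OF refl])
        fix t
        have "schwarz_kernel w t * of_real (l t) - schwarz_kernel w0 t * of_real (l t) =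
          (schwarz_kernel w t - schwarz_kernel w0 t) * of_real (l t)"
          by (simp add: algebra_simps)
        then show "schwarz_kernel w t * of_real (l t) - schwarz_kernel w0 t * of_real (l t) =
          (D w t * of_real (l t)) * (w - w0)"
          unfolding schwarz_kernel_diff[OF Imw w0] D_def by (simp add: mult_ac)
      qed
      also have "\<dots> = (\<integral>t. D w t * of_real (l t) \<partial>pois \<i>) * (w - w0)" by simp
      finally show "(\<integral>t. D w t * of_real (l t) \<partial>pois \<i>) = (schwarz l w - schwarz l w0) / (w - w0)"
        using w by simp
    qed
  qed
  then have "(schwarz l has_field_derivative (\<integral>t. D w0 t * of_real (l t) \<partial>pois \<i>)) (at w0 within U)"
    by (simp add: has_field_derivative_iff)
  moreover have "w0 \<in> U" "open U" using w0 by (auto simp: U_def)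
  ultimately have "schwarz l field_differentiable (at w0)"
    using at_within_open field_differentiable_def by metis
  then show "schwarz l field_differentiable (at w0 within upper)"
    by (rule field_differentiable_at_within)
qed

section \<open>Boundary behaviour and the maximum principle\<close>

lemma integrable_pois_bounded:
  fixes f :: "real \<Rightarrow> 'a :: {banach, second_countable_topology}"
  assumes "0 < Im w" "f \<in> borel_measurable borel" "\<And>t. norm (f t) \<le> M"
  shows "integrable (pois w) f"
proof -
  interpret prob_space "pois w" by (rule prob_space_pois[OF assms(1)])
  show ?thesis using assms by (intro integrable_const_bound[of _ M]) auto
qed

text \<open>Points at distance less than \<open>d\<close> contribute at most \<open>e / 2\<close> by uniform continuity, and the remaining
mass is of the order of the height by \<open>poisson_kernel_far\<close>.\<close>

lemma poisson_uniform_limit: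
  fixes l :: "real \<Rightarrow> real"
  assumes unif: "uniformly_continuous_on UNIV l" and bdd: "\<And>t. \<bar>l t\<bar> \<le> M" and "0 < e"
  obtains s0 where "0 < s0" "\<And>s x. 0 < s \<Longrightarrow> s < s0 \<Longrightarrow> \<bar>(\<integral>t. l t \<partial>pois (Complex x s)) - l x\<bar> \<le> e"
proof -
  have [measurable]: "l \<in> borel_measurable borel"
    using unif by (intro borel_measurable_continuous_onI uniformly_continuous_imp_continuous)
  have M: "0 \<le> M" using bdd[of 0] by linarith
  obtain d where d: "0 < d" "\<And>x t. dist t x < d \<Longrightarrow> dist (l t) (l x) < e / 2"
    using unif \<open>0 < e\<close> unfolding uniformly_continuous_on_def by (metis UNIV_I half_gt_zero)
  define Q where "Q = 2 * M * (1 + 1 / d\<^sup>2)"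
  have Q: "0 \<le> Q" unfolding Q_def using M by simp
  show thesis
  proof (rule that)
    show "0 < min 1 (e / (2 * (Q + 1)))" using \<open>0 < e\<close> Q by simp
    fix s x :: real assume s: "0 < s" "s < min 1 (e / (2 * (Q + 1)))"
    let ?w = "Complex x s" and ?v = "Complex x 1"
    have up: "0 < Im ?w" "0 < Im ?v" using s by auto
    interpret W: prob_space "pois ?w" by (rule prob_space_pois[OF up(1)])
    have il: "integrable (pois ?w) l"
      using bdd up by (intro integrable_pois_bounded[of _ _ M]) auto
    have int1: "has_bochner_integral lborel (poisson_kernel ?w) 1" "has_bochner_integral lborel (poisson_kernel ?v) 1"
      using up by (auto intro!: has_bochner_integral_poisson_kernel)
    have "\<bar>(\<integral>t. l t \<partial>pois ?w) - l x\<bar> = \<bar>\<integral>t. l t - l x \<partial>pois ?w\<bar>"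
      using il W.prob_space by (subst Bochner_Integration.integral_diff) auto
    also have "\<dots> \<le> (\<integral>t. \<bar>l t - l x\<bar> \<partial>pois ?w)" by (rule integral_abs_bound)
    also have "\<dots> = (\<integral>t. poisson_kernel ?w t *\<^sub>R \<bar>l t - l x\<bar> \<partial>lborel)"
      using up by (subst integral_pois_eq) auto
    also have "\<dots> \<le> (\<integral>t. e / 2 * poisson_kernel ?w t + Q * s * poisson_kernel ?v t \<partial>lborel)"
    proof (rule integral_mono)
      have "integrable (pois ?w) (\<lambda>t. \<bar>l t - l x\<bar>)" using il by auto
      then show "integrable lborel (\<lambda>t. poisson_kernel ?w t *\<^sub>R \<bar>l t - l x\<bar>)"
        using up by (subst (asm) integrable_pois_iff) auto
      show "integrable lborel (\<lambda>t. e / 2 * poisson_kernel ?w t + Q * s * poisson_kernel ?v t)"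
        using int1 by (auto simp: has_bochner_integral_iff)
      fix t
      have pp: "0 < poisson_kernel ?w t" "0 < poisson_kernel ?v t" using up by (auto intro: poisson_kernel_pos)
      show "poisson_kernel ?w t *\<^sub>R \<bar>l t - l x\<bar> \<le> e / 2 * poisson_kernel ?w t + Q * s * poisson_kernel ?v t"
      proof (cases "dist t x < d")
        case True
        then have "\<bar>l t - l x\<bar> \<le> e / 2" using d(2)[of t x] by (simp add: dist_real_def)
        then have "poisson_kernel ?w t * \<bar>l t - l x\<bar> \<le> poisson_kernel ?w t * (e / 2)"
          using pp by (intro mult_left_mono) auto
        moreover have "0 \<le> Q * s * poisson_kernel ?v t" using pp Q s by auto
        ultimately show ?thesis by (simp add: mult_ac)
      next
        case False
        then have "d \<le> \<bar>t - x\<bar>" by (simp add: dist_real_def)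
        have "poisson_kernel ?w t \<le> s * (1 + 1 / d\<^sup>2) * poisson_kernel ?v t"
          using \<open>d \<le> \<bar>t - x\<bar>\<close> d(1) s(1) by (rule poisson_kernel_far)
        moreover have "\<bar>l t - l x\<bar> \<le> 2 * M" using bdd[of t] bdd[of x] by linarith
        ultimately have "poisson_kernel ?w t * \<bar>l t - l x\<bar> \<le> (s * (1 + 1 / d\<^sup>2) * poisson_kernel ?v t) * (2 * M)"
          using pp by (intro mult_mono) auto
        then have "poisson_kernel ?w t * \<bar>l t - l x\<bar> \<le> Q * s * poisson_kernel ?v t"
          by (simp add: Q_def algebra_simps)
        moreover have "0 \<le> e / 2 * poisson_kernel ?w t" using pp \<open>0 < e\<close> by auto
        ultimately show ?thesis by simp
      qed
    qed
    also have "\<dots> = e / 2 + Q * s"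
      using int1 by (simp add: has_bochner_integral_iff)
    also have "\<dots> \<le> e"
    proof -
      have "(Q + 1) * s \<le> (Q + 1) * (e / (2 * (Q + 1)))" using s Q by (intro mult_left_mono) auto
      moreover have "(Q + 1) * (e / (2 * (Q + 1))) = e / 2" using Q by (simp add: divide_simps)
      ultimately have "(Q + 1) * s \<le> e / 2" by linarith
      then show ?thesis using s by (simp add: algebra_simps)
    qed
    finally show "\<bar>(\<integral>t. l t \<partial>pois ?w) - l x\<bar> \<le> e" .
  qed
qed

text \<open>A Phragmen-Lindelof argument: dividing by \<open>1 - \<i> d w\<close>, whose modulus on the half-plane is at least 1,
makes the function small on large circles. The ordinary maximum principle applies to the part of a
disc above a horizontal line, and then \<open>d\<close> tends to 0.\<close>

lemma upper_maximum_principle: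
  assumes hol: "F holomorphic_on upper" and bdd: "\<And>w. w \<in> upper \<Longrightarrow> norm (F w) \<le> M"
    and lim: "\<And>e. 0 < e \<Longrightarrow> \<exists>s0>0. \<forall>s x. 0 < s \<longrightarrow> s < s0 \<longrightarrow> norm (F (Complex x s)) \<le> 1 + e"
    and w: "w \<in> upper"
  shows "norm (F w) \<le> 1"
proof (rule field_le_epsilon)
  fix e :: real assume e: "0 < e"
  obtain s0 where s0: "0 < s0" "\<And>s x. 0 < s \<Longrightarrow> s < s0 \<Longrightarrow> norm (F (Complex x s)) \<le> 1 + e"
    using lim[OF e] by blast
  define s where "s = min (s0 / 2) (Im w / 2)"
  have s: "0 < s" "s < s0" "s < Im w" using s0 w by (auto simp: s_def min_def)
  have M: "0 \<le> M" using bdd[OF w] norm_ge_zero order_trans by blast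
  have main: "norm (F w) \<le> (1 + e) * norm (1 - \<i> * of_real d * w)" if d: "0 < d" for d
  proof -
    \<comment> \<open>On the circle of radius \<open>R\<close> the denominator is at least \<open>d R\<close>, hence at least \<open>M\<close>.\<close>
    define R where "R = max (norm w + 1) (M / d)"
    have "norm w + 1 \<le> R" "M / d \<le> R" by (auto simp: R_def)
    then have R: "norm w < R" "M \<le> d * R" "0 < R"
      using d norm_ge_zero[of w] by (auto simp: field_simps simp del: norm_ge_zero)
    define S where "S = {z. s < Im z} \<inter> ball 0 R"
    define G where "G = (\<lambda>z. F z / (1 - \<i> * of_real d * z))"
    have low: "1 \<le> norm (1 - \<i> * of_real d * z)" "d * norm z \<le> norm (1 - \<i> * of_real d * z)"
      if "0 < Im z" for z
    proof -
      have pos: "0 \<le> d * Im z" using that d by simp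
      show "1 \<le> norm (1 - \<i> * of_real d * z)"
        using complex_Re_le_cmod[of "1 - \<i> * of_real d * z"] pos by simp
      have "(d * norm z)\<^sup>2 \<le> (norm (1 - \<i> * of_real d * z))\<^sup>2"
        unfolding power_mult_distrib cmod_power2 using pos by (simp add: power2_eq_square algebra_simps)
      then show "d * norm z \<le> norm (1 - \<i> * of_real d * z)"
        by (rule power2_le_imp_le) simp
    qed
    have nz: "1 - \<i> * of_real d * z \<noteq> 0" if "0 < Im z" for z using low(1)[OF that] by auto
    have Ghol: "G holomorphic_on upper"
      unfolding G_def using nz by (intro holomorphic_intros hol) auto
    have opS: "open S" unfolding S_def by (intro open_Int open_halfspace_Im_gt open_ball)
    have cl: "closure S \<subseteq> {z. s \<le> Im z} \<inter> cball 0 R"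
      unfolding S_def by (rule closure_minimal) (auto intro!: closed_Int closed_halfspace_Im_ge)
    have clup: "closure S \<subseteq> upper" using cl s by fastforce
    have "norm (G w) \<le> 1 + e"
    proof (rule maximum_modulus_frontier[where f = G and S = S])
      show "G holomorphic_on interior S"
        using Ghol clup closure_subset interior_subset by (meson holomorphic_on_subset order_trans)
      show "continuous_on (closure S) G"
        using holomorphic_on_imp_continuous_on[OF Ghol] clup by (rule continuous_on_subset)
      show "bounded S" unfolding S_def by auto
      show "w \<in> S" using s R by (simp add: S_def)
      fix z assume z: "z \<in> frontier S"
      then have zc: "z \<in> closure S" "z \<notin> S" using opS by (auto simp: frontier_def interior_open)
      then have zi: "s \<le> Im z" "norm z \<le> R" using cl by auto
      have zup: "0 < Im z" using zi s by linarith
      consider "Im z = s" | "norm z = R" using zc(2) zi by (force simp: S_def)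
      then show "norm (G z) \<le> 1 + e"
      proof cases
        case 1
        have "z = Complex (Re z) s" using 1 by (simp add: complex_eq_iff)
        then have "norm (F z) \<le> 1 + e" using s0(2)[of s "Re z"] s by simp
        also have "1 + e \<le> (1 + e) * norm (1 - \<i> * of_real d * z)"
          using low(1)[OF zup] e by (simp add: mult_le_cancel_left1)
        finally show ?thesis using nz[OF zup] by (simp add: G_def norm_divide divide_le_eq)
      next
        case 2
        have "norm (F z) \<le> M" using bdd zup by simp
        also have "M \<le> norm (1 - \<i> * of_real d * z)" using low(2)[OF zup] R 2 by simp
        also have "\<dots> \<le> (1 + e) * norm (1 - \<i> * of_real d * z)" using e by (simp add: distrib_right)
        finally show ?thesis using nz[OF zup] by (simp add: G_def norm_divide divide_le_eq)
      qed
    qed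
    then show ?thesis using nz[of w] w by (simp add: G_def norm_divide divide_le_eq)
  qed
  have "((\<lambda>d. (1 + e) * norm (1 - \<i> * of_real d * w)) \<longlongrightarrow> (1 + e) * norm (1 - \<i> * of_real 0 * w)) (at_right 0)"
    by (intro tendsto_intros)
  moreover have "\<forall>\<^sub>F d in at_right 0. norm (F w) \<le> (1 + e) * norm (1 - \<i> * of_real d * w)"
    unfolding eventually_at_right_field using main by (intro exI[of _ 1]) auto
  ultimately have "norm (F w) \<le> (1 + e) * norm (1 - \<i> * of_real 0 * w)"
    by (rule tendsto_lowerbound) simp
  then show "norm (F w) \<le> 1 + e" by simp
qed

text \<open>The quotient of \<open>F\<close> by the zero-free function \<open>exp (schwarz l)\<close>, whose modulus is the exponential of the
Poisson integral of \<open>l\<close>, has boundary modulus at most 1.\<close>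

lemma modulus_le_exp_poisson:
  fixes l :: "real \<Rightarrow> real"
  assumes hol: "F holomorphic_on upper" and bdd: "\<And>w. w \<in> upper \<Longrightarrow> norm (F w) \<le> M"
    and unif: "uniformly_continuous_on UNIV l" and lb: "\<And>t. \<bar>l t\<bar> \<le> L"
    and lim: "\<And>e. 0 < e \<Longrightarrow> \<exists>s0>0. \<forall>s x. 0 < s \<longrightarrow> s < s0 \<longrightarrow> norm (F (Complex x s)) \<le> exp (l x + e)"
    and w: "w \<in> upper"
  shows "norm (F w) \<le> exp (\<integral>t. l t \<partial>pois w)"
proof -
  have [measurable]: "l \<in> borel_measurable borel"
    using unif by (intro borel_measurable_continuous_onI uniformly_continuous_imp_continuous)
  have il: "integrable (pois v) l" if "0 < Im v" for v
    using lb by (intro integrable_pois_bounded[OF that, of _ L]) auto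
  have L: "\<bar>\<integral>t. l t \<partial>pois v\<bar> \<le> L" if v: "0 < Im v" for v
  proof -
    interpret prob_space "pois v" by (rule prob_space_pois[OF v])
    have "\<bar>\<integral>t. l t \<partial>pois v\<bar> \<le> (\<integral>t. \<bar>l t\<bar> \<partial>pois v)" by (rule integral_abs_bound)
    also have "\<dots> \<le> L" using il[OF v] lb by (intro integral_le_const) auto
    finally show ?thesis .
  qed
  define G where "G = (\<lambda>w. F w * exp (- schwarz l w))"
  have nG: "norm (G v) = norm (F v) * exp (- (\<integral>t. l t \<partial>pois v))" if "0 < Im v" for v
    using Re_schwarz[OF that il] by (simp add: G_def norm_mult)
  have "norm (G w) \<le> 1"
  proof (rule upper_maximum_principle[where F = G and M = "M * exp L", OF _ _ _ w])
    show "G holomorphic_on upper"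
      unfolding G_def by (intro holomorphic_intros hol holomorphic_schwarz il) auto
    show "norm (G v) \<le> M * exp L" if "v \<in> upper" for v
      using that bdd[OF that] L[of v] order_trans[OF norm_ge_zero bdd[OF that]] by (subst nG) (auto intro!: mult_mono)
    show "\<exists>s0>0. \<forall>s x. 0 < s \<longrightarrow> s < s0 \<longrightarrow> norm (G (Complex x s)) \<le> 1 + e" if e: "0 < e" for e
    proof -
      \<comment> \<open>The two errors, of \<open>F\<close> and of the Poisson integral, together cost \<open>exp (2 h) = 1 + e\<close>.\<close>
      define h where "h = ln (1 + e) / 2"
      have h: "0 < h" "exp (2 * h) = 1 + e" using e by (auto simp: h_def)
      obtain s1 where s1: "0 < s1" "\<And>s x. 0 < s \<Longrightarrow> s < s1 \<Longrightarrow> norm (F (Complex x s)) \<le> exp (l x + h)"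
        using lim[OF h(1)] by blast
      obtain s2 where s2: "0 < s2" "\<And>s x. 0 < s \<Longrightarrow> s < s2 \<Longrightarrow> \<bar>(\<integral>t. l t \<partial>pois (Complex x s)) - l x\<bar> \<le> h"
        using poisson_uniform_limit[OF unif lb h(1)] by blast
      have "norm (G (Complex x s)) \<le> 1 + e" if "0 < s" "s < min s1 s2" for s x
      proof -
        have "norm (G (Complex x s)) \<le> exp (l x + h) * exp (- (\<integral>t. l t \<partial>pois (Complex x s)))"
          using s1(2)[of s x] that by (subst nG) auto
        also have "\<dots> \<le> exp (l x + h) * exp (- l x + h)"
          using s2(2)[of s x] that by (intro mult_left_mono) auto
        also have "\<dots> = exp (2 * h)" by (simp add: exp_add[symmetric])
        finally show ?thesis using h by simp
      qed
      then show ?thesis using s1(1) s2(1) by (intro exI[of _ "min s1 s2"]) auto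
    qed
  qed
  then have "norm (F w) * exp (- (\<integral>t. l t \<partial>pois w)) * exp (\<integral>t. l t \<partial>pois w) \<le> 1 * exp (\<integral>t. l t \<partial>pois w)"
    using w nG[of w] by (intro mult_right_mono) auto
  then show ?thesis by (simp add: mult.assoc exp_add[symmetric])
qed

section \<open>Bounded holomorphic functions\<close>

text \<open>Cauchy's estimate bounds the derivative at height \<open>e\<close> and above.\<close>

lemma bounded_holomorphic_Lipschitz:
  assumes hol: "F holomorphic_on upper" and bdd: "\<And>w. w \<in> upper \<Longrightarrow> norm (F w) \<le> M"
    and "0 < e" "e \<le> Im a" "e \<le> Im b"
  shows "norm (F a - F b) \<le> 2 * M / e * norm (a - b)"
proof (rule field_differentiable_bound[where S = "{w. e \<le> Im w}" and f = F and f' = "deriv F" and x = a and y = b])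
  show "convex {w. e \<le> Im w}" by (simp add: convex_halfspace_Im_ge)
  show "(F has_field_derivative deriv F z) (at z within {w. e \<le> Im w})" if "z \<in> {w. e \<le> Im w}" for z
    using that \<open>0 < e\<close> by (auto intro!: has_field_derivative_at_within[OF holomorphic_derivI[OF hol open_upper]])
  show "norm (deriv F z) \<le> 2 * M / e" if z: "z \<in> {w. e \<le> Im w}" for z
  proof -
    have sub: "cball z (e / 2) \<subseteq> upper"
    proof
      fix y assume "y \<in> cball z (e / 2)"
      then have "\<bar>Im z - Im y\<bar> \<le> e / 2"
        using abs_Im_le_cmod[of "z - y"] by (simp add: dist_norm)
      then have "Im z - Im y \<le> e / 2" by linarith
      then show "y \<in> upper" using z \<open>0 < e\<close> by simp
    qed
    have "norm ((deriv ^^ 1) F z) \<le> fact 1 * M / (e / 2) ^ 1"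
    proof (rule Cauchy_inequality[where f = F and \<xi> = z and r = "e / 2" and B = M and n = 1])
      show "F holomorphic_on ball z (e / 2)"
        using sub by (intro holomorphic_on_subset[OF hol] order_trans[OF ball_subset_cball])
      show "continuous_on (cball z (e / 2)) F"
        using sub by (intro holomorphic_on_imp_continuous_on holomorphic_on_subset[OF hol]) auto
      show "norm (F x) \<le> M" if "norm (z - x) = e / 2" for x
        using that sub by (intro bdd) (auto simp: dist_norm subset_iff)
    qed (use \<open>0 < e\<close> in auto)
    then show ?thesis by (simp add: mult.commute)
  qed
qed (use assms in auto)

lemma Lipschitz_imp_uniformly_continuous:
  fixes l :: "real \<Rightarrow> real"
  assumes "\<And>s t. \<bar>l s - l t\<bar> \<le> L * \<bar>s - t\<bar>"
  shows "uniformly_continuous_on UNIV l"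
proof -
  have "0 \<le> L" using assms[of 1 0] abs_ge_zero[of "l 1 - l 0"] by simp
  then have "L-lipschitz_on UNIV l"
    using assms by (intro lipschitz_onI) (auto simp: dist_real_def)
  then show ?thesis by (rule lipschitz_on_uniformly_continuous)
qed

lemma shift_facts:
  assumes hol: "F holomorphic_on upper" and bdd: "\<And>w. w \<in> upper \<Longrightarrow> norm (F w) \<le> M" and e: "0 < e"
  defines "G \<equiv> \<lambda>w. F (w + \<i> * of_real e)"
  shows "G holomorphic_on upper" and "\<And>w. 0 \<le> Im w \<Longrightarrow> norm (G w) \<le> M"
    and "\<And>a b. 0 \<le> Im a \<Longrightarrow> 0 \<le> Im b \<Longrightarrow> norm (G a - G b) \<le> 2 * M / e * norm (a - b)"
proof -
  have "F \<circ> (\<lambda>w. w + \<i> * of_real e) holomorphic_on upper"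
    using e by (intro holomorphic_on_compose_gen[OF _ hol] holomorphic_intros) auto
  then show "G holomorphic_on upper" by (simp add: G_def comp_def)
  show "norm (G w) \<le> M" if "0 \<le> Im w" for w using that e bdd by (simp add: G_def)
  show "norm (G a - G b) \<le> 2 * M / e * norm (a - b)" if "0 \<le> Im a" "0 \<le> Im b" for a b
    using bounded_holomorphic_Lipschitz[OF hol bdd e, of "a + \<i> * of_real e" "b + \<i> * of_real e"] that
    by (simp add: G_def)
qed

text \<open>The comparison principle for \<open>exp \<circ> F\<close>, whose modulus is the exponential of \<open>Re F\<close>. The shift by \<open>e\<close>
makes the boundary data Lipschitz.\<close>

lemma Re_le_poisson_shift:
  assumes hol: "F holomorphic_on upper" and bdd: "\<And>w. w \<in> upper \<Longrightarrow> norm (F w) \<le> M"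
    and e: "0 < e" and w: "w \<in> upper"
  shows "Re (F (w + \<i> * of_real e)) \<le> (\<integral>t. Re (F (of_real t + \<i> * of_real e)) \<partial>pois w)"
proof -
  define G where "G = (\<lambda>w. F (w + \<i> * of_real e))"
  have G: "G holomorphic_on upper" "\<And>w. 0 \<le> Im w \<Longrightarrow> norm (G w) \<le> M"
    "\<And>a b. 0 \<le> Im a \<Longrightarrow> 0 \<le> Im b \<Longrightarrow> norm (G a - G b) \<le> 2 * M / e * norm (a - b)"
    unfolding G_def by (rule shift_facts[OF hol bdd e]; assumption)+
  define L where "L = 2 * M / e"
  have M: "0 \<le> M" using bdd[OF w] norm_ge_zero order_trans by blast
  have L: "0 \<le> L" using M e by (simp add: L_def)
  have "norm (exp (G w)) \<le> exp (\<integral>t. Re (G (of_real t)) \<partial>pois w)"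
  proof (rule modulus_le_exp_poisson[where F = "\<lambda>w. exp (G w)" and l = "\<lambda>t. Re (G (of_real t))" and M = "exp M" and L = M, OF _ _ _ _ _ w])
    show "(\<lambda>w. exp (G w)) holomorphic_on upper" by (intro holomorphic_intros G)
    show "norm (exp (G v)) \<le> exp M" if "v \<in> upper" for v
      using that G(2)[of v] complex_Re_le_cmod[of "G v"] by simp
    show "uniformly_continuous_on UNIV (\<lambda>t. Re (G (of_real t)))"
    proof (rule Lipschitz_imp_uniformly_continuous[of _ L])
      fix s t
      have "\<bar>Re (G (of_real s) - G (of_real t))\<bar> \<le> norm (G (of_real s) - G (of_real t))"
        by (rule abs_Re_le_cmod)
      also have "\<dots> \<le> L * norm (of_real s - of_real t :: complex)" unfolding L_def by (rule G) auto
      finally show "\<bar>Re (G (of_real s)) - Re (G (of_real t))\<bar> \<le> L * \<bar>s - t\<bar>"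
        by (simp add: of_real_diff[symmetric] del: of_real_diff)
    qed
    show "\<bar>Re (G (of_real t))\<bar> \<le> M" for t
      using G(2)[of "of_real t"] abs_Re_le_cmod[of "G (of_real t)"] by simp
    show "\<exists>s0>0. \<forall>s x. 0 < s \<longrightarrow> s < s0 \<longrightarrow> norm (exp (G (Complex x s))) \<le> exp (Re (G (of_real x)) + h)"
      if h: "0 < h" for h
    proof (intro exI conjI allI impI)
      show "0 < h / (L + 1)" using h L by simp
      fix s x :: real assume s: "0 < s" "s < h / (L + 1)"
      have "Re (G (Complex x s)) - Re (G (of_real x)) \<le> norm (G (Complex x s) - G (of_real x))"
        using complex_Re_le_cmod[of "G (Complex x s) - G (of_real x)"] by simp
      also have "\<dots> \<le> L * norm (Complex x s - of_real x)" unfolding L_def using s by (intro G) auto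
      also have "Complex x s - of_real x = \<i> * of_real s" by (simp add: complex_eq_iff)
      also have "norm (\<i> * of_real s) = s" using s by (simp add: norm_mult)
      also have "L * s \<le> (L + 1) * (h / (L + 1))" using s L by (intro mult_mono) auto
      also have "\<dots> = h" using L by simp
      finally show "norm (exp (G (Complex x s))) \<le> exp (Re (G (of_real x)) + h)" by simp
    qed
  qed
  then show ?thesis by (simp add: G_def)
qed

text \<open>The preceding inequality for \<open>F\<close>, \<open>- F\<close>, \<open>\<i> F\<close> and \<open>- \<i> F\<close> becomes an equality.\<close>

lemma poisson_shift:
  assumes hol: "F holomorphic_on upper" and bdd: "\<And>w. w \<in> upper \<Longrightarrow> norm (F w) \<le> M"
    and e: "0 < e" and w: "w \<in> upper"
  shows "F (w + \<i> * of_real e) = (\<integral>t. F (of_real t + \<i> * of_real e) \<partial>pois w)"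
proof -
  have Im: "0 < Im w" using w by simp
  have cont: "continuous_on UNIV (\<lambda>t. F (of_real t + \<i> * of_real e))"
    using e by (intro continuous_on_compose2[OF holomorphic_on_imp_continuous_on[OF hol]] continuous_intros) auto
  have int: "integrable (pois w) (\<lambda>t. F (of_real t + \<i> * of_real e))"
    using e bdd by (intro integrable_pois_bounded[OF Im, of _ M] borel_measurable_continuous_onI cont) auto
  have le: "Re (c * F (w + \<i> * of_real e)) \<le> Re (c * (\<integral>t. F (of_real t + \<i> * of_real e) \<partial>pois w))"
    if "norm c = 1" for c
  proof -
    have "Re (c * F (w + \<i> * of_real e)) \<le> (\<integral>t. Re (c * F (of_real t + \<i> * of_real e)) \<partial>pois w)"
    proof (rule Re_le_poisson_shift[where F = "\<lambda>w. c * F w" and M = M, OF _ _ e w])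
      show "(\<lambda>w. c * F w) holomorphic_on upper" by (intro holomorphic_intros hol)
      show "norm (c * F w) \<le> M" if "w \<in> upper" for w
        using bdd[OF that] \<open>norm c = 1\<close> by (simp add: norm_mult)
    qed
    also have "\<dots> = Re (\<integral>t. c * F (of_real t + \<i> * of_real e) \<partial>pois w)"
      using int by (intro integral_Re) auto
    finally show ?thesis using int by simp
  qed
  show ?thesis
    using le[of 1] le[of "-1"] le[of "\<i>"] le[of "-\<i>"] by (intro complex_eqI) auto
qed

lemma ln_add_diff_le:
  assumes "0 < d" "0 \<le> (a::real)" "0 \<le> b"
  shows "\<bar>ln (a + d) - ln (b + d)\<bar> \<le> \<bar>a - b\<bar> / d"
proof -
  have *: "ln (a + d) - ln (b + d) \<le> \<bar>a - b\<bar> / d" if "0 \<le> a" "0 \<le> b" for a b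
  proof -
    have "ln (a + d) - ln (b + d) = ln ((a + d) / (b + d))" using that assms by (simp add: ln_div add_nonneg_pos)
    also have "\<dots> \<le> (a + d) / (b + d) - 1" using that assms by (intro ln_le_minus_one divide_pos_pos add_nonneg_pos) auto
    also have "\<dots> = (a - b) / (b + d)" using that assms by (simp add: field_simps add_nonneg_pos)
    also have "\<dots> \<le> \<bar>a - b\<bar> / (b + d)" using that assms by (intro divide_right_mono) auto
    also have "\<dots> \<le> \<bar>a - b\<bar> / d" using that assms by (intro divide_left_mono mult_pos_pos add_nonneg_pos) auto
    finally show ?thesis .
  qed
  show ?thesis using *[of a b] *[of b a] assms by (simp add: abs_minus_commute abs_le_iff)
qed

text \<open>Jensen's inequality for the shifted function. The positive \<open>d\<close> keeps the logarithm Lipschitz at the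
zeros.\<close>

lemma modulus_le_exp_poisson_ln_shift:
  assumes hol: "F holomorphic_on upper" and bdd: "\<And>w. w \<in> upper \<Longrightarrow> norm (F w) \<le> M"
    and e: "0 < e" and d: "0 < d" and w: "w \<in> upper"
  shows "norm (F (w + \<i> * of_real e)) \<le> exp (\<integral>t. ln (norm (F (of_real t + \<i> * of_real e)) + d) \<partial>pois w)"
proof -
  define G where "G = (\<lambda>w. F (w + \<i> * of_real e))"
  have G: "G holomorphic_on upper" "\<And>w. 0 \<le> Im w \<Longrightarrow> norm (G w) \<le> M"
    "\<And>a b. 0 \<le> Im a \<Longrightarrow> 0 \<le> Im b \<Longrightarrow> norm (G a - G b) \<le> 2 * M / e * norm (a - b)"
    unfolding G_def by (rule shift_facts[OF hol bdd e]; assumption)+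
  define L where "L = 2 * M / e"
  have M: "0 \<le> M" using bdd[OF w] norm_ge_zero order_trans by blast
  have L: "0 \<le> L" using M e by (simp add: L_def)
  have "norm (G w) \<le> exp (\<integral>t. ln (norm (G (of_real t)) + d) \<partial>pois w)"
  proof (rule modulus_le_exp_poisson[where F = G and l = "\<lambda>t. ln (norm (G (of_real t)) + d)"
      and M = M and L = "\<bar>ln (M + d)\<bar> + \<bar>ln d\<bar>", OF G(1) _ _ _ _ w])
    show "norm (G v) \<le> M" if "v \<in> upper" for v using that G(2)[of v] by simp
    show "uniformly_continuous_on UNIV (\<lambda>t. ln (norm (G (of_real t)) + d))"
    proof (rule Lipschitz_imp_uniformly_continuous[of _ "L / d"])
      fix s t
      have "\<bar>norm (G (of_real s)) - norm (G (of_real t))\<bar> \<le> L * norm (of_real s - of_real t :: complex)"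
        using G(3)[of "of_real s" "of_real t"] norm_triangle_ineq3[of "G (of_real s)" "G (of_real t)"] by (simp add: L_def)
      then have "\<bar>norm (G (of_real s)) - norm (G (of_real t))\<bar> / d \<le> L / d * \<bar>s - t\<bar>"
        using d by (simp add: divide_right_mono of_real_diff[symmetric] del: of_real_diff)
      then show "\<bar>ln (norm (G (of_real s)) + d) - ln (norm (G (of_real t)) + d)\<bar> \<le> L / d * \<bar>s - t\<bar>"
        using ln_add_diff_le[OF d, of "norm (G (of_real s))" "norm (G (of_real t))"] by simp
    qed
    show "\<bar>ln (norm (G (of_real t)) + d)\<bar> \<le> \<bar>ln (M + d)\<bar> + \<bar>ln d\<bar>" for t
    proof -
      have "ln d \<le> ln (norm (G (of_real t)) + d)" using d by (subst ln_le_cancel_iff) (auto intro: add_nonneg_pos)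
      moreover have "ln (norm (G (of_real t)) + d) \<le> ln (M + d)"
        using d M G(2)[of "of_real t"] by (subst ln_le_cancel_iff) (auto intro: add_nonneg_pos)
      ultimately show ?thesis by linarith
    qed
    show "\<exists>s0>0. \<forall>s x. 0 < s \<longrightarrow> s < s0 \<longrightarrow> norm (G (Complex x s)) \<le> exp (ln (norm (G (of_real x)) + d) + h)"
      if h: "0 < h" for h
    proof (intro exI conjI allI impI)
      show "0 < d * h / (L + 1)" using h L d by simp
      fix s x :: real assume s: "0 < s" "s < d * h / (L + 1)"
      have "norm (G (Complex x s)) \<le> norm (G (of_real x)) + norm (G (Complex x s) - G (of_real x))"
        using norm_triangle_sub by blast
      also have "norm (G (Complex x s) - G (of_real x)) \<le> L * norm (Complex x s - of_real x)"
        unfolding L_def using s by (intro G) auto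
      also have "Complex x s - of_real x = \<i> * of_real s" by (simp add: complex_eq_iff)
      also have "norm (\<i> * of_real s) = s" using s by (simp add: norm_mult)
      also have "L * s \<le> (L + 1) * (d * h / (L + 1))" using s L by (intro mult_mono) auto
      also have "\<dots> = d * h" using L by simp
      also have "norm (G (of_real x)) + d * h \<le> (norm (G (of_real x)) + d) * (1 + h)"
        using d h by (simp add: algebra_simps)
      also have "\<dots> \<le> (norm (G (of_real x)) + d) * exp h"
        using d exp_ge_add_one_self[of h] by (intro mult_left_mono) auto
      also have "\<dots> = exp (ln (norm (G (of_real x)) + d) + h)"
        using d by (simp add: exp_add add_nonneg_pos)
      finally show "norm (G (Complex x s)) \<le> exp (ln (norm (G (of_real x)) + d) + h)" by simp
    qed
  qed
  then show ?thesis by (simp add: G_def)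
qed

section \<open>Almost everywhere boundary limits of Poisson integrals\<close>

lemma nn_integral_pois:
  assumes "g \<in> borel_measurable borel"
  shows "(\<integral>\<^sup>+t. g t \<partial>pois w) = (\<integral>\<^sup>+t. ennreal (poisson_kernel w t) * g t \<partial>lborel)"
  unfolding pois_def using assms by (intro nn_integral_density) auto

text \<open>Poisson averages are dominated by sums of averages over dyadic intervals, with geometrically decaying
weights relative to their lengths.\<close>

lemma poisson_kernel_dyadic_bound:
  assumes "0 < y"
  shows "ennreal (poisson_kernel (Complex x y) t) \<le>
    (\<Sum>k. ennreal (4 / (pi * y) * (1 / 4) ^ k) * indicator (cball x (2 ^ k * y)) t)"
proof -
  obtain n :: nat where n: "\<bar>t - x\<bar> < 2 ^ n * y"
    using assms real_arch_pow[of 2 "\<bar>t - x\<bar> / y"] by (auto simp: field_simps)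
  define k where "k = (LEAST k. \<bar>t - x\<bar> \<le> 2 ^ k * y)"
  have k: "\<bar>t - x\<bar> \<le> 2 ^ k * y"
    unfolding k_def by (rule LeastI[of _ n]) (use n in simp)
  have bound: "poisson_kernel (Complex x y) t \<le> 4 / (pi * y) * (1 / 4) ^ k"
  proof (cases k)
    case 0
    have "poisson_kernel (Complex x y) t \<le> 1 / (pi * y)"
      using poisson_kernel_le[of "Complex x y" t] assms by simp
    also have "\<dots> \<le> 4 / (pi * y)" using assms by (intro divide_right_mono) auto
    finally show ?thesis using 0 by simp
  next
    case (Suc j)
    have "\<not> \<bar>t - x\<bar> \<le> 2 ^ j * y"
      using not_less_Least[of j "\<lambda>k. \<bar>t - x\<bar> \<le> 2 ^ k * y"] Suc by (simp add: k_def)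
    then have "(2 ^ j * y)\<^sup>2 \<le> \<bar>t - x\<bar>\<^sup>2"
      using assms by (intro power_mono) auto
    then have ge: "4 ^ j * y\<^sup>2 \<le> (t - x)\<^sup>2 + y\<^sup>2"
      by (simp add: power_mult_distrib power_mult[symmetric] mult.commute[of j 2] power_mult)
        (metis (no_types, lifting) add_increasing2 zero_le_power2 power2_eq_square power_mult_distrib
          numeral_Bit0 mult_2 numeral_times_numeral)
    have "poisson_kernel (Complex x y) t = y / (pi * ((t - x)\<^sup>2 + y\<^sup>2))"
      by (simp add: poisson_kernel_def)
    also have "\<dots> \<le> y / (pi * (4 ^ j * y\<^sup>2))"
      using ge assms by (intro divide_left_mono mult_left_mono mult_pos_pos) (auto intro!: add_nonneg_pos)
    also have "\<dots> = 4 / (pi * y) * (1 / 4) ^ k"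
      using assms by (simp add: Suc power2_eq_square power_divide)
    finally show ?thesis .
  qed
  define D where "D = (\<lambda>k. ennreal (4 / (pi * y) * (1 / 4) ^ k) * indicator (cball x (2 ^ k * y)) t)"
  have "ennreal (poisson_kernel (Complex x y) t) \<le> D k"
    using bound k by (auto simp: D_def dist_real_def abs_minus_commute intro: ennreal_leI)
  also have "\<dots> = sum D {k}"
    by simp
  also have "\<dots> \<le> (\<Sum>k. D k)"
    by (intro sum_le_suminf) auto
  finally show ?thesis by (simp only: D_def)
qed

lemma poisson_large_imp_ball_large:
  assumes [measurable]: "g \<in> borel_measurable borel" and e: "0 < e" and y: "0 < y"
    and large: "ennreal e < (\<integral>\<^sup>+t. g t \<partial>pois (Complex x y))"
  obtains s where "0 < s" "ennreal (e * s / 4) < emeasure (density lborel g) (cball x s)"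
proof (rule ccontr)
  note K = that
  assume "\<not> thesis"
  then have small: "emeasure (density lborel g) (cball x s) \<le> ennreal (e * s / 4)" if "0 < s" for s
    using K[OF that] by (meson linorder_not_le)
  have "(\<integral>\<^sup>+t. g t \<partial>pois (Complex x y)) = (\<integral>\<^sup>+t. ennreal (poisson_kernel (Complex x y) t) * g t \<partial>lborel)"
    by (rule nn_integral_pois) simp
  also have "\<dots> \<le> (\<integral>\<^sup>+t. (\<Sum>k. ennreal (4 / (pi * y) * (1 / 4) ^ k) * indicator (cball x (2 ^ k * y)) t * g t) \<partial>lborel)"
    using poisson_kernel_dyadic_bound[OF y, of x]
    by (intro nn_integral_mono) (auto intro: mult_right_mono)
  also have "\<dots> = (\<Sum>k. \<integral>\<^sup>+t. ennreal (4 / (pi * y) * (1 / 4) ^ k) * indicator (cball x (2 ^ k * y)) t * g t \<partial>lborel)"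
    by (intro nn_integral_suminf borel_measurable_times_ennreal borel_measurable_indicator) auto
  also have "\<dots> = (\<Sum>k. ennreal (4 / (pi * y) * (1 / 4) ^ k) * emeasure (density lborel g) (cball x (2 ^ k * y)))"
  proof (intro suminf_cong)
    fix k
    have "emeasure (density lborel g) (cball x (2 ^ k * y)) = (\<integral>\<^sup>+t. g t * indicator (cball x (2 ^ k * y)) t \<partial>lborel)"
      by (intro emeasure_density) auto
    then show "(\<integral>\<^sup>+t. ennreal (4 / (pi * y) * (1 / 4) ^ k) * indicator (cball x (2 ^ k * y)) t * g t \<partial>lborel) =
        ennreal (4 / (pi * y) * (1 / 4) ^ k) * emeasure (density lborel g) (cball x (2 ^ k * y))"
      by (simp only:) (subst nn_integral_cmult[symmetric], auto simp: mult_ac intro!: nn_integral_cong borel_measurable_times_ennreal borel_measurable_indicator)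
  qed
  also have "\<dots> \<le> (\<Sum>k. ennreal (4 / (pi * y) * (1 / 4) ^ k) * ennreal (e * (2 ^ k * y) / 4))"
    using y by (intro suminf_le mult_left_mono small) auto
  also have "\<dots> = (\<Sum>k. ennreal (e / pi * (1 / 2) ^ k))"
  proof (intro suminf_cong)
    fix k
    have "(1 / 4 :: real) ^ k * 2 ^ k = (1 / 2) ^ k"
      by (simp add: power_mult_distrib[symmetric])
    then have "4 / (pi * y) * (1 / 4) ^ k * (e * (2 ^ k * y) / 4) = e / pi * (1 / 2) ^ k"
      using y by (simp add: field_simps)
    then show "ennreal (4 / (pi * y) * (1 / 4) ^ k) * ennreal (e * (2 ^ k * y) / 4) = ennreal (e / pi * (1 / 2) ^ k)"
      using y e by (subst ennreal_mult[symmetric]) auto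
  qed
  also have "\<dots> = ennreal (\<Sum>k. e / pi * (1 / 2) ^ k)"
    using e by (intro suminf_ennreal2) (auto intro!: summable_mult)
  also have "(\<Sum>k. e / pi * (1 / 2) ^ k) = e / pi * 2"
    by (subst suminf_mult) (auto simp: suminf_geometric)
  also have "ennreal (e / pi * 2) \<le> ennreal e"
  proof (rule ennreal_leI)
    have "e * 2 \<le> e * pi" using e pi_gt3 by (intro mult_left_mono) auto
    then show "e / pi * 2 \<le> e" by (simp add: field_simps)
  qed
  finally show False using large by simp
qed

text \<open>The Hardy-Littlewood inequality. Each point with a large Poisson average is the centre of an interval of
large average, and Vitali's covering lemma selects disjoint intervals whose fivefold enlargements
cover all these points.\<close>

lemma poisson_maximal_weak_type:
  assumes [measurable]: "g \<in> borel_measurable borel" and e: "0 < e"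
    and fin: "(\<integral>\<^sup>+t. g t \<partial>lborel) \<le> ennreal I" and I: "0 \<le> I"
  obtains N where "N \<in> sets lborel" "emeasure lborel N \<le> ennreal (40 * I / e)"
    "\<And>x y. x \<notin> N \<Longrightarrow> 0 < y \<Longrightarrow> (\<integral>\<^sup>+t. g t \<partial>pois (Complex x y)) \<le> ennreal e"
proof -
  define \<mu> where "\<mu> = density lborel g"
  have sets_mu [simp, measurable_cong]: "sets \<mu> = sets borel" by (simp add: \<mu>_def)
  define E where "E = {x. \<exists>y>0. ennreal e < (\<integral>\<^sup>+t. g t \<partial>pois (Complex x y))}"
  have "\<exists>s. 0 < s \<and> ennreal (e * s / 4) < emeasure \<mu> (cball x s)" if "x \<in> E" for x
    using that poisson_large_imp_ball_large[OF assms(1) e] unfolding E_def \<mu>_def by blast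
  then obtain r where r: "\<And>x. x \<in> E \<Longrightarrow> 0 < r x" "\<And>x. x \<in> E \<Longrightarrow> ennreal (e * r x / 4) < emeasure \<mu> (cball x (r x))"
    by metis
  have total: "emeasure \<mu> A \<le> ennreal I" if "A \<in> sets borel" for A
  proof -
    have "emeasure \<mu> A = (\<integral>\<^sup>+t. g t * indicator A t \<partial>lborel)"
      unfolding \<mu>_def using that by (intro emeasure_density) auto
    also have "\<dots> \<le> (\<integral>\<^sup>+t. g t \<partial>lborel)" by (intro nn_integral_mono) (auto simp: indicator_def)
    finally show ?thesis using fin by simp
  qed
  have rB: "0 < r x \<and> r x \<le> 4 * I / e" if "x \<in> E" for x
  proof -
    have "ennreal (e * r x / 4) < ennreal I"
      using r(2)[OF that] total[of "cball x (r x)"] by (auto intro: less_le_trans)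
    then have "e * r x / 4 < I" using I by (simp add: ennreal_less_iff[OF order_less_imp_le] ennreal_less_iff e r(1)[OF that] order_less_imp_le)
    then show ?thesis using e r(1)[OF that] by (simp add: field_simps)
  qed
  have cover: "E \<subseteq> (\<Union>i\<in>E. cball i (r i))" using r(1) by (force simp: less_imp_le)
  obtain C where C: "countable C" "C \<subseteq> E"
     "pairwise (\<lambda>i j. disjnt (cball i (r i)) (cball j (r j))) C"
     "E \<subseteq> (\<Union>i\<in>C. cball i (5 * r i))"
    by (rule Vitali_covering_lemma_cballs[where a = "\<lambda>x. x", OF cover rB])
  define c where "c = from_nat_into C"
  define J where "J = to_nat_on C ` C"
  have cJ: "c n \<in> C" "to_nat_on C (c n) = n" if "n \<in> J" for n
    using that C(1) unfolding c_def J_def by auto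
  \<comment> \<open>The countable family, indexed by all natural numbers, with empty sets at unused indices.\<close>
  define A where "A = (\<lambda>n. if n \<in> J then cball (c n) (r (c n)) else {})"
  define A5 where "A5 = (\<lambda>n. if n \<in> J then cball (c n) (5 * r (c n)) else {})"
  define N where "N = (\<Union>n. A5 n)"
  have disj: "disjoint_family A"
    unfolding disjoint_family_on_def
  proof (intro ballI impI)
    fix m n :: nat assume "m \<noteq> n"
    show "A m \<inter> A n = {}"
    proof (cases "m \<in> J \<and> n \<in> J")
      case True
      then have "c m \<noteq> c n" using cJ \<open>m \<noteq> n\<close> by metis
      then have "disjnt (cball (c m) (r (c m))) (cball (c n) (r (c n)))"
        using True cJ(1) C(3) unfolding pairwise_def by blast
      then show ?thesis using True unfolding A_def disjnt_def by simp
    next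
      case False then show ?thesis by (auto simp: A_def)
    qed
  qed
  have "E \<subseteq> N"
  proof
    fix x assume "x \<in> E"
    then obtain i where i: "i \<in> C" "x \<in> cball i (5 * r i)" using C(4) by blast
    have "to_nat_on C i \<in> J" "c (to_nat_on C i) = i" using i C(1) by (auto simp: J_def c_def)
    then show "x \<in> N" using i unfolding N_def A5_def by (intro UN_I[of "to_nat_on C i"]) auto
  qed
  have le: "emeasure lborel (A5 n) \<le> ennreal (40 / e) * emeasure \<mu> (A n)" for n
  proof (cases "n \<in> J")
    case True
    then have cE: "c n \<in> E" using cJ C(2) by auto
    have "emeasure lborel (A5 n) = ennreal (10 * r (c n))"
      using True r(1)[OF cE] by (simp add: A5_def cball_eq_atLeastAtMost)
    also have "\<dots> = ennreal (40 / e) * ennreal (e * r (c n) / 4)"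
      using e r(1)[OF cE] by (subst ennreal_mult[symmetric]) (auto simp: field_simps)
    also have "\<dots> \<le> ennreal (40 / e) * emeasure \<mu> (A n)"
      using True r(2)[OF cE] by (intro mult_left_mono) (auto simp: A_def)
    finally show ?thesis .
  qed (simp add: A5_def)
  show thesis
  proof (rule that)
    show "N \<in> sets lborel" by (auto simp: N_def A5_def)
    have "emeasure lborel N \<le> (\<Sum>n. emeasure lborel (A5 n))"
      unfolding N_def by (intro emeasure_subadditive_countably) (auto simp: A5_def)
    also have "\<dots> \<le> (\<Sum>n. ennreal (40 / e) * emeasure \<mu> (A n))"
      using le by (intro suminf_le) auto
    also have "\<dots> = ennreal (40 / e) * (\<Sum>n. emeasure \<mu> (A n))" by simp
    also have "(\<Sum>n. emeasure \<mu> (A n)) = emeasure \<mu> (\<Union>n. A n)"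
      using disj by (intro suminf_emeasure) (auto simp: A_def)
    also have "ennreal (40 / e) * \<dots> \<le> ennreal (40 / e) * ennreal I"
      by (intro mult_left_mono total) (auto simp: A_def)
    also have "\<dots> = ennreal (40 * I / e)" using e I by (subst ennreal_mult[symmetric]) auto
    finally show "emeasure lborel N \<le> ennreal (40 * I / e)" .
    show "(\<integral>\<^sup>+t. g t \<partial>pois (Complex x y)) \<le> ennreal e" if "x \<notin> N" "0 < y" for x y
    proof (rule ccontr)
      assume "\<not> (\<integral>\<^sup>+t. g t \<partial>pois (Complex x y)) \<le> ennreal e"
      then have "ennreal e < (\<integral>\<^sup>+t. g t \<partial>pois (Complex x y))" by (simp only: not_le)
      then have "x \<in> E" unfolding E_def using that(2) by blast
      then show False using that(1) \<open>E \<subseteq> N\<close> by blast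
    qed
  qed
qed

lemma AE_from_small_exceptional_sets:
  assumes "\<And>e::real. 0 < e \<Longrightarrow> \<exists>N\<in>sets M. emeasure M N \<le> ennreal e \<and> (AE x in M. x \<notin> N \<longrightarrow> Q x)"
  shows "AE x in M. Q x"
proof -
  have "\<forall>n. \<exists>N\<in>sets M. emeasure M N \<le> ennreal (1 / Suc n) \<and> (AE x in M. x \<notin> N \<longrightarrow> Q x)"
    using assms by simp
  then obtain N where N: "\<And>n. N n \<in> sets M" "\<And>n. emeasure M (N n) \<le> ennreal (1 / Suc n)"
    "\<And>n. AE x in M. x \<notin> N n \<longrightarrow> Q x" by metis
  have "emeasure M (\<Inter>n. N n) \<le> ennreal (1 / Suc n)" for n
    using N by (intro order_trans[OF emeasure_mono[of _ "N n"] N(2)]) auto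
  moreover have "(\<lambda>n. ennreal (1 / Suc n)) \<longlonglongrightarrow> ennreal 0"
    by (intro tendsto_ennrealI LIMSEQ_Suc lim_1_over_n)
  ultimately have "emeasure M (\<Inter>n. N n) \<le> ennreal 0"
    by (intro LIMSEQ_le_const) auto
  then have "emeasure M (\<Inter>n. N n) = 0" by simp
  then have "AE x in M. x \<notin> (\<Inter>n. N n)"
    using N(1) by (intro AE_not_in) auto
  moreover have "AE x in M. \<forall>n. x \<notin> N n \<longrightarrow> Q x"
    by (intro AE_all_countable[THEN iffD2] allI N(3))
  ultimately show ?thesis by eventually_elim auto
qed

abbreviation poisson_limit :: "(real \<Rightarrow> 'a :: {banach, second_countable_topology}) \<Rightarrow> real \<Rightarrow> bool" where
  "poisson_limit f x \<equiv> ((\<lambda>y. \<integral>t. f t \<partial>pois (Complex x y)) \<longlongrightarrow> f x) (at_right 0)"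

text \<open>The limit of a Poisson integral at \<open>x\<close> depends only on the function near \<open>x\<close>.\<close>

lemma poisson_limit_far:
  fixes f :: "real \<Rightarrow> 'a :: {banach, second_countable_topology}"
  assumes f: "integrable (pois \<i>) f" and d: "0 < d" and far: "\<And>t. \<bar>t - x\<bar> < d \<Longrightarrow> f t = 0"
  shows "((\<lambda>y. \<integral>t. f t \<partial>pois (Complex x y)) \<longlongrightarrow> 0) (at_right 0)"
proof (rule Lim_null_comparison)
  let ?v = "Complex x 1"
  have [measurable]: "f \<in> borel_measurable borel"
    using borel_measurable_integrable[OF f] by simp
  have fv: "integrable (pois ?v) f" by (rule integrable_pois_transfer[OF f]) auto
  define I where "I = (\<integral>t. norm (f t) \<partial>pois ?v)"
  show "\<forall>\<^sub>F y in at_right 0. norm (\<integral>t. f t \<partial>pois (Complex x y)) \<le> y * (1 + 1 / d\<^sup>2) * I"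
    unfolding eventually_at_right_field
  proof (intro exI[of _ 1] conjI allI impI)
    fix y :: real assume y: "0 < y"
    let ?w = "Complex x y"
    have fw: "integrable (pois ?w) f" by (rule integrable_pois_transfer[OF f]) (use y in auto)
    have "norm (\<integral>t. f t \<partial>pois ?w) \<le> (\<integral>t. norm (f t) \<partial>pois ?w)"
      using fw by (intro integral_norm_bound) 
    also have "\<dots> = (\<integral>t. poisson_kernel ?w t *\<^sub>R norm (f t) \<partial>lborel)"
      using y by (intro integral_pois_eq) auto
    also have "\<dots> \<le> (\<integral>t. (y * (1 + 1 / d\<^sup>2)) * (poisson_kernel ?v t *\<^sub>R norm (f t)) \<partial>lborel)"
    proof (rule integral_mono)
      have "integrable (pois ?w) (\<lambda>t. norm (f t))" using fw by simp
      then show "integrable lborel (\<lambda>t. poisson_kernel ?w t *\<^sub>R norm (f t))"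
        using y by (subst (asm) integrable_pois_iff) auto
      have "integrable (pois ?v) (\<lambda>t. norm (f t))" using fv by simp
      then show "integrable lborel (\<lambda>t. (y * (1 + 1 / d\<^sup>2)) * (poisson_kernel ?v t *\<^sub>R norm (f t)))"
        by (subst (asm) integrable_pois_iff) auto
      show "poisson_kernel ?w t *\<^sub>R norm (f t) \<le> (y * (1 + 1 / d\<^sup>2)) * (poisson_kernel ?v t *\<^sub>R norm (f t))" for t
      proof (cases "\<bar>t - x\<bar> < d")
        case True then show ?thesis using far by simp
      next
        case False
        then have "poisson_kernel ?w t * norm (f t) \<le> y * (1 + 1 / d\<^sup>2) * poisson_kernel ?v t * norm (f t)"
          by (intro mult_right_mono poisson_kernel_far) (use d y in auto)
        then show ?thesis by (simp add: mult.assoc)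
      qed
    qed
    also have "\<dots> = (y * (1 + 1 / d\<^sup>2)) * (\<integral>t. poisson_kernel ?v t *\<^sub>R norm (f t) \<partial>lborel)"
      by (rule integral_mult_right_zero)
    also have "(\<integral>t. poisson_kernel ?v t *\<^sub>R norm (f t) \<partial>lborel) = I"
      unfolding I_def by (rule integral_pois_eq[symmetric]) auto
    finally show "norm (\<integral>t. f t \<partial>pois ?w) \<le> y * (1 + 1 / d\<^sup>2) * I" .
  qed simp
  show "((\<lambda>y. y * (1 + 1 / d\<^sup>2) * I) \<longlongrightarrow> 0) (at_right 0)"
    by (rule tendsto_eq_intros refl)+ simp
qed

lemma integrable_lborel_imp_pois:
  fixes f :: "real \<Rightarrow> 'a :: {banach, second_countable_topology}"
  assumes "integrable lborel f" "0 < Im w"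
  shows "integrable (pois w) f"
proof -
  have [measurable]: "f \<in> borel_measurable borel"
    using borel_measurable_integrable[OF assms(1)] by simp
  have "integrable lborel (\<lambda>t. (1 / (pi * Im w)) *\<^sub>R f t)" using assms by simp
  then have "integrable lborel (\<lambda>t. poisson_kernel w t *\<^sub>R f t)"
  proof (rule Bochner_Integration.integrable_bound)
    show "AE t in lborel. norm (poisson_kernel w t *\<^sub>R f t) \<le> norm ((1 / (pi * Im w)) *\<^sub>R f t)"
      using poisson_kernel_le[OF assms(2)] poisson_kernel_pos[OF assms(2)] assms(2)
      by (intro AE_I2) (auto simp: abs_of_pos mult_right_mono simp del: times_divide_eq_left)
  qed measurable
  then show ?thesis using assms(2) by (subst integrable_pois_iff) auto
qed

lemma eventually_at_right_pos: "\<forall>\<^sub>F y in at_right (0::real). 0 < y"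
  by (simp add: eventually_at_right_less)

lemma tendsto_at_right_cong:
  assumes "(F \<longlongrightarrow> L) (at_right (0::real))" and "\<And>y. 0 < y \<Longrightarrow> G y = F y"
  shows "(G \<longlongrightarrow> L) (at_right 0)"
proof (rule Lim_transform_eventually[OF assms(1)])
  from eventually_at_right_pos show "\<forall>\<^sub>F y in at_right 0. F y = G y" by eventually_elim (simp add: assms(2))
qed

lemma tendsto_from_errors:
  fixes F :: "real \<Rightarrow> 'a :: real_normed_vector"
  assumes "\<And>n::nat. \<forall>\<^sub>F y in G. norm (F y - L) \<le> 3 / Suc n"
  shows "(F \<longlongrightarrow> L) G"
proof (rule tendstoI)
  fix e :: real assume e: "0 < e"
  obtain n :: nat where "3 / e < Suc n" using reals_Archimedean2 less_Suc_eq less_trans of_nat_less_iff by metis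
  then have n: "3 / Suc n < e" using e by (simp add: field_simps)
  show "\<forall>\<^sub>F y in G. dist (F y) L < e"
    using assms[of n] by eventually_elim (use n in \<open>simp add: dist_norm\<close>)
qed

text \<open>Enclose \<open>B\<close> in an open set \<open>U\<close> of nearly the same measure. Inside \<open>U\<close> the Poisson integrals of \<open>U\<close> tend
to 1, and the excess \<open>U - B\<close> is controlled by the maximal inequality off a small set.\<close>

lemma poisson_limit_indicator_point:
  assumes B [measurable]: "B \<in> sets borel"
  shows "AE x in lborel. x \<in> B \<longrightarrow> poisson_limit (indicator B :: real \<Rightarrow> real) x"
proof -
  have errs: "AE x in lborel. x \<in> B \<longrightarrow> (\<forall>\<^sub>F y in at_right 0. norm ((\<integral>t. indicator B t \<partial>pois (Complex x y)) - (1::real)) \<le> 3 / Suc n)" for n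
  proof (rule AE_from_small_exceptional_sets)
    fix e :: real assume e: "0 < e"
    define \<eta> where "\<eta> = 1 / (real (Suc n))"
    have \<eta>: "0 < \<eta>" by (simp add: \<eta>_def)
    obtain U where U: "open U" "B \<subseteq> U" "emeasure lborel (U - B) < ennreal (e * \<eta> / 40)"
      using outer_regular_lborel[OF B, of "e * \<eta> / 40"] e \<eta> by auto
    have Um [measurable]: "U \<in> sets borel" using U by auto
    obtain N where N: "N \<in> sets lborel" "emeasure lborel N \<le> ennreal (40 * (e * \<eta> / 40) / \<eta>)"
       "\<And>x y. x \<notin> N \<Longrightarrow> 0 < y \<Longrightarrow> (\<integral>\<^sup>+t. indicator (U - B) t \<partial>pois (Complex x y)) \<le> ennreal \<eta>"
      by (rule poisson_maximal_weak_type[of "indicator (U - B)" \<eta> "e * \<eta> / 40"])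
        (use U e \<eta> in \<open>auto intro: less_imp_le\<close>)
    show "\<exists>N\<in>sets lborel. emeasure lborel N \<le> ennreal e \<and> (AE x in lborel. x \<notin> N \<longrightarrow> x \<in> B \<longrightarrow>
       (\<forall>\<^sub>F y in at_right 0. norm ((\<integral>t. indicator B t \<partial>pois (Complex x y)) - (1::real)) \<le> 3 / Suc n))"
    proof (intro bexI[of _ N] conjI AE_I2 impI)
      show "N \<in> sets lborel" by fact
      show "emeasure lborel N \<le> ennreal e" using N(2) \<eta> by simp
      fix x assume x: "x \<notin> N" "x \<in> B"
      then obtain d where d: "0 < d" "ball x d \<subseteq> U" using U open_contains_ball by blast
      have lim: "((\<lambda>y. \<integral>t. indicator (- U) t \<partial>pois (Complex x y)) \<longlongrightarrow> (0::real)) (at_right 0)"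
      proof (rule poisson_limit_far[OF _ d(1)])
        show "integrable (pois \<i>) (indicator (- U) :: real \<Rightarrow> real)"
          by (rule integrable_pois_bounded[of _ _ 1]) (auto simp: indicator_def)
        show "indicator (- U) t = (0::real)" if "\<bar>t - x\<bar> < d" for t
          using that d by (auto simp: indicator_def dist_real_def subset_iff abs_minus_commute)
      qed
      have "\<forall>\<^sub>F y in at_right 0. norm ((\<integral>t. indicator (- U) t \<partial>pois (Complex x y)) - 0 :: real) < \<eta>"
        using lim \<eta> by (auto dest: tendstoD simp: dist_norm)
      moreover note eventually_at_right_pos
      ultimately show "\<forall>\<^sub>F y in at_right 0. norm ((\<integral>t. indicator B t \<partial>pois (Complex x y)) - (1::real)) \<le> 3 / Suc n"
      proof eventually_elim
        case (elim y)
        have up: "0 < Im (Complex x y)" using elim by simp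
        interpret prob_space "pois (Complex x y)" by (rule prob_space_pois[OF up])
        have "1 = prob UNIV" using prob_space by simp
        also have "\<dots> = prob (B \<union> (U - B) \<union> - U)" using U by (intro arg_cong[of _ _ prob]) auto
        also have "\<dots> = prob B + prob (U - B) + prob (- U)"
          using U(2) by (subst finite_measure_Union; (subst finite_measure_Union)?) auto
        finally have eq: "1 = prob B + prob (U - B) + prob (- U)" .
        have "emeasure (pois (Complex x y)) (U - B) \<le> ennreal \<eta>"
          using N(3)[OF x(1), of y] elim by simp
        then have "ennreal (prob (U - B)) \<le> ennreal \<eta>"
          by (simp only: emeasure_eq_measure)
        then have "prob (U - B) \<le> \<eta>" using \<eta> by simp
        moreover have "prob (- U) < \<eta>" using elim by simp
        moreover have "3 / Suc n = 3 * \<eta>" by (simp add: \<eta>_def)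
        ultimately have "1 - prob B \<le> 3 / Suc n" using eq \<eta> by linarith
        moreover have "prob B - 1 \<le> 3 / Suc n" using order_trans[OF prob_le_1[of B], of "1 + 3 / Suc n"] by simp
        ultimately show ?case by (simp add: abs_le_iff)
      qed
    qed
  qed
  have "AE x in lborel. \<forall>n. x \<in> B \<longrightarrow> (\<forall>\<^sub>F y in at_right 0. norm ((\<integral>t. indicator B t \<partial>pois (Complex x y)) - (1::real)) \<le> 3 / Suc n)"
    by (rule AE_all_countable[THEN iffD2]) (intro allI errs)
  then show ?thesis
  proof eventually_elim
    case (elim x)
    show ?case
    proof
      assume "x \<in> B"
      then show "poisson_limit (indicator B :: real \<Rightarrow> real) x"
        using elim by (intro tendsto_from_errors) auto
    qed
  qed
qed

lemma poisson_limit_indicator: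
  assumes B [measurable]: "B \<in> sets borel"
  shows "AE x in lborel. poisson_limit (indicator B :: real \<Rightarrow> real) x"
  using poisson_limit_indicator_point[OF B] poisson_limit_indicator_point[OF borel_comp[OF B]]
proof (eventually_elim)
  case (elim x)
  show ?case
  proof (cases "x \<in> B")
    case False
    then have "((\<lambda>y. 1 - (\<integral>t. indicator (- B) t \<partial>pois (Complex x y))) \<longlongrightarrow> 1 - (indicator (- B) x :: real)) (at_right 0)"
      using elim by (intro tendsto_intros) auto
    then show ?thesis
    proof (rule Lim_transform_eventually[THEN tendsto_eq_rhs])
      show "1 - indicator (- B) x = (indicator B x :: real)" using False by simp
      from eventually_at_right_pos show "\<forall>\<^sub>F y in at_right 0. 1 - (\<integral>t. indicator (- B) t \<partial>pois (Complex x y)) = (\<integral>t. indicator B t \<partial>pois (Complex x y) :: real)"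
      proof eventually_elim
        case (elim y)
        interpret prob_space "pois (Complex x y)" by (rule prob_space_pois) (use elim in simp)
        show ?case using prob_compl[of B] by (simp add: Compl_eq_Diff_UNIV)
      qed
    qed
  qed (use elim in simp)
qed

text \<open>The usual consequence of a weak type inequality: almost everywhere convergence passes to limits
in \<open>L\<^sub>1\<close>.\<close>

lemma poisson_limit_approx:
  fixes f :: "real \<Rightarrow> 'a :: {banach, second_countable_topology}"
  assumes f: "integrable lborel f"
    and approx: "\<And>e::real. 0 < e \<Longrightarrow> \<exists>g. integrable lborel g \<and> (\<integral>\<^sup>+t. norm (f t - g t) \<partial>lborel) \<le> ennreal e \<and>
       (AE x in lborel. poisson_limit g x)"
  shows "AE x in lborel. poisson_limit f x"
proof -
  have "AE x in lborel. (\<forall>\<^sub>F y in at_right 0. norm ((\<integral>t. f t \<partial>pois (Complex x y)) - f x) \<le> 3 / Suc n)" for n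
  proof (rule AE_from_small_exceptional_sets)
    fix e :: real assume e: "0 < e"
    define \<eta> where "\<eta> = 1 / (real (Suc n))"
    have \<eta>: "0 < \<eta>" by (simp add: \<eta>_def)
    define \<delta> where "\<delta> = e * \<eta> / 41"
    have \<delta>: "0 < \<delta>" using e \<eta> by (simp add: \<delta>_def)
    obtain g where g: "integrable lborel g" "(\<integral>\<^sup>+t. norm (f t - g t) \<partial>lborel) \<le> ennreal \<delta>"
      "AE x in lborel. poisson_limit g x" using approx[OF \<delta>] by blast
    have [measurable]: "f \<in> borel_measurable borel" "g \<in> borel_measurable borel"
      using borel_measurable_integrable[OF f] borel_measurable_integrable[OF g(1)] by simp_all
    obtain N where N: "N \<in> sets lborel" "emeasure lborel N \<le> ennreal (40 * \<delta> / \<eta>)"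
       "\<And>x y. x \<notin> N \<Longrightarrow> 0 < y \<Longrightarrow> (\<integral>\<^sup>+t. norm (f t - g t) \<partial>pois (Complex x y)) \<le> ennreal \<eta>"
      by (rule poisson_maximal_weak_type[of "\<lambda>t. ennreal (norm (f t - g t))" \<eta> \<delta>])
        (use g \<eta> \<delta> in auto)
    define N' where "N' = {x \<in> UNIV. 1 \<le> ennreal (1 / \<eta>) * ennreal (norm (f x - g x))}"
    have N'm: "N' \<in> sets lborel" unfolding N'_def by measurable
    have "emeasure lborel N' \<le> ennreal (1 / \<eta>) * (\<integral>\<^sup>+t. ennreal (norm (f t - g t)) * indicator UNIV t \<partial>lborel)"
      unfolding N'_def by (rule nn_integral_Markov_inequality) auto
    also have "\<dots> \<le> ennreal (1 / \<eta>) * ennreal \<delta>" using g(2) by (intro mult_left_mono) auto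
    also have "\<dots> = ennreal (\<delta> / \<eta>)" using \<eta> \<delta> by (subst ennreal_mult[symmetric]) auto
    finally have N': "emeasure lborel N' \<le> ennreal (\<delta> / \<eta>)" .
    show "\<exists>N\<in>sets lborel. emeasure lborel N \<le> ennreal e \<and> (AE x in lborel. x \<notin> N \<longrightarrow>
       (\<forall>\<^sub>F y in at_right 0. norm ((\<integral>t. f t \<partial>pois (Complex x y)) - f x) \<le> 3 / Suc n))"
    proof (intro bexI[of _ "N \<union> N'"] conjI)
      show "N \<union> N' \<in> sets lborel" using N N'm by auto
      have "emeasure lborel (N \<union> N') \<le> ennreal (40 * \<delta> / \<eta>) + ennreal (\<delta> / \<eta>)"
        using N(1) N'm by (intro order_trans[OF emeasure_subadditive] add_mono N N') auto
      also have "\<dots> = ennreal (40 * \<delta> / \<eta> + \<delta> / \<eta>)" using \<eta> \<delta> by (subst ennreal_plus) auto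
      also have "40 * \<delta> / \<eta> + \<delta> / \<eta> = e" using \<eta> by (simp add: \<delta>_def field_simps)
      finally show "emeasure lborel (N \<union> N') \<le> ennreal e" .
      show "AE x in lborel. x \<notin> N \<union> N' \<longrightarrow>
         (\<forall>\<^sub>F y in at_right 0. norm ((\<integral>t. f t \<partial>pois (Complex x y)) - f x) \<le> 3 / Suc n)"
        using g(3)
      proof eventually_elim
        case (elim x)
        show ?case
        proof
          assume x: "x \<notin> N \<union> N'"
          have fg: "norm (f x - g x) < \<eta>"
          proof (rule ccontr)
            assume "\<not> norm (f x - g x) < \<eta>"
            then have "1 \<le> 1 / \<eta> * norm (f x - g x)" using \<eta> by (simp add: field_simps)
            then have "ennreal 1 \<le> ennreal (1 / \<eta> * norm (f x - g x))" by (rule ennreal_leI)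
            also have "\<dots> = ennreal (1 / \<eta>) * ennreal (norm (f x - g x))"
              using \<eta> by (intro ennreal_mult) auto
            finally have "x \<in> N'" unfolding N'_def by simp
            then show False using x by simp
          qed
          have "\<forall>\<^sub>F y in at_right 0. norm ((\<integral>t. g t \<partial>pois (Complex x y)) - g x) < \<eta>"
            using tendstoD[OF elim \<eta>] by (simp add: dist_norm)
          moreover note eventually_at_right_pos
          ultimately show "\<forall>\<^sub>F y in at_right 0. norm ((\<integral>t. f t \<partial>pois (Complex x y)) - f x) \<le> 3 / Suc n"
          proof eventually_elim
            case (elim y)
            have up: "0 < Im (Complex x y)" using elim by simp
            have int: "integrable (pois (Complex x y)) f" "integrable (pois (Complex x y)) g"
              using up f g by (auto intro: integrable_lborel_imp_pois)
            have "ennreal (norm ((\<integral>t. f t \<partial>pois (Complex x y)) - (\<integral>t. g t \<partial>pois (Complex x y)))) =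
               ennreal (norm (\<integral>t. f t - g t \<partial>pois (Complex x y)))"
              using int by simp
            also have "\<dots> \<le> (\<integral>\<^sup>+t. norm (f t - g t) \<partial>pois (Complex x y))"
              using int by (intro integral_norm_bound_ennreal) auto
            also have "\<dots> \<le> ennreal \<eta>" using N(3) x elim by auto
            finally have le: "norm ((\<integral>t. f t \<partial>pois (Complex x y)) - (\<integral>t. g t \<partial>pois (Complex x y))) \<le> \<eta>"
              using \<eta> by simp
            have "(\<integral>t. f t \<partial>pois (Complex x y)) - f x =
               ((\<integral>t. f t \<partial>pois (Complex x y)) - (\<integral>t. g t \<partial>pois (Complex x y))) +
               ((\<integral>t. g t \<partial>pois (Complex x y)) - g x) + (g x - f x)" by simp
            moreover have "norm (A + C + D) \<le> norm A + norm C + norm D" for A C D :: 'a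
              by (rule order_trans[OF norm_triangle_ineq add_right_mono[OF norm_triangle_ineq]])
            ultimately have "norm ((\<integral>t. f t \<partial>pois (Complex x y)) - f x) \<le>
               norm ((\<integral>t. f t \<partial>pois (Complex x y)) - (\<integral>t. g t \<partial>pois (Complex x y))) +
               norm ((\<integral>t. g t \<partial>pois (Complex x y)) - g x) + norm (g x - f x)"
              by metis
            also have "\<dots> \<le> \<eta> + \<eta> + \<eta>"
              using fg elim le by (intro add_mono) (auto simp: norm_minus_commute)
            finally have "norm ((\<integral>t. f t \<partial>pois (Complex x y)) - f x) \<le> \<eta> + \<eta> + \<eta>" .
            then show ?case by (simp add: \<eta>_def)
          qed
        qed
      qed
    qed
  qed
  then have "AE x in lborel. \<forall>n. (\<forall>\<^sub>F y in at_right 0. norm ((\<integral>t. f t \<partial>pois (Complex x y)) - f x) \<le> 3 / Suc n)"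
    by (simp add: AE_all_countable)
  then show ?thesis by eventually_elim (intro tendsto_from_errors, blast)
qed

lemma poisson_limit_lborel:
  fixes f :: "real \<Rightarrow> 'a :: {banach, second_countable_topology}"
  assumes "integrable lborel f"
  shows "AE x in lborel. poisson_limit f x"
  using assms
proof (induct rule: integrable_induct)
  case (base A c)
  then have A: "A \<in> sets borel" by simp
  show ?case
    using poisson_limit_indicator[OF A]
  proof eventually_elim
    case (elim x)
    have "((\<lambda>y. (\<integral>t. indicator A t \<partial>pois (Complex x y)) *\<^sub>R c) \<longlongrightarrow> indicator A x *\<^sub>R c) (at_right 0)"
      by (intro tendsto_intros elim)
    moreover have "(\<integral>t. indicator A t *\<^sub>R c \<partial>pois (Complex x y)) = (\<integral>t. indicator A t \<partial>pois (Complex x y)) *\<^sub>R c"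
      if "0 < y" for y
    proof -
      have up: "0 < Im (Complex x y)" using that by simp
      have "integrable (pois (Complex x y)) (indicator A :: real \<Rightarrow> real)"
        using A by (intro integrable_pois_bounded[OF up, of _ 1]) (auto simp: indicator_def)
      then show ?thesis by (intro integral_scaleR_left) auto
    qed
    ultimately show ?case
      by (elim tendsto_at_right_cong) auto
  qed
next
  case (add f g)
  show ?case using add(2,4)
  proof eventually_elim
    case (elim x)
    have "((\<lambda>y. (\<integral>t. f t \<partial>pois (Complex x y)) + (\<integral>t. g t \<partial>pois (Complex x y))) \<longlongrightarrow> f x + g x) (at_right 0)"
      by (intro tendsto_intros elim)
    moreover have "(\<integral>t. f t + g t \<partial>pois (Complex x y)) = (\<integral>t. f t \<partial>pois (Complex x y)) + (\<integral>t. g t \<partial>pois (Complex x y))"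
      if "0 < y" for y
      using that add by (intro Bochner_Integration.integral_add integrable_lborel_imp_pois) auto
    ultimately show ?case
      by (elim tendsto_at_right_cong) auto
  qed
next
  case (lim f s)
  show ?case
  proof (rule poisson_limit_approx[OF lim(5)])
    fix e :: real assume e: "0 < e"
    have [measurable]: "f \<in> borel_measurable borel" "s i \<in> borel_measurable borel" for i
      using borel_measurable_integrable[OF lim(5)] borel_measurable_integrable[OF lim(1)] by simp_all
    have "(\<lambda>i. \<integral>t. norm (f t - s i t) \<partial>lborel) \<longlonglongrightarrow> (\<integral>t. norm (f t - f t) \<partial>lborel)"
    proof (rule integral_dominated_convergence[where w = "\<lambda>t. 3 * norm (f t)"])
      show "integrable lborel (\<lambda>t. 3 * norm (f t))" using lim(5) by simp
      show "AE t in lborel. (\<lambda>i. norm (f t - s i t)) \<longlonglongrightarrow> norm (f t - f t)"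
        using lim(3) by (intro AE_I2 tendsto_intros) auto
      show "AE t in lborel. norm (norm (f t - s i t)) \<le> 3 * norm (f t)" for i
      proof (intro AE_I2)
        fix t show "norm (norm (f t - s i t)) \<le> 3 * norm (f t)"
          using norm_triangle_ineq4[of "f t" "s i t"] lim(4)[of t i] by simp
      qed
    qed measurable
    then have "(\<lambda>i. \<integral>t. norm (f t - s i t) \<partial>lborel) \<longlonglongrightarrow> 0" by simp
    then have "\<forall>\<^sub>F i in sequentially. (\<integral>t. norm (f t - s i t) \<partial>lborel) < e"
      using e by (rule order_tendstoD)
    then obtain i where i: "(\<integral>t. norm (f t - s i t) \<partial>lborel) < e"
      by (auto simp: eventually_sequentially)
    have "(\<integral>\<^sup>+t. norm (f t - s i t) \<partial>lborel) = ennreal (\<integral>t. norm (f t - s i t) \<partial>lborel)"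
      using lim(1,5) by (intro nn_integral_eq_integral) auto
    then show "\<exists>g. integrable lborel g \<and> (\<integral>\<^sup>+t. norm (f t - g t) \<partial>lborel) \<le> ennreal e \<and>
       (AE x in lborel. poisson_limit g x)"
      using i lim(1,2) by (intro exI[of _ "s i"]) (auto intro: ennreal_leI)
  qed
qed

text \<open>Fatou's theorem for Poisson integrals. Cutting off at \<open>n\<close> leaves an integrable function, and the
removed part does not influence the limit at points with \<open>\<bar>x\<bar> < n\<close>.\<close>

theorem AE_poisson_limit:
  fixes f :: "real \<Rightarrow> 'a :: {banach, second_countable_topology}"
  assumes f: "integrable (pois \<i>) f"
  shows "AE x in lborel. poisson_limit f x"
proof -
  have [measurable]: "f \<in> borel_measurable borel"
    using borel_measurable_integrable[OF f] by simp
  have loc: "AE x in lborel. \<bar>x\<bar> < real n \<longrightarrow> poisson_limit f x" for n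
  proof -
    define h where "h = (\<lambda>t. indicator {-real n..real n} t *\<^sub>R f t)"
    define k where "k = (\<lambda>t. indicator (- {-real n..real n}) t *\<^sub>R f t)"
    have hm [measurable]: "h \<in> borel_measurable borel" "k \<in> borel_measurable borel"
      by (auto simp: h_def k_def)
    have hk: "integrable (pois \<i>) h" "integrable (pois \<i>) k"
      using f unfolding h_def k_def
      by (auto intro!: Bochner_Integration.integrable_bound[OF f] AE_I2 simp: indicator_def)
    have "integrable lborel h"
    proof -
      have "integrable lborel (\<lambda>t. poisson_kernel \<i> t *\<^sub>R h t)"
        using hk(1) by (subst (asm) integrable_pois_iff) auto
      then have "integrable lborel (\<lambda>t. (pi * (1 + real n ^ 2)) *\<^sub>R (poisson_kernel \<i> t *\<^sub>R h t))"
        by (rule integrable_scaleR_right)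
      then show ?thesis
      proof (rule Bochner_Integration.integrable_bound)
        show "AE t in lborel. norm (h t) \<le> norm ((pi * (1 + real n ^ 2)) *\<^sub>R (poisson_kernel \<i> t *\<^sub>R h t))"
        proof (intro AE_I2)
          fix t
          show "norm (h t) \<le> norm ((pi * (1 + real n ^ 2)) *\<^sub>R (poisson_kernel \<i> t *\<^sub>R h t))"
          proof (cases "t \<in> {-real n..real n}")
            case True
            then have t2: "t\<^sup>2 \<le> (real n)\<^sup>2" by (intro power2_le_iff_abs_le[THEN iffD2]) auto
            have pos: "0 < 1 + t\<^sup>2" by (auto intro: add_pos_nonneg)
            have "pi * (1 + t\<^sup>2) \<le> pi * (1 + real n ^ 2)" using t2 by (intro mult_left_mono) auto
            moreover have "0 < pi * (1 + t\<^sup>2)" using pos by simp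
            ultimately have "1 \<le> (pi * (1 + real n ^ 2)) / (pi * (1 + t\<^sup>2))"
              by (subst le_divide_eq_1_pos)
            then have "1 \<le> (pi * (1 + real n ^ 2)) * poisson_kernel \<i> t"
              by (simp add: poisson_kernel_def add.commute)
            then have "1 * norm (h t) \<le> ((pi * (1 + real n ^ 2)) * poisson_kernel \<i> t) * norm (h t)"
              by (intro mult_right_mono) auto
            also have "\<dots> = norm ((pi * (1 + real n ^ 2)) *\<^sub>R (poisson_kernel \<i> t *\<^sub>R h t))"
              using poisson_kernel_pos[of \<i> t] by (simp add: abs_mult)
            finally show ?thesis by simp
          qed (simp add: h_def)
        qed
      qed measurable
    qed
    then have "AE x in lborel. poisson_limit h x" by (rule poisson_limit_lborel)
    then show ?thesis
    proof eventually_elim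
      case (elim x)
      show ?case
      proof
        assume x: "\<bar>x\<bar> < real n"
        have "((\<lambda>y. \<integral>t. k t \<partial>pois (Complex x y)) \<longlongrightarrow> 0) (at_right 0)"
          using x by (intro poisson_limit_far[OF hk(2), of "real n - \<bar>x\<bar>"]) (auto simp: k_def indicator_def)
        then have "((\<lambda>y. (\<integral>t. h t \<partial>pois (Complex x y)) + (\<integral>t. k t \<partial>pois (Complex x y))) \<longlongrightarrow> h x + 0) (at_right 0)"
          by (intro tendsto_intros elim)
        moreover have "h x + 0 = f x" using x by (auto simp: h_def indicator_def abs_less_iff)
        moreover have "(\<integral>t. h t \<partial>pois (Complex x y)) + (\<integral>t. k t \<partial>pois (Complex x y)) = (\<integral>t. f t \<partial>pois (Complex x y))"
          if "0 < y" for y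
        proof -
          have "(\<integral>t. h t \<partial>pois (Complex x y)) + (\<integral>t. k t \<partial>pois (Complex x y)) = (\<integral>t. h t + k t \<partial>pois (Complex x y))"
            using that by (intro Bochner_Integration.integral_add[symmetric] integrable_pois_transfer[OF hk(1)] integrable_pois_transfer[OF hk(2)]) auto
          also have "(\<lambda>t. h t + k t) = f" by (auto simp: h_def k_def indicator_def)
          finally show ?thesis .
        qed
        ultimately show "poisson_limit f x"
          by (simp add: tendsto_at_right_cong)
      qed
    qed
  qed
  have "AE x in lborel. \<forall>n. \<bar>x\<bar> < real n \<longrightarrow> poisson_limit f x"
    by (rule AE_all_countable[THEN iffD2]) (intro allI loc)
  then show ?thesis by eventually_elim (metis reals_Archimedean2)
qed

section \<open>Convergence and Lebesgue norms\<close>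

lemma norm_add_powr_le:
  fixes a b :: "'a :: real_normed_vector"
  assumes "0 < p"
  shows "norm (a + b) powr p \<le> 2 powr p * (norm a powr p + norm b powr p)"
proof -
  have "norm (a + b) \<le> 2 * max (norm a) (norm b)"
    using norm_triangle_ineq[of a b] by linarith
  then have "norm (a + b) powr p \<le> (2 * max (norm a) (norm b)) powr p"
    using assms by (intro powr_mono2) auto
  also have "\<dots> = 2 powr p * max (norm a) (norm b) powr p"
    by (subst powr_mult) auto
  also have "max (norm a) (norm b) powr p \<le> norm a powr p + norm b powr p"
    by (auto simp: max_def)
  finally show ?thesis by simp
qed

lemma le_one_plus_powr:
  assumes "0 \<le> (a::real)" "1 \<le> p"
  shows "a \<le> 1 + a powr p"
proof (cases "a \<le> 1")
  case False
  then have "a powr 1 \<le> a powr p" using assms by (intro powr_mono) auto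
  then show ?thesis using False by simp
qed (use powr_ge_zero[of a p] in linarith)

lemma integrable_from_Lp:
  fixes h :: "'a \<Rightarrow> 'b :: {banach, second_countable_topology}"
  assumes "finite_measure M" "1 \<le> p" and [measurable]: "h \<in> borel_measurable M"
    and le: "(\<integral>\<^sup>+t. ennreal (norm (h t) powr p) \<partial>M) < \<infinity>"
  shows "integrable M (\<lambda>t. norm (h t) powr p)" "integrable M h"
proof -
  interpret finite_measure M by fact
  show 1: "integrable M (\<lambda>t. norm (h t) powr p)"
    using le by (intro integrableI_bounded) auto
  have "integrable M (\<lambda>t. 1 + norm (h t) powr p)" using 1 by simp
  then show "integrable M h"
  proof (rule Bochner_Integration.integrable_bound)
    show "AE t in M. norm (h t) \<le> norm (1 + norm (h t) powr p)"
      using le_one_plus_powr[OF norm_ge_zero assms(2)] by (intro AE_I2) (auto intro: order_trans)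
  qed measurable
qed

text \<open>Here \<open>p > 1\<close> is essential: the part of \<open>h n\<close> above the level \<open>K\<close> has integral at most \<open>C K powr (1 - p)\<close>,
which is small for large \<open>K\<close> uniformly in \<open>n\<close>; the part below is handled by dominated convergence.\<close>

lemma tendsto_L1_from_bounded_Lp:
  fixes h :: "nat \<Rightarrow> 'a \<Rightarrow> 'b :: {banach, second_countable_topology}"
  assumes M: "finite_measure M" and p: "1 < p" and [measurable]: "\<And>n. h n \<in> borel_measurable M"
    and le: "\<And>n. (\<integral>\<^sup>+t. ennreal (norm (h n t) powr p) \<partial>M) \<le> ennreal C"
    and lim: "AE t in M. (\<lambda>n. h n t) \<longlonglongrightarrow> 0"
  shows "(\<lambda>n. \<integral>t. norm (h n t) \<partial>M) \<longlonglongrightarrow> 0"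
proof -
  interpret finite_measure M by fact
  have fin: "(\<integral>\<^sup>+t. ennreal (norm (h n t) powr p) \<partial>M) < \<infinity>" for n
    using le[of n] by (simp add: order_le_less_trans)
  note int = integrable_from_Lp[OF M order_less_imp_le[OF p] _ fin]
  define C' where "C' = max C 0"
  have C': "0 \<le> C'" by (simp add: C'_def)
  have le': "(\<integral>t. norm (h n t) powr p \<partial>M) \<le> C'" for n
  proof -
    have "ennreal (\<integral>t. norm (h n t) powr p \<partial>M) \<le> ennreal C'"
      using nn_integral_eq_integral[OF int(1)[of n]] order_trans[OF le[of n] ennreal_leI[of C C']]
      by (simp add: C'_def)
    then show ?thesis using C' by simp
  qed
  have cut: "(\<integral>t. norm (h n t) \<partial>M) \<le> (\<integral>t. min (norm (h n t)) K \<partial>M) + C' * K powr (1 - p)" if K: "0 < K" for n K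
  proof -
    have "(\<integral>t. norm (h n t) \<partial>M) \<le> (\<integral>t. min (norm (h n t)) K + norm (h n t) powr p * K powr (1 - p) \<partial>M)"
    proof (rule integral_mono)
      show "integrable M (\<lambda>t. norm (h n t))" using int(2) by simp
      have "integrable M (\<lambda>t. min (norm (h n t)) K)"
        using K by (intro integrable_const_bound[of _ K]) auto
      then show "integrable M (\<lambda>t. min (norm (h n t)) K + norm (h n t) powr p * K powr (1 - p))"
        using int(1) by simp
      fix t
      show "norm (h n t) \<le> min (norm (h n t)) K + norm (h n t) powr p * K powr (1 - p)"
      proof (cases "norm (h n t) \<le> K")
        case False
        define a where "a = norm (h n t)"
        have a: "K < a" "0 < a" using False K by (auto simp: a_def)
        have "K powr (p - 1) \<le> a powr (p - 1)" using a K p by (intro powr_mono2) auto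
        then have "a * K powr (p - 1) \<le> a * a powr (p - 1)" using a by (intro mult_left_mono) auto
        also have "a * a powr (p - 1) = a powr p" using a by (simp add: powr_mult_base)
        finally have "a * K powr (p - 1) * K powr (1 - p) \<le> a powr p * K powr (1 - p)"
          by (intro mult_right_mono) auto
        moreover have "K powr (p - 1) * K powr (1 - p) = 1" using K by (simp add: powr_add[symmetric])
        ultimately have "a \<le> a powr p * K powr (1 - p)" by (simp add: mult.assoc)
        then show ?thesis using a K unfolding a_def[symmetric] by (simp add: min_def)
      qed simp
    qed
    also have "\<dots> = (\<integral>t. min (norm (h n t)) K \<partial>M) + (\<integral>t. norm (h n t) powr p \<partial>M) * K powr (1 - p)"
    proof -
      have "integrable M (\<lambda>t. min (norm (h n t)) K)"
        using K by (intro integrable_const_bound[of _ K]) auto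
      then show ?thesis using int(1)[of n] by simp
    qed
    also have "\<dots> \<le> (\<integral>t. min (norm (h n t)) K \<partial>M) + C' * K powr (1 - p)"
      using le'[of n] by (intro add_left_mono mult_right_mono) auto
    finally show ?thesis .
  qed
  have minlim: "(\<lambda>n. \<integral>t. min (norm (h n t)) K \<partial>M) \<longlonglongrightarrow> 0" if K: "0 < K" for K
  proof -
    have "(\<lambda>n. \<integral>t. min (norm (h n t)) K \<partial>M) \<longlonglongrightarrow> (\<integral>t. min (norm (0::'b)) K \<partial>M)"
    proof (rule integral_dominated_convergence[where w = "\<lambda>_. K"])
      show "AE t in M. (\<lambda>n. min (norm (h n t)) K) \<longlonglongrightarrow> min (norm (0::'b)) K"
        using lim by eventually_elim (intro tendsto_intros)
    qed (use K in auto)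
    then show ?thesis using K by (simp add: min_def)
  qed
  show ?thesis
  proof (rule LIMSEQ_I)
    fix e :: real assume e: "0 < e"
    have "((\<lambda>K. C' * K powr (1 - p)) \<longlongrightarrow> C' * 0) at_top"
      using p by (intro tendsto_intros tendsto_neg_powr filterlim_ident) auto
    then have "\<forall>\<^sub>F K in at_top. C' * K powr (1 - p) < e / 2"
      using e by (intro order_tendstoD(2)) auto
    then have "\<forall>\<^sub>F K in at_top. 0 < K \<and> C' * K powr (1 - p) < e / 2"
      using eventually_gt_at_top[of 0] by eventually_elim auto
    then obtain K where K: "0 < K" "C' * K powr (1 - p) < e / 2"
      by (auto simp: eventually_at_top_linorder)
    have "\<forall>\<^sub>F n in sequentially. (\<integral>t. min (norm (h n t)) K \<partial>M) < e / 2"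
      using minlim[OF K(1)] e by (intro order_tendstoD(2)) auto
    then obtain N where N: "\<And>n. n \<ge> N \<Longrightarrow> (\<integral>t. min (norm (h n t)) K \<partial>M) < e / 2"
      by (auto simp: eventually_sequentially)
    have "norm ((\<integral>t. norm (h n t) \<partial>M) - 0) < e" if "n \<ge> N" for n
    proof -
      have "0 \<le> (\<integral>t. norm (h n t) \<partial>M)" by simp
      then show ?thesis using cut[OF K(1), of n] N[OF that] K(2) by (simp add: abs_of_nonneg)
    qed
    then show "\<exists>N. \<forall>n\<ge>N. norm ((\<integral>t. norm (h n t) \<partial>M) - 0) < e" by blast
  qed
qed

definition Lp_bound :: "real \<Rightarrow> (real \<Rightarrow> complex) \<Rightarrow> real \<Rightarrow> bool" where
  "Lp_bound p f C \<longleftrightarrow> f \<in> borel_measurable borel \<and> 0 \<le> C \<and> (\<integral>\<^sup>+x. ennreal (norm (f x) powr p) \<partial>lborel) \<le> ennreal C"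

lemma Lp_bound_measurable: "Lp_bound p f C \<Longrightarrow> f \<in> borel_measurable borel"
  by (simp add: Lp_bound_def)

lemma Lp_boundI:
  assumes "f \<in> borel_measurable borel" "(\<integral>\<^sup>+x. ennreal (norm (f x) powr p) \<partial>lborel) < \<infinity>"
  obtains C where "Lp_bound p f C"
proof -
  obtain r where "0 \<le> r" "(\<integral>\<^sup>+x. ennreal (norm (f x) powr p) \<partial>lborel) = ennreal r"
    using assms(2) by (cases "\<integral>\<^sup>+x. ennreal (norm (f x) powr p) \<partial>lborel") auto
  then show thesis using assms(1) that[of r] by (simp add: Lp_bound_def)
qed

lemma Lp_bound_pois:
  assumes f: "Lp_bound p f C" and w: "0 < Im w"
  shows "(\<integral>\<^sup>+t. ennreal (norm (f t) powr p) \<partial>pois w) \<le> ennreal (C / (pi * Im w))"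
proof -
  have [measurable]: "f \<in> borel_measurable borel" using f by (simp add: Lp_bound_def)
  have "(\<integral>\<^sup>+t. ennreal (norm (f t) powr p) \<partial>pois w) =
     (\<integral>\<^sup>+t. ennreal (poisson_kernel w t) * ennreal (norm (f t) powr p) \<partial>lborel)"
    by (rule nn_integral_pois) measurable
  also have "\<dots> \<le> (\<integral>\<^sup>+t. ennreal (1 / (pi * Im w)) * ennreal (norm (f t) powr p) \<partial>lborel)"
    using poisson_kernel_le[OF w] by (intro nn_integral_mono mult_right_mono ennreal_leI) auto
  also have "\<dots> = ennreal (1 / (pi * Im w)) * (\<integral>\<^sup>+t. ennreal (norm (f t) powr p) \<partial>lborel)"
    by (rule nn_integral_cmult) measurable
  also have "\<dots> \<le> ennreal (1 / (pi * Im w)) * ennreal C"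
    using f by (intro mult_left_mono) (auto simp: Lp_bound_def)
  also have "\<dots> = ennreal (C / (pi * Im w))"
    using f w by (subst ennreal_mult[symmetric]) (auto simp: Lp_bound_def)
  finally show ?thesis .
qed

lemma Lp_bound_integrable_pois:
  assumes f: "Lp_bound p f C" and p: "1 \<le> p" and w: "0 < Im w"
  shows "integrable (pois w) f" "integrable (pois w) (\<lambda>t. norm (f t) powr p)"
    "(\<integral>t. norm (f t) powr p \<partial>pois w) \<le> C / (pi * Im w)"
    "(\<integral>t. norm (f t) \<partial>pois w) \<le> 1 + C / (pi * Im w)"
proof -
  interpret prob_space "pois w" by (rule prob_space_pois[OF w])
  have [measurable]: "f \<in> borel_measurable borel" using f by (simp add: Lp_bound_def)
  have fin: "(\<integral>\<^sup>+t. ennreal (norm (f t) powr p) \<partial>pois w) < \<infinity>"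
    using Lp_bound_pois[OF f w] by (simp add: order_le_less_trans)
  show i: "integrable (pois w) f" "integrable (pois w) (\<lambda>t. norm (f t) powr p)"
    by (rule integrable_from_Lp[OF finite_measure_axioms p _ fin]; measurable)+
  have "ennreal (\<integral>t. norm (f t) powr p \<partial>pois w) \<le> ennreal (C / (pi * Im w))"
    using nn_integral_eq_integral[OF i(2)] Lp_bound_pois[OF f w] by simp
  then show le: "(\<integral>t. norm (f t) powr p \<partial>pois w) \<le> C / (pi * Im w)"
    using f w by (subst (asm) ennreal_le_iff) (auto simp: Lp_bound_def)
  have "(\<integral>t. norm (f t) \<partial>pois w) \<le> (\<integral>t. 1 + norm (f t) powr p \<partial>pois w)"
    using i le_one_plus_powr[OF norm_ge_zero p] by (intro integral_mono) auto
  also have "\<dots> = 1 + (\<integral>t. norm (f t) powr p \<partial>pois w)"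
    using i prob_space by simp
  finally show "(\<integral>t. norm (f t) \<partial>pois w) \<le> 1 + C / (pi * Im w)" using le by simp
qed

lemma Lp_bound_diff:
  assumes "Lp_bound p f C" "Lp_bound p g D" "0 < p"
  shows "Lp_bound p (\<lambda>t. f t - g t) (2 powr p * (C + D))"
proof -
  have [measurable]: "f \<in> borel_measurable borel" "g \<in> borel_measurable borel"
    using assms by (auto simp: Lp_bound_def)
  have "(\<integral>\<^sup>+x. ennreal (norm (f x - g x) powr p) \<partial>lborel) \<le>
     (\<integral>\<^sup>+x. ennreal (2 powr p) * (ennreal (norm (f x) powr p) + ennreal (norm (g x) powr p)) \<partial>lborel)"
  proof (rule nn_integral_mono)
    fix x
    have "norm (f x - g x) powr p \<le> 2 powr p * (norm (f x) powr p + norm (g x) powr p)"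
      using norm_add_powr_le[OF assms(3), of "f x" "- g x"] by simp
    then have "ennreal (norm (f x - g x) powr p) \<le> ennreal (2 powr p * (norm (f x) powr p + norm (g x) powr p))"
      by (rule ennreal_leI)
    then show "ennreal (norm (f x - g x) powr p) \<le>
        ennreal (2 powr p) * (ennreal (norm (f x) powr p) + ennreal (norm (g x) powr p))"
      by (simp add: ennreal_mult)
  qed
  also have "\<dots> = ennreal (2 powr p) * ((\<integral>\<^sup>+x. ennreal (norm (f x) powr p) \<partial>lborel) + (\<integral>\<^sup>+x. ennreal (norm (g x) powr p) \<partial>lborel))"
    by (simp add: nn_integral_cmult nn_integral_add)
  also have "\<dots> \<le> ennreal (2 powr p) * (ennreal C + ennreal D)"
    using assms by (intro mult_left_mono add_mono) (auto simp: Lp_bound_def)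
  also have "\<dots> = ennreal (2 powr p * (C + D))"
    using assms by (simp add: Lp_bound_def ennreal_mult)
  finally show ?thesis using assms by (auto simp: Lp_bound_def)
qed

lemma Lp_bound_translate:
  assumes "Lp_bound p f C"
  shows "Lp_bound p (\<lambda>t. f (t + s)) C"
proof -
  have [measurable]: "f \<in> borel_measurable borel" using assms by (auto simp: Lp_bound_def)
  have "(\<integral>\<^sup>+x. ennreal (norm (f x) powr p) \<partial>lborel) = (\<integral>\<^sup>+x. ennreal (norm (f (s + 1 * x)) powr p) \<partial>lborel)"
    using nn_integral_real_affine[of "\<lambda>x. ennreal (norm (f x) powr p)" 1 s] by simp
  then show ?thesis using assms by (simp add: Lp_bound_def add.commute)
qed

section \<open>Hardy functions on the upper half-plane\<close>

definition hardy_means :: "real \<Rightarrow> (complex \<Rightarrow> complex) \<Rightarrow> real \<Rightarrow> bool" where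
  "hardy_means p F C \<longleftrightarrow> F holomorphic_on upper \<and> 0 \<le> C \<and>
     (\<forall>y>0. (\<integral>\<^sup>+x. ennreal (norm (F (Complex x y)) powr p) \<partial>lborel) \<le> ennreal C)"

definition boundary_of :: "(complex \<Rightarrow> complex) \<Rightarrow> (real \<Rightarrow> complex) \<Rightarrow> bool" where
  "boundary_of F f \<longleftrightarrow> (AE x in lborel. ((\<lambda>y. F (Complex x y)) \<longlongrightarrow> f x) (at_right 0))"

text \<open>A function in \<open>H\<^sup>p\<close> of the upper half-plane is kept together with its boundary function; the
boundary function is a representative of a class.\<close>

definition hardy_pair :: "real \<Rightarrow> (complex \<Rightarrow> complex) \<Rightarrow> (real \<Rightarrow> complex) \<Rightarrow> bool" where
  "hardy_pair p F f \<longleftrightarrow> (\<exists>C. hardy_means p F C) \<and> (\<exists>C. Lp_bound p f C) \<and> boundary_of F f"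

lemma continuous_on_Complex [continuous_intros]:
  assumes "continuous_on S f" "continuous_on S g"
  shows "continuous_on S (\<lambda>x. Complex (f x) (g x))"
  unfolding Complex_eq using assms by (intro continuous_intros)

lemma holomorphic_horizontal_measurable:
  assumes "F holomorphic_on upper" "0 < y"
  shows "(\<lambda>x. F (Complex x y)) \<in> borel_measurable borel"
  using assms
  by (intro borel_measurable_continuous_onI continuous_on_compose2[OF holomorphic_on_imp_continuous_on[OF assms(1)]]
      continuous_intros) auto

lemma hardy_means_Lp_bound:
  assumes "hardy_means p F C" "0 < y"
  shows "Lp_bound p (\<lambda>x. F (Complex x y)) C"
  using assms holomorphic_horizontal_measurable[of F y] by (auto simp: hardy_means_def Lp_bound_def)

section \<open>Poisson representation\<close>

lemma horizontal_integral_primitive: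
  assumes F: "F holomorphic_on upper" and \<Phi>: "\<And>w. w \<in> upper \<Longrightarrow> (\<Phi> has_field_derivative F w) (at w)"
    and y: "0 < y" and h: "0 < h"
  shows "(\<integral>s. indicator {0..h} s *\<^sub>R F (Complex (x + s) y) \<partial>lborel) = \<Phi> (Complex (x + h) y) - \<Phi> (Complex x y)"
proof -
  have "((\<lambda>s. \<Phi> (Complex (x + s) y)) has_vector_derivative F (Complex (x + s) y)) (at s within {0..h})" for s
  proof -
    have "((\<lambda>s. Complex (x + s) y) has_vector_derivative 1) (at s within {0..h})"
      unfolding Complex_eq by (auto intro!: derivative_eq_intros simp: has_vector_derivative_def scaleR_conv_of_real)
    moreover have "(\<Phi> has_field_derivative F (Complex (x + s) y)) (at (Complex (x + s) y) within (\<lambda>s. Complex (x + s) y) ` {0..h})"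
      using y by (intro has_field_derivative_at_within[OF \<Phi>]) auto
    ultimately show ?thesis
      using field_vector_diff_chain_within[of "\<lambda>s. Complex (x + s) y" 1 s "{0..h}" \<Phi> "F (Complex (x + s) y)"]
      by (simp add: comp_def)
  qed
  moreover have "continuous_on {0..h} (\<lambda>s. F (Complex (x + s) y))"
    using y by (intro continuous_on_compose2[OF holomorphic_on_imp_continuous_on[OF F]] continuous_intros) auto
  ultimately have "(\<integral>s. indicator {0..h} s *\<^sub>R F (Complex (x + s) y) \<partial>lborel) = \<Phi> (Complex (x + h) y) - \<Phi> (Complex (x + 0) y)"
    using h by (intro integral_FTC_Icc) auto
  then show ?thesis by simp
qed

text \<open>The averages over \<open>[0, h]\<close> tend to the value at 0.\<close>

lemma zero_from_averages:
  fixes g :: "real \<Rightarrow> complex"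
  assumes cont: "continuous_on {0..} g"
    and zero: "\<And>h. 0 < h \<Longrightarrow> (\<integral>s. indicator {0..h} s *\<^sub>R g s \<partial>lborel) = 0"
  shows "g 0 = 0"
proof (rule ccontr)
  assume "g 0 \<noteq> 0"
  then have e: "0 < norm (g 0) / 2" by simp
  obtain d where d: "0 < d" "\<And>s. 0 \<le> s \<Longrightarrow> s < d \<Longrightarrow> dist (g s) (g 0) < norm (g 0) / 2"
    using cont[unfolded continuous_on_iff, rule_format, of 0, OF _ e] by (auto simp: dist_real_def)
  define h where "h = d / 2"
  have h: "0 < h" "h < d" using d by (auto simp: h_def)
  have conth: "continuous_on {0..h} g" using cont by (rule continuous_on_subset) auto
  have gi: "set_integrable lborel {0..h} g" using conth by (rule borel_integrable_atLeastAtMost')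
  have ci: "set_integrable lborel {0..h} (\<lambda>_. g 0)" by (rule borel_integrable_atLeastAtMost') auto
  have "h *\<^sub>R g 0 = (LINT s:{0..h}|lborel. g 0)"
    using h by (simp add: set_lebesgue_integral_def)
  also have "\<dots> = (LINT s:{0..h}|lborel. g 0) - (LINT s:{0..h}|lborel. g s)"
    using zero[OF h(1)] by (simp add: set_lebesgue_integral_def)
  also have "\<dots> = (LINT s:{0..h}|lborel. g 0 - g s)"
    using gi ci by (rule set_integral_diff(2)[symmetric, rotated])
  finally have "norm (h *\<^sub>R g 0) = norm (LINT s:{0..h}|lborel. g 0 - g s)" by simp
  also have "\<dots> \<le> (\<integral>s. indicator {0..h} s * (norm (g 0) / 2) \<partial>lborel)"
    unfolding set_lebesgue_integral_def
  proof (rule order_trans[OF integral_norm_bound integral_mono])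
    show "integrable lborel (\<lambda>s. norm (indicator {0..h} s *\<^sub>R (g 0 - g s)))"
      using set_integral_diff(1)[OF ci gi] unfolding set_integrable_def by (rule integrable_norm)
    show "integrable lborel (\<lambda>s. indicator {0..h} s * (norm (g 0) / 2))"
      by (intro integrable_mult_left integrable_real_indicator) (use h in auto)
    show "norm (indicator {0..h} s *\<^sub>R (g 0 - g s)) \<le> indicator {0..h} s * (norm (g 0) / 2)" for s
      using d(2)[of s] h by (auto simp: indicator_def dist_norm norm_minus_commute)
  qed
  also have "\<dots> = h * (norm (g 0) / 2)" using h by simp
  finally show False using h e by simp
qed

text \<open>The bound on the means controls \<open>F\<close> on horizontal lines only in the mean. But its integrals over horizontal
segments of length \<open>h\<close> form a holomorphic function bounded by \<open>h + C\<close>, because \<open>\<bar>a\<bar>\<close> is at most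
\<open>1 + \<bar>a\<bar> powr p\<close>. The Poisson formula holds for that function; exchanging the two integrations and
letting \<open>h\<close> tend to 0 gives it for \<open>F\<close>.\<close>

lemma hardy_means_poisson_shift:
  assumes F: "hardy_means p F C" and p: "1 < p" and e: "0 < e" and w: "0 < Im w"
  shows "F (w + \<i> * of_real e) = (\<integral>t. F (Complex t e) \<partial>pois w)"
proof -
  have hol: "F holomorphic_on upper" and C: "0 \<le> C" using F by (auto simp: hardy_means_def)
  obtain \<Phi> where \<Phi>w: "\<And>w. w \<in> upper \<Longrightarrow> (\<Phi> has_field_derivative F w) (at w within upper)"
    using holomorphic_convex_primitive'[OF convex_upper open_upper hol] by blast
  have \<Phi>: "(\<Phi> has_field_derivative F w) (at w)" if "w \<in> upper" for w
    using \<Phi>w[OF that] at_within_open[OF that open_upper] by simp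
  have \<Phi>hol: "\<Phi> holomorphic_on upper"
    using \<Phi> by (auto simp: holomorphic_on_def field_differentiable_def intro: has_field_derivative_at_within)
  have Lb: "Lp_bound p (\<lambda>x. F (Complex (x + s) y)) C" if "0 < y" for y s
    using Lp_bound_translate[OF hardy_means_Lp_bound[OF F that]] .
  define Q where "Q = (\<lambda>s. \<integral>t. F (Complex (t + s) e) \<partial>pois w)"
  have prod_meas [measurable]: "(\<lambda>(t, s). F (Complex (t + s) e)) \<in> borel_measurable (borel \<Otimes>\<^sub>M borel)"
  proof -
    have "(\<lambda>x. F (Complex x e)) \<in> borel_measurable borel" by (rule holomorphic_horizontal_measurable[OF hol e])
    from measurable_compose[OF _ this, of "\<lambda>(t, s). t + s" "borel \<Otimes>\<^sub>M borel"] show ?thesis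
      by (simp add: case_prod_unfold)
  qed
  interpret W: prob_space "pois w" by (rule prob_space_pois[OF w])
  have Qcont: "continuous_on {0..} Q"
  proof (rule continuous_on_sequentiallyI)
    fix X :: "nat \<Rightarrow> real" and a :: real assume "\<forall>n. X n \<in> {0..}" "a \<in> {0..}" "X \<longlonglongrightarrow> a"
    have L1: "(\<lambda>n. \<integral>t. norm (F (Complex (t + X n) e) - F (Complex (t + a) e)) \<partial>pois w) \<longlonglongrightarrow> 0"
    proof (rule tendsto_L1_from_bounded_Lp[where p = p and C = "2 powr p * (C + C) / (pi * Im w)"])
      show "finite_measure (pois w)" by (rule W.finite_measure_axioms)
      show "(\<integral>\<^sup>+t. ennreal (norm (F (Complex (t + X n) e) - F (Complex (t + a) e)) powr p) \<partial>pois w) \<le> ennreal (2 powr p * (C + C) / (pi * Im w))" for n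
        using Lp_bound_pois[OF Lp_bound_diff[OF Lb[OF e] Lb[OF e]] w] p by simp
      show "(\<lambda>t. F (Complex (t + X n) e) - F (Complex (t + a) e)) \<in> borel_measurable (pois w)" for n
        using Lp_bound_measurable[OF Lp_bound_diff[OF Lb[OF e] Lb[OF e]]] p by simp
      show "AE t in pois w. (\<lambda>n. F (Complex (t + X n) e) - F (Complex (t + a) e)) \<longlonglongrightarrow> 0"
      proof (intro AE_I2)
        fix t
        have "isCont F (Complex (t + a) e)"
          using holomorphic_on_imp_continuous_on[OF hol] open_upper e by (simp add: continuous_on_eq_continuous_at)
        moreover have "(\<lambda>n. Complex (t + X n) e) \<longlonglongrightarrow> Complex (t + a) e"
          using \<open>X \<longlonglongrightarrow> a\<close> by (intro tendsto_Complex tendsto_intros)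
        ultimately have "(\<lambda>n. F (Complex (t + X n) e)) \<longlonglongrightarrow> F (Complex (t + a) e)" by (rule isCont_tendsto_compose)
        then show "(\<lambda>n. F (Complex (t + X n) e) - F (Complex (t + a) e)) \<longlonglongrightarrow> 0" by (simp add: LIM_zero)
      qed
    qed (rule p)
    have "(\<lambda>n. Q (X n) - Q a) \<longlonglongrightarrow> 0"
    proof (rule Lim_null_comparison[OF always_eventually L1], rule allI)
      fix n
      have "integrable (pois w) (\<lambda>t. F (Complex (t + s) e))" for s
        using Lp_bound_integrable_pois(1)[OF Lb[OF e] _ w] p by simp
      then have "Q (X n) - Q a = (\<integral>t. F (Complex (t + X n) e) - F (Complex (t + a) e) \<partial>pois w)"
        unfolding Q_def by simp
      then show "norm (Q (X n) - Q a) \<le> (\<integral>t. norm (F (Complex (t + X n) e) - F (Complex (t + a) e)) \<partial>pois w)"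
        by (simp add: integral_norm_bound)
    qed
    then show "(\<lambda>n. Q (X n)) \<longlonglongrightarrow> Q a" by (rule LIM_zero_cancel)
  qed
  have Fcont: "continuous_on {0..} (\<lambda>s. F (w + of_real s + \<i> * of_real e))"
    using w e by (intro continuous_on_compose2[OF holomorphic_on_imp_continuous_on[OF hol]] continuous_intros) auto
  have "F (w + of_real 0 + \<i> * of_real e) - Q 0 = 0"
  proof (rule zero_from_averages[where g = "\<lambda>s. F (w + of_real s + \<i> * of_real e) - Q s"])
    show "continuous_on {0..} (\<lambda>s. F (w + of_real s + \<i> * of_real e) - Q s)"
      by (intro continuous_intros Fcont Qcont)
    fix h :: real assume h: "0 < h"
    \<comment> \<open>As \<open>\<Phi>\<close> is a primitive of \<open>F\<close>, this is the integral of \<open>F\<close> over the segment from \<open>w\<close> to \<open>w + h\<close>.\<close>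
    define G where "G = (\<lambda>w. (\<Phi> (w + of_real h) - \<Phi> w))"
    have G_int: "G (Complex x y) = (\<integral>s. indicator {0..h} s *\<^sub>R F (Complex (x + s) y) \<partial>lborel)" if "0 < y" for x y
      using horizontal_integral_primitive[OF hol \<Phi> that h, of x]
      by (simp add: G_def complex_eq_iff) (metis add.commute complex_of_real_def complex_add add_0)
    have Ghol: "G holomorphic_on upper"
    proof -
      have "\<Phi> \<circ> (\<lambda>w. w + of_real h) holomorphic_on upper"
        by (intro holomorphic_on_compose_gen[OF _ \<Phi>hol] holomorphic_intros) auto
      then show ?thesis unfolding G_def comp_def using \<Phi>hol by (intro holomorphic_intros)
    qed
    have Gbdd: "norm (G v) \<le> h + C" if "v \<in> upper" for v
    proof -
      obtain x y where vxy: "v = Complex x y" by (cases v)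
      have v: "v = Complex x y" "0 < y" using vxy that by auto
      have [measurable]: "(\<lambda>s. F (Complex (x + s) y)) \<in> borel_measurable borel"
        using Lp_bound_measurable[OF Lb[OF v(2), of x]] by (simp add: add.commute)
      have "ennreal (norm (G v)) \<le> (\<integral>\<^sup>+s. ennreal (norm (indicator {0..h} s *\<^sub>R F (Complex (x + s) y))) \<partial>lborel)"
      proof -
        have "set_integrable lborel {0..h} (\<lambda>s. F (Complex (x + s) y))"
          using v(2) by (intro borel_integrable_atLeastAtMost' continuous_on_compose2[OF holomorphic_on_imp_continuous_on[OF hol]]
             continuous_intros) auto
        then show ?thesis unfolding v(1) G_int[OF v(2)] set_integrable_def by (rule integral_norm_bound_ennreal)
      qed
      also have "\<dots> \<le> (\<integral>\<^sup>+s. indicator {0..h} s + ennreal (norm (F (Complex (x + s) y)) powr p) \<partial>lborel)"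
      proof (rule nn_integral_mono)
        fix s
        have "norm (F (Complex (x + s) y)) \<le> 1 + norm (F (Complex (x + s) y)) powr p"
          using p by (intro le_one_plus_powr) auto
        then have "ennreal (norm (F (Complex (x + s) y))) \<le> 1 + ennreal (norm (F (Complex (x + s) y)) powr p)"
          by (metis ennreal_1 ennreal_leI ennreal_plus powr_ge_zero zero_le_one)
        then show "ennreal (norm (indicator {0..h} s *\<^sub>R F (Complex (x + s) y))) \<le> indicator {0..h} s + ennreal (norm (F (Complex (x + s) y)) powr p)"
          by (auto simp: indicator_def)
      qed
      also have "\<dots> = ennreal h + (\<integral>\<^sup>+s. ennreal (norm (F (Complex (x + s) y)) powr p) \<partial>lborel)"
        using h by (subst nn_integral_add) auto
      also have "\<dots> \<le> ennreal h + ennreal C"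
        using Lb[OF v(2), of x] by (intro add_left_mono) (simp add: Lp_bound_def add.commute)
      also have "\<dots> = ennreal (h + C)" using h C by simp
      finally show ?thesis by (subst (asm) ennreal_le_iff) (use h C in auto)
    qed
    have Fi: "set_integrable lborel {0..h} (\<lambda>s. F (w + of_real s + \<i> * of_real e))"
      using Fcont by (intro borel_integrable_atLeastAtMost' continuous_on_subset[OF Fcont]) auto
    have Qi: "set_integrable lborel {0..h} Q"
      by (intro borel_integrable_atLeastAtMost' continuous_on_subset[OF Qcont]) auto
    have "(\<integral>s. indicator {0..h} s *\<^sub>R F (w + of_real s + \<i> * of_real e) \<partial>lborel) = G (w + \<i> * of_real e)"
    proof -
      have "w + of_real s + \<i> * of_real e = Complex (Re w + s) (Im w + e)" for s
        by (simp add: complex_eq_iff)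
      moreover have "w + \<i> * of_real e = Complex (Re w) (Im w + e)" by (simp add: complex_eq_iff)
      ultimately show ?thesis using G_int[of "Im w + e" "Re w"] w e by simp
    qed
    also have "\<dots> = (\<integral>t. G (of_real t + \<i> * of_real e) \<partial>pois w)"
      by (rule poisson_shift[OF Ghol Gbdd e]) (use w in auto)
    also have "\<dots> = (\<integral>t. (\<integral>s. indicator {0..h} s *\<^sub>R F (Complex (t + s) e) \<partial>lborel) \<partial>pois w)"
    proof -
      have "of_real t + \<i> * of_real e = Complex t e" for t by (simp add: complex_eq_iff)
      then show ?thesis using G_int[OF e] by simp
    qed
    also have "\<dots> = (\<integral>s. (\<integral>t. indicator {0..h} s *\<^sub>R F (Complex (t + s) e) \<partial>pois w) \<partial>lborel)"
    proof -
      interpret P: pair_sigma_finite "pois w" lborel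
        by (simp add: pair_sigma_finite_def W.sigma_finite_measure_axioms sigma_finite_lborel)
      interpret P': pair_sigma_finite lborel "pois w"
        by (simp add: pair_sigma_finite_def W.sigma_finite_measure_axioms sigma_finite_lborel)
      have m: "(\<lambda>(t, s). indicator {0..h} s *\<^sub>R F (Complex (t + s) e)) \<in> borel_measurable (pois w \<Otimes>\<^sub>M lborel)"
      proof -
        have "(\<lambda>(t, s). indicator {0..h} s *\<^sub>R F (Complex (t + s) e)) \<in> borel_measurable (borel \<Otimes>\<^sub>M borel)"
          using prod_meas by (auto simp: case_prod_unfold)
        then show ?thesis
          by (subst measurable_cong_sets[OF sets_pair_measure_cong[of "pois w" borel lborel borel] refl]) auto
      qed
      have fin: "(\<integral>\<^sup>+s. (\<integral>\<^sup>+t. ennreal (norm (indicator {0..h} s *\<^sub>R F (Complex (t + s) e))) \<partial>pois w) \<partial>lborel) < \<infinity>"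
      proof -
        have "(\<integral>\<^sup>+t. ennreal (norm (indicator {0..h} s *\<^sub>R F (Complex (t + s) e))) \<partial>pois w) \<le>
          ennreal (1 + C / (pi * Im w)) * indicator {0..h} s" for s
        proof -
          have "(\<integral>\<^sup>+t. ennreal (norm (F (Complex (t + s) e))) \<partial>pois w) = ennreal (\<integral>t. norm (F (Complex (t + s) e)) \<partial>pois w)"
            using Lp_bound_integrable_pois(1)[OF Lb[OF e] _ w] p by (intro nn_integral_eq_integral) auto
          also have "\<dots> \<le> ennreal (1 + C / (pi * Im w))"
            using Lp_bound_integrable_pois(4)[OF Lb[OF e] _ w] p by (intro ennreal_leI) auto
          finally show ?thesis by (auto simp: indicator_def)
        qed
        then have "(\<integral>\<^sup>+s. (\<integral>\<^sup>+t. ennreal (norm (indicator {0..h} s *\<^sub>R F (Complex (t + s) e))) \<partial>pois w) \<partial>lborel) \<le>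
           (\<integral>\<^sup>+s. ennreal (1 + C / (pi * Im w)) * indicator {0..h} s \<partial>lborel)" by (intro nn_integral_mono)
        also have "\<dots> < \<infinity>" using h by (subst nn_integral_cmult) (auto simp: ennreal_mult_less_top)
        finally show ?thesis .
      qed
      have "integrable (pois w \<Otimes>\<^sub>M lborel) (\<lambda>(t, s). indicator {0..h} s *\<^sub>R F (Complex (t + s) e))"
      proof (rule integrableI_bounded[OF m])
        have "(\<integral>\<^sup>+z. ennreal (norm (case z of (t, s) \<Rightarrow> indicator {0..h} s *\<^sub>R F (Complex (t + s) e))) \<partial>(pois w \<Otimes>\<^sub>M lborel)) =
          (\<integral>\<^sup>+s. (\<integral>\<^sup>+t. ennreal (norm (indicator {0..h} s *\<^sub>R F (Complex (t + s) e))) \<partial>pois w) \<partial>lborel)"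
          using m by (subst P.nn_integral_snd[symmetric]) auto
        then show "(\<integral>\<^sup>+z. ennreal (norm (case z of (t, s) \<Rightarrow> indicator {0..h} s *\<^sub>R F (Complex (t + s) e))) \<partial>(pois w \<Otimes>\<^sub>M lborel)) < \<infinity>"
          using fin by simp
      qed
      then show ?thesis by (rule P.Fubini_integral[symmetric])
    qed
    also have "\<dots> = (\<integral>s. indicator {0..h} s *\<^sub>R Q s \<partial>lborel)" by (simp add: Q_def)
    finally have eq: "(\<integral>s. indicator {0..h} s *\<^sub>R F (w + of_real s + \<i> * of_real e) \<partial>lborel) = (\<integral>s. indicator {0..h} s *\<^sub>R Q s \<partial>lborel)" .
    show "(\<integral>s. indicator {0..h} s *\<^sub>R (F (w + of_real s + \<i> * of_real e) - Q s) \<partial>lborel) = 0"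
      using set_integral_diff(2)[OF Fi Qi] eq unfolding set_lebesgue_integral_def by simp
  qed
  then show ?thesis by (simp add: Q_def)
qed

lemma hardy_L1_convergence:
  assumes F: "hardy_pair p F f" and p: "1 < p" and w: "0 < Im w"
    and e: "\<And>n. 0 < e n" "e \<longlonglongrightarrow> 0"
  shows "(\<lambda>n. \<integral>t. norm (F (Complex t (e n)) - f t) \<partial>pois w) \<longlonglongrightarrow> 0"
proof -
  interpret prob_space "pois w" by (rule prob_space_pois[OF w])
  obtain C D where C: "hardy_means p F C" and D: "Lp_bound p f D" using F by (auto simp: hardy_pair_def)
  have Lb: "Lp_bound p (\<lambda>t. F (Complex t (e n)) - f t) (2 powr p * (C + D))" for n
    using p by (intro Lp_bound_diff hardy_means_Lp_bound C D e) auto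
  show ?thesis
  proof (rule tendsto_L1_from_bounded_Lp[where p = p and C = "2 powr p * (C + D) / (pi * Im w)"])
    show "finite_measure (pois w)" by (rule finite_measure_axioms)
    show "(\<lambda>t. F (Complex t (e n)) - f t) \<in> borel_measurable (pois w)" for n
      using Lp_bound_measurable[OF Lb] by simp
    show "(\<integral>\<^sup>+t. ennreal (norm (F (Complex t (e n)) - f t) powr p) \<partial>pois w) \<le> ennreal (2 powr p * (C + D) / (pi * Im w))" for n
      by (rule Lp_bound_pois[OF Lb w])
    have fl: "filterlim e (at_right 0) sequentially"
      by (rule tendsto_imp_filterlim_at_right[OF e(2)]) (simp add: e(1))
    have "AE t in lborel. ((\<lambda>y. F (Complex t y)) \<longlongrightarrow> f t) (at_right 0)"
      using F by (simp add: hardy_pair_def boundary_of_def)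
    then have "AE t in lborel. (\<lambda>n. F (Complex t (e n)) - f t) \<longlonglongrightarrow> 0"
    proof eventually_elim
      case (elim t)
      from filterlim_compose[OF elim fl] show ?case by (simp add: LIM_zero)
    qed
    then show "AE t in pois w. (\<lambda>n. F (Complex t (e n)) - f t) \<longlonglongrightarrow> 0" by (simp add: AE_pois_iff[OF w])
  qed (rule p)
qed

lemma null_sequence: "(\<lambda>n. 1 / real (Suc n)) \<longlonglongrightarrow> 0"
  by (intro LIMSEQ_Suc lim_1_over_n)

lemma holomorphic_shift_tendsto:
  assumes "F holomorphic_on upper" "0 < Im w"
  shows "(\<lambda>n. F (w + \<i> * of_real (1 / real (Suc n)))) \<longlonglongrightarrow> F w"
proof -
  have "isCont F w"
    using holomorphic_on_imp_continuous_on[OF assms(1)] open_upper assms(2)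
    by (simp add: continuous_on_eq_continuous_at)
  moreover have "(\<lambda>n. w + \<i> * of_real (1 / real (Suc n))) \<longlonglongrightarrow> w + \<i> * of_real 0"
    by (intro tendsto_intros null_sequence)
  ultimately show ?thesis by (intro isCont_tendsto_compose[of w F]) auto
qed

text \<open>In the shifted formula the boundary data converge almost everywhere and have bounded \<open>p\<close>-means, hence
converge in \<open>L\<^sub>1\<close> of harmonic measure.\<close>

theorem hardy_poisson_representation:
  assumes F: "hardy_pair p F f" and p: "1 < p" and w: "0 < Im w"
  shows "F w = (\<integral>t. f t \<partial>pois w)"
proof -
  define e where "e = (\<lambda>n. 1 / real (Suc n))"
  have e: "0 < e n" "e \<longlonglongrightarrow> 0" for n using null_sequence by (auto simp: e_def)
  obtain C D where C: "hardy_means p F C" and D: "Lp_bound p f D" using F by (auto simp: hardy_pair_def)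
  have hol: "F holomorphic_on upper" using C by (simp add: hardy_means_def)
  have int: "integrable (pois w) f" "integrable (pois w) (\<lambda>t. F (Complex t (e n)))" for n
    using Lp_bound_integrable_pois(1)[OF D _ w] Lp_bound_integrable_pois(1)[OF hardy_means_Lp_bound[OF C e(1)] _ w] p by auto
  have "(\<lambda>n. F (w + \<i> * of_real (e n)) - (\<integral>t. f t \<partial>pois w)) \<longlonglongrightarrow> 0"
  proof (rule Lim_null_comparison[OF always_eventually hardy_L1_convergence[OF F p w e]], rule allI)
    fix n
    have "F (w + \<i> * of_real (e n)) - (\<integral>t. f t \<partial>pois w) = (\<integral>t. F (Complex t (e n)) - f t \<partial>pois w)"
      using hardy_means_poisson_shift[OF C p e(1) w] int by simp
    then show "norm (F (w + \<i> * of_real (e n)) - (\<integral>t. f t \<partial>pois w)) \<le> (\<integral>t. norm (F (Complex t (e n)) - f t) \<partial>pois w)"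
      by (simp add: integral_norm_bound)
  qed
  then have "(\<lambda>n. F (w + \<i> * of_real (e n))) \<longlonglongrightarrow> (\<integral>t. f t \<partial>pois w)" by (rule LIM_zero_cancel)
  moreover have "(\<lambda>n. F (w + \<i> * of_real (e n))) \<longlonglongrightarrow> F w"
    unfolding e_def by (rule holomorphic_shift_tendsto[OF hol w])
  ultimately show ?thesis by (rule LIMSEQ_unique[symmetric])
qed

lemma hardy_bounded_above:
  assumes F: "hardy_pair p F f" and p: "1 < p" and e: "0 < e"
  obtains M where "\<And>w. e \<le> Im w \<Longrightarrow> norm (F w) \<le> M"
proof -
  obtain D where D: "Lp_bound p f D" using F by (auto simp: hardy_pair_def)
  have "norm (F w) \<le> 1 + D / (pi * e)" if "e \<le> Im w" for w
  proof -
    have w: "0 < Im w" using that e by linarith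
    have "norm (F w) \<le> (\<integral>t. norm (f t) \<partial>pois w)"
      unfolding hardy_poisson_representation[OF F p w] by (rule integral_norm_bound)
    also have "\<dots> \<le> 1 + D / (pi * Im w)" using Lp_bound_integrable_pois(4)[OF D _ w] p by simp
    also have "\<dots> \<le> 1 + D / (pi * e)"
      using D e that w by (intro add_left_mono divide_left_mono) (auto simp: Lp_bound_def)
    finally show ?thesis .
  qed
  then show thesis by (rule that)
qed

section \<open>Jensen's inequality\<close>

lemma integrable_ln_norm_add:
  fixes f :: "real \<Rightarrow> complex"
  assumes f: "integrable (pois w) f" and w: "0 < Im w" and d: "0 < d"
  shows "integrable (pois w) (\<lambda>t. ln (norm (f t) + d))"
proof -
  interpret prob_space "pois w" by (rule prob_space_pois[OF w])
  have [measurable]: "f \<in> borel_measurable borel" using borel_measurable_integrable[OF f] by simp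
  have "integrable (pois w) (\<lambda>t. norm (f t) / d + \<bar>ln d\<bar>)" using f by simp
  then show ?thesis
  proof (rule Bochner_Integration.integrable_bound)
    show "AE t in pois w. norm (ln (norm (f t) + d)) \<le> norm (norm (f t) / d + \<bar>ln d\<bar>)"
    proof (intro AE_I2)
      fix t
      have "\<bar>ln (norm (f t) + d) - ln (0 + d)\<bar> \<le> \<bar>norm (f t) - 0\<bar> / d" by (rule ln_add_diff_le[OF d]) auto
      then have "\<bar>ln (norm (f t) + d)\<bar> \<le> norm (f t) / d + \<bar>ln d\<bar>" by simp
      then show "norm (ln (norm (f t) + d)) \<le> norm (norm (f t) / d + \<bar>ln d\<bar>)" by simp
    qed
  qed measurable
qed

text \<open>Let the shift tend to 0 in Jensen's inequality; the logarithms converge in \<open>L\<^sub>1\<close> of harmonic measure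
because \<open>ln (\<bar>a\<bar> + d)\<close> is Lipschitz in \<open>a\<close>.\<close>

lemma hardy_modulus_le_exp_ln_add:
  assumes F: "hardy_pair p F f" and p: "1 < p" and w: "0 < Im w" and d: "0 < d"
  shows "norm (F w) \<le> exp (\<integral>t. ln (norm (f t) + d) \<partial>pois w)"
proof -
  define e where "e = (\<lambda>n. 1 / real (Suc n))"
  have e: "0 < e n" "e \<longlonglongrightarrow> 0" for n using null_sequence by (auto simp: e_def)
  obtain C D where C: "hardy_means p F C" and D: "Lp_bound p f D" using F by (auto simp: hardy_pair_def)
  have hol: "F holomorphic_on upper" using C by (simp add: hardy_means_def)
  have int: "integrable (pois w) f" "integrable (pois w) (\<lambda>t. F (Complex t (e n)))" for n
    using Lp_bound_integrable_pois(1)[OF D _ w] Lp_bound_integrable_pois(1)[OF hardy_means_Lp_bound[OF C e(1)] _ w] p by auto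
  have le: "norm (F (w + \<i> * of_real (e n))) \<le> exp (\<integral>t. ln (norm (F (Complex t (e n))) + d) \<partial>pois w)" for n
  proof -
    \<comment> \<open>Half of the shift makes the function bounded, the other half is the shift in Jensen's inequality.\<close>
    define G where "G = (\<lambda>w. F (w + \<i> * of_real (e n / 2)))"
    obtain M where M: "\<And>w. e n / 2 \<le> Im w \<Longrightarrow> norm (F w) \<le> M" using hardy_bounded_above[OF F p, of "e n / 2"] e(1)[of n] by auto
    have "F \<circ> (\<lambda>w. w + \<i> * of_real (e n / 2)) holomorphic_on upper"
      using e(1)[of n] by (intro holomorphic_on_compose_gen[OF _ hol] holomorphic_intros) auto
    then have "G holomorphic_on upper" by (simp add: G_def comp_def)
    moreover have "norm (G v) \<le> M" if "v \<in> upper" for v using that M e(1)[of n] by (simp add: G_def)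
    ultimately have "norm (G (w + \<i> * of_real (e n / 2))) \<le>
        exp (\<integral>t. ln (norm (G (of_real t + \<i> * of_real (e n / 2))) + d) \<partial>pois w)"
      using e(1)[of n] d w by (intro modulus_le_exp_poisson_ln_shift[where M = M]) auto
    moreover have "v + \<i> * of_real (e n / 2) + \<i> * of_real (e n / 2) = v + \<i> * of_real (e n)" for v
      by (simp add: complex_eq_iff)
    moreover have "of_real t + \<i> * of_real (e n) = Complex t (e n)" for t by (simp add: complex_eq_iff)
    ultimately show ?thesis by (simp only: G_def)
  qed
  have "(\<lambda>n. (\<integral>t. ln (norm (F (Complex t (e n))) + d) \<partial>pois w) - (\<integral>t. ln (norm (f t) + d) \<partial>pois w)) \<longlonglongrightarrow> 0"
  proof (rule Lim_null_comparison[OF always_eventually, rule_format])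
    show "(\<lambda>n. (\<integral>t. norm (F (Complex t (e n)) - f t) \<partial>pois w) / d) \<longlonglongrightarrow> 0"
      using tendsto_divide[OF hardy_L1_convergence[OF F p w e] tendsto_const[of d]] d by simp
    fix n
    have li: "integrable (pois w) (\<lambda>t. ln (norm (F (Complex t (e n))) + d))" "integrable (pois w) (\<lambda>t. ln (norm (f t) + d))"
      by (intro integrable_ln_norm_add int w d)+
    then have "norm ((\<integral>t. ln (norm (F (Complex t (e n))) + d) \<partial>pois w) - (\<integral>t. ln (norm (f t) + d) \<partial>pois w)) =
      norm (\<integral>t. ln (norm (F (Complex t (e n))) + d) - ln (norm (f t) + d) \<partial>pois w)" by simp
    also have "\<dots> \<le> (\<integral>t. norm (ln (norm (F (Complex t (e n))) + d) - ln (norm (f t) + d)) \<partial>pois w)" by (rule integral_norm_bound)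
    also have "\<dots> \<le> (\<integral>t. norm (F (Complex t (e n)) - f t) / d \<partial>pois w)"
    proof (rule integral_mono)
      show "integrable (pois w) (\<lambda>t. norm (ln (norm (F (Complex t (e n))) + d) - ln (norm (f t) + d)))" using li by simp
      show "integrable (pois w) (\<lambda>t. norm (F (Complex t (e n)) - f t) / d)" using int by simp
      fix t
      have "\<bar>norm (F (Complex t (e n))) - norm (f t)\<bar> / d \<le> norm (F (Complex t (e n)) - f t) / d"
        using d by (intro divide_right_mono norm_triangle_ineq3) auto
      then show "norm (ln (norm (F (Complex t (e n))) + d) - ln (norm (f t) + d)) \<le> norm (F (Complex t (e n)) - f t) / d"
        using ln_add_diff_le[OF d, of "norm (F (Complex t (e n)))" "norm (f t)"] by simp
    qed
    finally show "norm ((\<integral>t. ln (norm (F (Complex t (e n))) + d) \<partial>pois w) - (\<integral>t. ln (norm (f t) + d) \<partial>pois w)) \<le>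
      (\<integral>t. norm (F (Complex t (e n)) - f t) \<partial>pois w) / d" by simp
  qed
  then have "(\<lambda>n. \<integral>t. ln (norm (F (Complex t (e n))) + d) \<partial>pois w) \<longlonglongrightarrow> (\<integral>t. ln (norm (f t) + d) \<partial>pois w)" by (rule LIM_zero_cancel)
  then have "(\<lambda>n. exp (\<integral>t. ln (norm (F (Complex t (e n))) + d) \<partial>pois w)) \<longlonglongrightarrow> exp (\<integral>t. ln (norm (f t) + d) \<partial>pois w)" by (intro tendsto_intros)
  moreover have "(\<lambda>n. norm (F (w + \<i> * of_real (e n)))) \<longlonglongrightarrow> norm (F w)"
    unfolding e_def by (intro tendsto_norm holomorphic_shift_tendsto[OF hol w])
  ultimately show ?thesis using le by (intro LIMSEQ_le[of _ "norm (F w)"]) auto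
qed

text \<open>As \<open>d\<close> decreases to 0 the integrals of \<open>ln (\<bar>f\<bar> + d)\<close> decrease but stay above \<open>ln \<bar>F w\<bar>\<close>. A zero set of
positive measure would drive them to minus infinity, and monotone convergence does the rest.\<close>

lemma hardy_jensen_at:
  assumes F: "hardy_pair p F f" and p: "1 < p" and w: "0 < Im w" and nz: "F w \<noteq> 0"
  shows "AE t in lborel. f t \<noteq> 0" and "integrable (pois w) (\<lambda>t. ln (norm (f t)))"
    and "norm (F w) \<le> exp (\<integral>t. ln (norm (f t)) \<partial>pois w)"
proof -
  interpret prob_space "pois w" by (rule prob_space_pois[OF w])
  obtain D where D: "Lp_bound p f D" using F by (auto simp: hardy_pair_def)
  have [measurable]: "f \<in> borel_measurable borel" using D by (simp add: Lp_bound_def)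
  have fi: "integrable (pois w) f" using Lp_bound_integrable_pois(1)[OF D _ w] p by simp
  define d where "d = (\<lambda>n. 1 / real (Suc n))"
  have d: "0 < d n" "d n \<le> 1" "d \<longlonglongrightarrow> 0" for n using null_sequence by (auto simp: d_def)
  have dec: "d n \<le> d m" if "m \<le> n" for m n using that by (simp add: d_def frac_le)
  define L where "L = (\<lambda>n t. - ln (norm (f t) + d n))"
  have Li: "integrable (pois w) (L n)" for n
    unfolding L_def using integrable_ln_norm_add[OF fi w d(1)] by simp
  have up: "(\<integral>t. L n t \<partial>pois w) \<le> - ln (norm (F w))" for n
  proof -
    have "ln (norm (F w)) \<le> ln (exp (\<integral>t. ln (norm (f t) + d n) \<partial>pois w))"
      using hardy_modulus_le_exp_ln_add[OF F p w d(1)] nz by (intro ln_mono) auto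
    then show ?thesis by (simp add: L_def)
  qed
  have mono: "L m t \<le> L n t" if "m \<le> n" for m n t
    using dec[OF that] d(1)[of n] norm_ge_zero[of "f t"] unfolding L_def
    by (auto intro!: ln_mono add_nonneg_pos)
  have intmono: "incseq (\<lambda>n. \<integral>t. L n t \<partial>pois w)"
    by (intro monoI integral_mono Li mono)
  obtain x where x: "(\<lambda>n. \<integral>t. L n t \<partial>pois w) \<longlonglongrightarrow> x"
    using incseq_convergent[OF intmono, of "- ln (norm (F w))"] up by blast
  have xle: "x \<le> - ln (norm (F w))" using x up by (intro LIMSEQ_le_const2[OF x]) auto
  define Z where "Z = {t. f t = 0}"
  have Z [measurable]: "Z \<in> sets borel" unfolding Z_def by measurable
  \<comment> \<open>On the zero set \<open>L n\<close> exceeds \<open>L 0\<close> by \<open>ln (n + 1)\<close>.\<close>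
  have "prob Z * ln (real (Suc n)) \<le> - ln (norm (F w)) - (\<integral>t. L 0 t \<partial>pois w)" for n
  proof -
    have "prob Z * ln (real (Suc n)) = (\<integral>t. indicator Z t * ln (real (Suc n)) \<partial>pois w)" by simp
    also have "\<dots> \<le> (\<integral>t. L n t - L 0 t \<partial>pois w)"
    proof (rule integral_mono)
      show "integrable (pois w) (\<lambda>t. indicator Z t * ln (real (Suc n)))"
        by (intro integrable_mult_left integrable_real_indicator) (auto simp: emeasure_eq_measure)
      show "integrable (pois w) (\<lambda>t. L n t - L 0 t)" using Li by simp
      show "indicator Z t * ln (real (Suc n)) \<le> L n t - L 0 t" for t
      proof (cases "t \<in> Z")
        case True then show ?thesis by (simp add: Z_def L_def d_def ln_div)
      qed (use mono[of 0 n t] in simp)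
    qed
    also have "\<dots> \<le> - ln (norm (F w)) - (\<integral>t. L 0 t \<partial>pois w)" using Li up[of n] by simp
    finally show ?thesis .
  qed
  moreover have "\<not> (\<forall>n. prob Z * ln (real (Suc n)) \<le> K)" if "0 < prob Z" for K
  proof
    assume a: "\<forall>n. prob Z * ln (real (Suc n)) \<le> K"
    obtain n :: nat where "exp (K / prob Z) < real n" using reals_Archimedean2 by blast
    then have "exp (K / prob Z) < real (Suc n)" by simp
    then have "K / prob Z < ln (real (Suc n))" by (metis exp_less_cancel_iff exp_ln of_nat_0_less_iff zero_less_Suc)
    then show False using a that by (simp add: field_simps not_le[symmetric])
  qed
  ultimately have "prob Z = 0" using measure_nonneg[of "pois w" Z] by (metis less_eq_real_def)
  then have "AE t in pois w. t \<notin> Z" by (intro AE_not_in) (auto simp: null_sets_def emeasure_eq_measure)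
  then have nz': "AE t in pois w. f t \<noteq> 0" by (simp add: Z_def)
  then show "AE t in lborel. f t \<noteq> 0" by (simp add: AE_pois_iff[OF w])
  have Llim: "AE t in pois w. (\<lambda>n. L n t) \<longlonglongrightarrow> - ln (norm (f t))"
    using nz'
  proof eventually_elim
    case (elim t)
    have "(\<lambda>n. - ln (norm (f t) + d n)) \<longlonglongrightarrow> - ln (norm (f t) + 0)"
      using elim by (intro tendsto_intros d) auto
    then show ?case by (simp add: L_def)
  qed
  have mono_AE: "AE t in pois w. mono (\<lambda>n. L n t)" by (intro AE_I2 monoI mono)
  have m: "(\<lambda>t. - ln (norm (f t))) \<in> borel_measurable (pois w)" by measurable
  have "integrable (pois w) (\<lambda>t. - ln (norm (f t)))"
    by (rule integrable_monotone_convergence[OF Li mono_AE Llim x m])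
  then show "integrable (pois w) (\<lambda>t. ln (norm (f t)))" by simp
  have "(\<integral>t. - ln (norm (f t)) \<partial>pois w) = x"
    by (rule integral_monotone_convergence[OF Li mono_AE Llim x m])
  then have "ln (norm (F w)) \<le> (\<integral>t. ln (norm (f t)) \<partial>pois w)" using xle by simp
  then have "exp (ln (norm (F w))) \<le> exp (\<integral>t. ln (norm (f t)) \<partial>pois w)" by simp
  then show "norm (F w) \<le> exp (\<integral>t. ln (norm (f t)) \<partial>pois w)" using nz by simp
qed

text \<open>The first part is the boundary uniqueness theorem.\<close>

theorem hardy_jensen:
  assumes F: "hardy_pair p F f" and p: "1 < p" and nz: "w0 \<in> upper" "F w0 \<noteq> 0"
  shows "AE t in lborel. f t \<noteq> 0" and "integrable (pois \<i>) (\<lambda>t. ln (norm (f t)))"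
    and "\<And>w. 0 < Im w \<Longrightarrow> norm (F w) \<le> exp (\<integral>t. ln (norm (f t)) \<partial>pois w)"
proof -
  have w0: "0 < Im w0" using nz by simp
  show "AE t in lborel. f t \<noteq> 0" by (rule hardy_jensen_at[OF F p w0 nz(2)])
  show "integrable (pois \<i>) (\<lambda>t. ln (norm (f t)))"
    by (rule integrable_pois_transfer[OF hardy_jensen_at(2)[OF F p w0 nz(2)] w0]) simp
  show "norm (F w) \<le> exp (\<integral>t. ln (norm (f t)) \<partial>pois w)" if "0 < Im w" for w
    using hardy_jensen_at(3)[OF F p that] by (cases "F w = 0") auto
qed

section \<open>Algebra of boundary values\<close>

lemma boundary_of_mult:
  assumes "boundary_of F f" "boundary_of G g"
  shows "boundary_of (\<lambda>w. F w * G w) (\<lambda>t. f t * g t)"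
  using assms unfolding boundary_of_def by eventually_elim (rule tendsto_mult)

lemma boundary_of_cong:
  assumes "boundary_of F f" "AE t in lborel. f t = g t" "\<And>w. w \<in> upper \<Longrightarrow> F w = G w"
  shows "boundary_of G g"
  using assms(1,2) unfolding boundary_of_def
proof eventually_elim
  case (elim x)
  then show ?case using assms(3) by (auto intro: tendsto_at_right_cong[of "\<lambda>y. F (Complex x y)"])
qed

lemma boundary_of_continuous:
  assumes "\<And>t. isCont G (of_real t)"
  shows "boundary_of G (\<lambda>t. G (of_real t))"
  unfolding boundary_of_def
proof (intro AE_I2)
  fix x
  have "((\<lambda>y. Complex x y) \<longlongrightarrow> Complex x 0) (at_right 0)"
    by (intro tendsto_Complex tendsto_intros)
  then show "((\<lambda>y. G (Complex x y)) \<longlongrightarrow> G (of_real x)) (at_right 0)"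
    using isCont_tendsto_compose[OF assms[of x]] by (simp add: complex_of_real_def)
qed

lemma boundary_of_norm_le:
  assumes "boundary_of F f" "\<And>w. w \<in> upper \<Longrightarrow> norm (F w) \<le> M"
  shows "AE t in lborel. norm (f t) \<le> M"
  using assms(1) unfolding boundary_of_def
proof eventually_elim
  case (elim x)
  have "\<forall>\<^sub>F y in at_right (0::real). norm (F (Complex x y)) \<le> M"
    using eventually_at_right_pos by eventually_elim (rule assms(2), simp)
  then show ?case using tendsto_norm[OF elim] by (intro tendsto_upperbound[of _ "norm (f x)"]) auto
qed

lemma Lp_bound_mult:
  assumes f: "Lp_bound p f C" and b: "b \<in> borel_measurable borel" "AE t in lborel. norm (b t) \<le> M"
    and p: "0 < p" and M: "0 \<le> M"
  shows "Lp_bound p (\<lambda>t. b t * f t) (M powr p * C)"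
proof -
  have [measurable]: "f \<in> borel_measurable borel" "b \<in> borel_measurable borel"
    using f b by (auto simp: Lp_bound_def)
  have "(\<integral>\<^sup>+x. ennreal (norm (b x * f x) powr p) \<partial>lborel) \<le> (\<integral>\<^sup>+x. ennreal (M powr p) * ennreal (norm (f x) powr p) \<partial>lborel)"
  proof (rule nn_integral_mono_AE)
    show "AE x in lborel. ennreal (norm (b x * f x) powr p) \<le> ennreal (M powr p) * ennreal (norm (f x) powr p)"
      using b(2)
    proof eventually_elim
      case (elim x)
      have "norm (b x * f x) powr p \<le> (M * norm (f x)) powr p"
        using p elim by (intro powr_mono2) (auto simp: norm_mult intro: mult_right_mono)
      also have "\<dots> = M powr p * norm (f x) powr p" using M by (simp add: powr_mult)
      finally show ?case by (simp add: ennreal_mult[symmetric] ennreal_leI)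
    qed
  qed
  also have "\<dots> = ennreal (M powr p) * (\<integral>\<^sup>+x. ennreal (norm (f x) powr p) \<partial>lborel)"
    by (rule nn_integral_cmult) measurable
  also have "\<dots> \<le> ennreal (M powr p) * ennreal C" using f by (intro mult_left_mono) (auto simp: Lp_bound_def)
  also have "\<dots> = ennreal (M powr p * C)" using f by (simp add: ennreal_mult Lp_bound_def)
  finally have le: "(\<integral>\<^sup>+x. ennreal (norm (b x * f x) powr p) \<partial>lborel) \<le> ennreal (M powr p * C)" .
  have "0 \<le> M powr p * C" using f by (simp add: Lp_bound_def)
  moreover have "(\<lambda>t. b t * f t) \<in> borel_measurable borel" by measurable
  ultimately show ?thesis using le unfolding Lp_bound_def by blast
qed

lemma hardy_pair_mult_bounded:
  assumes F: "hardy_pair p F f" and p: "0 < p" and B: "B holomorphic_on upper" "\<And>w. w \<in> upper \<Longrightarrow> norm (B w) \<le> M"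
    and b: "b \<in> borel_measurable borel" "boundary_of B b"
  shows "hardy_pair p (\<lambda>w. B w * F w) (\<lambda>t. b t * f t)"
proof -
  obtain C D where C: "hardy_means p F C" and D: "Lp_bound p f D" using F by (auto simp: hardy_pair_def)
  have M: "0 \<le> M" using order_trans[OF norm_ge_zero B(2), of \<i>] by simp
  have "hardy_means p (\<lambda>w. B w * F w) (M powr p * C)"
    unfolding hardy_means_def
  proof (intro conjI allI impI)
    show "(\<lambda>w. B w * F w) holomorphic_on upper"
      using C B by (intro holomorphic_intros) (auto simp: hardy_means_def)
    show "0 \<le> M powr p * C" using C by (auto simp: hardy_means_def)
    fix y :: real assume y: "0 < y"
    have "Lp_bound p (\<lambda>x. B (Complex x y) * F (Complex x y)) (M powr p * C)"
      using B y p M by (intro Lp_bound_mult hardy_means_Lp_bound[OF C] holomorphic_horizontal_measurable) auto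
    then show "(\<integral>\<^sup>+x. ennreal (norm (B (Complex x y) * F (Complex x y)) powr p) \<partial>lborel) \<le> ennreal (M powr p * C)"
      by (simp add: Lp_bound_def)
  qed
  moreover have "Lp_bound p (\<lambda>t. b t * f t) (M powr p * D)"
    using b p M B by (intro Lp_bound_mult D boundary_of_norm_le) auto
  moreover have "boundary_of (\<lambda>w. B w * F w) (\<lambda>t. b t * f t)"
    using F b by (intro boundary_of_mult) (auto simp: hardy_pair_def)
  ultimately show ?thesis unfolding hardy_pair_def by blast
qed

lemma hardy_pair_zero: "f \<in> borel_measurable borel \<Longrightarrow> AE t in lborel. f t = 0 \<Longrightarrow> hardy_pair p (\<lambda>_. 0) f"
  unfolding hardy_pair_def
proof (intro conjI exI)
  assume f: "f \<in> borel_measurable borel" "AE t in lborel. f t = 0"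
  show "hardy_means p (\<lambda>_. 0) 0" by (simp add: hardy_means_def)
  have "(\<integral>\<^sup>+x. ennreal (norm (f x) powr p) \<partial>lborel) = (\<integral>\<^sup>+x. 0 \<partial>(lborel :: real measure))"
    using f(2) by (intro nn_integral_cong_AE) (auto elim: eventually_mono)
  then show "Lp_bound p f 0" using f by (simp add: Lp_bound_def)
  show "boundary_of (\<lambda>_. 0) f" unfolding boundary_of_def using f(2) by eventually_elim simp
qed

lemma hardy_pair_cong:
  assumes F: "hardy_pair p F f" and g: "g \<in> borel_measurable borel" "AE t in lborel. f t = g t"
  shows "hardy_pair p F g"
proof -
  obtain D where D: "Lp_bound p f D" using F by (auto simp: hardy_pair_def)
  have "(\<integral>\<^sup>+x. ennreal (norm (f x) powr p) \<partial>lborel) = (\<integral>\<^sup>+x. ennreal (norm (g x) powr p) \<partial>lborel)"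
    using g(2) by (intro nn_integral_cong_AE) (auto elim: eventually_mono)
  then have "Lp_bound p g D" using D g(1) by (simp add: Lp_bound_def)
  then show ?thesis using F g(2) boundary_of_cong[of F f g F] unfolding hardy_pair_def by blast
qed

lemma hardy_pair_unique:
  assumes F: "hardy_pair p F f" and G: "hardy_pair p G g" and p: "1 < p"
    and fg: "AE t in lborel. f t = g t" and w: "w \<in> upper"
  shows "F w = G w"
proof -
  have w': "0 < Im w" using w by simp
  have [measurable]: "f \<in> borel_measurable borel" "g \<in> borel_measurable borel"
    using F G by (auto simp: hardy_pair_def Lp_bound_def)
  have "(\<integral>t. f t \<partial>pois w) = (\<integral>t. g t \<partial>pois w)"
    using fg by (intro integral_cong_AE) (auto simp: AE_pois_iff[OF w'])
  then show ?thesis using hardy_poisson_representation[OF F p w'] hardy_poisson_representation[OF G p w'] by simp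
qed

lemma boundary_of_zero:
  assumes "boundary_of F f" "\<And>w. w \<in> upper \<Longrightarrow> F w = 0"
  shows "AE t in lborel. f t = 0"
  using assms(1) unfolding boundary_of_def
proof eventually_elim
  case (elim x)
  have "((\<lambda>y. 0) \<longlongrightarrow> f x) (at_right (0::real))"
    by (rule tendsto_at_right_cong[OF elim]) (simp add: assms(2))
  then show ?case by (simp add: tendsto_const_iff)
qed

section \<open>Boundary values of bounded holomorphic functions\<close>

text \<open>A boundary function is found without weak compactness. Let \<open>K n\<close> be the convex set of measurable functions
bounded by 1 whose Poisson integrals approximate \<open>F\<close> with error \<open>2 / (Im w (n + 1))\<close>; it contains the
restriction of \<open>F\<close> to the line of height \<open>1 / (n + 1)\<close>. These sets decrease, so functions of almost minimal
\<open>L\<^sub>2\<close> norm in them form a Cauchy sequence by the parallelogram law. The Poisson integral of the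
limit is \<open>F\<close>, and Poisson integrals have boundary limits almost everywhere.\<close>

theorem bounded_holomorphic_boundary:
  assumes hol: "F holomorphic_on upper" and bdd: "\<And>w. w \<in> upper \<Longrightarrow> norm (F w) \<le> 1"
  obtains f where "f \<in> borel_measurable borel" "boundary_of F f"
proof -
  note thesis_rule = that
  define K where "K = (\<lambda>n::nat. {g. g \<in> borel_measurable borel \<and> (\<forall>t. norm (g t) \<le> 1) \<and>
     (\<forall>w. 0 < Im w \<longrightarrow> norm ((\<integral>t. g t \<partial>pois w) - F w) \<le> 2 / (Im w * Suc n))})"
  define N where "N = (\<lambda>g :: real \<Rightarrow> complex. \<integral>t. (norm (g t))\<^sup>2 \<partial>pois \<i>)"
  interpret prob_space "pois \<i>" by (rule prob_space_pois) simp
  have Kint: "integrable (pois w) g" if "g \<in> K n" "0 < Im w" for g n w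
    using that by (intro integrable_pois_bounded[of _ _ 1]) (auto simp: K_def)
  have Nint: "integrable (pois \<i>) (\<lambda>t. (norm (g t))\<^sup>2)" if "g \<in> K n" for g n
    using that by (intro integrable_pois_bounded[of _ _ 1]) (auto simp: K_def power_le_one)
  have shift: "(\<lambda>t. F (Complex t (1 / Suc n))) \<in> K n" for n
    unfolding K_def
  proof (intro CollectI conjI allI impI)
    show "(\<lambda>t. F (Complex t (1 / Suc n))) \<in> borel_measurable borel"
      by (rule holomorphic_horizontal_measurable[OF hol]) simp
    show "norm (F (Complex t (1 / Suc n))) \<le> 1" for t by (rule bdd) simp
    fix w assume w: "0 < Im w"
    have "of_real t + \<i> * of_real (1 / Suc n) = Complex t (1 / Suc n)" for t by (simp add: complex_eq_iff)
    then have "(\<integral>t. F (Complex t (1 / Suc n)) \<partial>pois w) = F (w + \<i> * of_real (1 / Suc n))"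
      using poisson_shift[OF hol bdd, of "1 / Suc n" w] w by simp
    also have "norm (F (w + \<i> * of_real (1 / Suc n)) - F w) \<le> 2 * 1 / Im w * norm (w + \<i> * of_real (1 / Suc n) - w)"
      by (rule bounded_holomorphic_Lipschitz[OF hol bdd w]) auto
    also have "norm (w + \<i> * of_real (1 / Suc n) - w) = 1 / Suc n"
      by (simp only: add_diff_cancel_left' norm_mult norm_ii norm_of_real) simp
    finally show "norm ((\<integral>t. F (Complex t (1 / Suc n)) \<partial>pois w) - F w) \<le> 2 / (Im w * Suc n)" by simp
  qed
  have Kmono: "K j \<subseteq> K n" if "n \<le> j" for n j
  proof
    fix g assume g: "g \<in> K j"
    have "2 / (Im w * Suc j) \<le> 2 / (Im w * Suc n)" if "0 < Im w" for w
      using that \<open>n \<le> j\<close> by (intro divide_left_mono mult_left_mono) auto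
    then show "g \<in> K n" using g unfolding K_def by (auto intro: order_trans)
  qed
  have mid: "(\<lambda>t. (a t + b t) / 2) \<in> K n" if a: "a \<in> K n" and b: "b \<in> K n" for a b n
    unfolding K_def
  proof (intro CollectI conjI allI impI)
    have [measurable]: "a \<in> borel_measurable borel" "b \<in> borel_measurable borel" using a b by (auto simp: K_def)
    show "(\<lambda>t. (a t + b t) / 2) \<in> borel_measurable borel" by measurable
    show "norm ((a t + b t) / 2) \<le> 1" for t
    proof -
      have "norm (a t + b t) \<le> norm (a t) + norm (b t)" by (rule norm_triangle_ineq)
      moreover have "norm (a t) \<le> 1" "norm (b t) \<le> 1" using a b by (auto simp: K_def)
      ultimately show ?thesis by (simp add: norm_divide)
    qed
    fix w assume w: "0 < Im w"
    have "(\<integral>t. (a t + b t) / 2 \<partial>pois w) - F w = (((\<integral>t. a t \<partial>pois w) - F w) + ((\<integral>t. b t \<partial>pois w) - F w)) / 2"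
      using Kint[OF a w] Kint[OF b w] by (simp add: field_simps)
    also have "norm \<dots> \<le> (2 / (Im w * Suc n) + 2 / (Im w * Suc n)) / 2"
    proof -
      have "norm ((\<integral>t. a t \<partial>pois w) - F w) \<le> 2 / (Im w * Suc n)" "norm ((\<integral>t. b t \<partial>pois w) - F w) \<le> 2 / (Im w * Suc n)"
        using a b w by (auto simp: K_def)
      then show ?thesis unfolding norm_divide
        by (simp only: norm_numeral) (intro divide_right_mono order_trans[OF norm_triangle_ineq add_mono]; simp)
    qed
    finally show "norm ((\<integral>t. (a t + b t) / 2 \<partial>pois w) - F w) \<le> 2 / (Im w * Suc n)" by simp
  qed
  define m where "m = (\<lambda>n. Inf (N ` K n))"
  have N0: "0 \<le> N g" for g by (simp add: N_def)
  have bddb: "bdd_below (N ` K n)" for n using N0 by (intro bdd_belowI[of _ 0]) auto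
  have m_le: "m n \<le> N g" if "g \<in> K n" for g n
    unfolding m_def using that bddb by (intro cInf_lower) auto
  have m_mono: "incseq m"
    unfolding m_def using shift Kmono bddb by (intro monoI cInf_superset_mono image_mono) blast+
  have m1: "m n \<le> 1" for n
  proof -
    have "m n \<le> N (\<lambda>t. F (Complex t (1 / Suc n)))" by (rule m_le[OF shift])
    also have "\<dots> \<le> 1" unfolding N_def
      using shift[of n] Nint[OF shift] by (intro integral_le_const) (auto simp: K_def power_le_one)
    finally show ?thesis .
  qed
  obtain L where L: "m \<longlonglongrightarrow> L" using incseq_convergent[OF m_mono, of 1] m1 by blast
  have "\<exists>g\<in>K n. N g < m n + 1 / Suc n" for n
  proof -
    have ne: "N ` K n \<noteq> {}" using shift by blast
    have lt: "Inf (N ` K n) < m n + 1 / Suc n" by (simp add: m_def)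
    show ?thesis using cInf_lessD[OF ne lt] by blast
  qed
  then obtain g where g: "\<And>n. g n \<in> K n" "\<And>n. N (g n) < m n + 1 / Suc n" by metis
  have gm [measurable]: "g n \<in> borel_measurable borel" for n using g(1)[of n] by (simp add: K_def)
  have par: "N (\<lambda>t. a t - b t) = 2 * N a + 2 * N b - 4 * N (\<lambda>t. (a t + b t) / 2)" if ab: "a \<in> K n" "b \<in> K n" for a b n
  proof -
    have "(norm (a t - b t))\<^sup>2 = 2 * (norm (a t))\<^sup>2 + 2 * (norm (b t))\<^sup>2 - 4 * (norm ((a t + b t) / 2))\<^sup>2" for t
      by (simp add: norm_divide power_divide cmod_power2) (simp add: power2_eq_square algebra_simps)
    then show ?thesis unfolding N_def using Nint[OF ab(1)] Nint[OF ab(2)] Nint[OF mid[OF ab]] by simp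
  qed
  have diff: "N (\<lambda>t. g i t - g j t) \<le> 2 * \<bar>m j - m i\<bar> + 2 / Suc i + 2 / Suc j" for i j
  proof -
    have *: "N (\<lambda>t. g i t - g j t) \<le> 2 * \<bar>m j - m i\<bar> + 2 / Suc i + 2 / Suc j" if "i \<le> j" for i j
    proof -
      have gj: "g j \<in> K i" using g(1)[of j] Kmono[OF that] by blast
      have "m i \<le> N (\<lambda>t. (g i t + g j t) / 2)" by (rule m_le[OF mid[OF g(1) gj]])
      moreover have "m i \<le> m j" using m_mono that by (rule incseqD)
      ultimately show ?thesis using par[OF g(1) gj] g(2)[of i] g(2)[of j] by simp
    qed
    have "N (\<lambda>t. g i t - g j t) = N (\<lambda>t. g j t - g i t)" by (simp add: N_def norm_minus_commute)
    then show ?thesis using *[of i j] *[of j i] by (cases "i \<le> j") (auto simp: abs_minus_commute)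
  qed
  have L1: "\<exists>M. \<forall>i\<ge>M. \<forall>j\<ge>M. (\<integral>t. norm (g i t - g j t) \<partial>pois \<i>) < e" if e: "0 < e" for e
  proof -
    \<comment> \<open>The square norm is turned into an \<open>L\<^sub>1\<close> norm by \<open>x \<le> e / 2 + x\<^sup>2 / e\<close>.\<close>
    define c where "c = e * e / 4"
    have c: "0 < c" using e by (simp add: c_def)
    have "Cauchy m" using L by (rule LIMSEQ_imp_Cauchy)
    then obtain M1 where M1: "\<And>i j. i \<ge> M1 \<Longrightarrow> j \<ge> M1 \<Longrightarrow> \<bar>m j - m i\<bar> < c / 4"
      using c unfolding Cauchy_def dist_real_def by (metis divide_pos_pos zero_less_numeral)
    obtain M2 :: nat where M2: "16 / c < real M2" using reals_Archimedean2 by blast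
    have small: "2 / real (Suc i) < c / 8" if "i \<ge> M2" for i
    proof -
      have "16 / c < real (Suc i)" using M2 that by linarith
      then show ?thesis using c by (simp add: field_simps)
    qed
    have "(\<integral>t. norm (g i t - g j t) \<partial>pois \<i>) < e" if ij: "i \<ge> max M1 M2" "j \<ge> max M1 M2" for i j
    proof -
      have b1: "norm (g i t) \<le> 1" for i t using g(1)[of i] by (simp add: K_def)
      have b2: "norm (g i t - g j t) \<le> 2" for t
        using norm_triangle_ineq4[of "g i t" "g j t"] b1[of i t] b1[of j t] by linarith
      have i1: "integrable (pois \<i>) (\<lambda>t. norm (g i t - g j t))"
        using b2 by (intro integrable_pois_bounded[of _ _ 2]) auto
      have i2: "integrable (pois \<i>) (\<lambda>t. (norm (g i t - g j t))\<^sup>2)"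
      proof (rule integrable_pois_bounded[of _ _ 4])
        show "norm ((norm (g i t - g j t))\<^sup>2) \<le> 4" for t
          using power_mono[OF b2[of t], of 2] by simp
      qed auto
      have "(\<integral>t. norm (g i t - g j t) \<partial>pois \<i>) \<le> (\<integral>t. e / 2 + (norm (g i t - g j t))\<^sup>2 * (1 / e) \<partial>pois \<i>)"
      proof (rule integral_mono[OF i1])
        show "integrable (pois \<i>) (\<lambda>t. e / 2 + (norm (g i t - g j t))\<^sup>2 * (1 / e))" using i2 by simp
        fix t
        define x where "x = norm (g i t - g j t)"
        have "0 \<le> (x - e)\<^sup>2 + x\<^sup>2" by simp
        then have "2 * e * x \<le> e * e + 2 * x\<^sup>2" by (simp add: power2_eq_square algebra_simps)
        then have "x \<le> e / 2 + x\<^sup>2 * (1 / e)" using e by (simp add: field_simps power2_eq_square)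
        then show "norm (g i t - g j t) \<le> e / 2 + (norm (g i t - g j t))\<^sup>2 * (1 / e)" by (simp only: x_def)
      qed
      also have "\<dots> = e / 2 + N (\<lambda>t. g i t - g j t) * (1 / e)"
        using i2 prob_space by (simp add: N_def)
      also have "\<dots> < e / 2 + c * (1 / e)"
      proof -
        have "N (\<lambda>t. g i t - g j t) < c" using diff[of i j] M1[of i j] small[of i] small[of j] ij c by simp
        then show ?thesis using e by (intro add_strict_left_mono mult_strict_right_mono) auto
      qed
      also have "\<dots> \<le> e" using e by (simp add: c_def)
      finally show ?thesis .
    qed
    then show ?thesis by blast
  qed
  obtain r where r: "strict_mono r" "AE t in pois \<i>. Cauchy (\<lambda>i. g (r i) t)"
    by (rule cauchy_L1_AE_cauchy_subseq[of "pois \<i>" g]) (use Kint[OF g(1)] L1 in auto)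
  define f where "f = (\<lambda>t. lim (\<lambda>i. g (r i) t))"
  have fm [measurable]: "f \<in> borel_measurable borel" unfolding f_def by measurable
  have lim: "AE t in lborel. (\<lambda>i. g (r i) t) \<longlonglongrightarrow> f t"
  proof -
    have "AE t in lborel. Cauchy (\<lambda>i. g (r i) t)" using r(2) by (simp add: AE_pois_iff)
    then show ?thesis by eventually_elim (simp add: f_def Cauchy_convergent_iff convergent_LIMSEQ_iff)
  qed
  have rep: "F w = (\<integral>t. f t \<partial>pois w)" if w: "0 < Im w" for w
  proof (rule LIMSEQ_unique)
    interpret W: prob_space "pois w" by (rule prob_space_pois[OF w])
    show "(\<lambda>i. \<integral>t. g (r i) t \<partial>pois w) \<longlonglongrightarrow> (\<integral>t. f t \<partial>pois w)"
    proof (rule integral_dominated_convergence[where w = "\<lambda>_. 1"])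
      show "AE t in pois w. (\<lambda>i. g (r i) t) \<longlonglongrightarrow> f t" using lim by (simp add: AE_pois_iff[OF w])
      show "AE t in pois w. norm (g (r i) t) \<le> 1" for i using g(1)[of "r i"] by (simp add: K_def)
    qed auto
    have "(\<lambda>i. (\<integral>t. g (r i) t \<partial>pois w) - F w) \<longlonglongrightarrow> 0"
    proof (rule Lim_null_comparison[OF always_eventually], rule allI)
      have "(\<lambda>i. 2 / Im w * (1 / Suc i)) \<longlonglongrightarrow> 2 / Im w * 0" by (rule tendsto_mult[OF tendsto_const null_sequence])
      then show "(\<lambda>i. 2 / Im w * (1 / Suc i)) \<longlonglongrightarrow> 0" by (simp only: mult_zero_right)
      fix i
      have "g (r i) \<in> K i" using g(1)[of "r i"] Kmono[OF seq_suble[OF r(1), of i]] by blast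
      then show "norm ((\<integral>t. g (r i) t \<partial>pois w) - F w) \<le> 2 / Im w * (1 / Suc i)" using w by (simp add: K_def)
    qed
    then show "(\<lambda>i. \<integral>t. g (r i) t \<partial>pois w) \<longlonglongrightarrow> F w" by (rule LIM_zero_cancel)
  qed
  have "AE t in lborel. norm (f t) \<le> 1"
    using lim
  proof eventually_elim
    case (elim t)
    have "norm (g (r i) t) \<le> 1" for i using g(1)[of "r i"] by (simp add: K_def)
    then show ?case using tendsto_norm[OF elim] by (intro LIMSEQ_le_const2[of _ "norm (f t)"]) auto
  qed
  then have fint: "integrable (pois \<i>) f" by (intro integrable_const_bound[of _ 1]) (auto simp: AE_pois_iff)
  have "boundary_of F f"
    unfolding boundary_of_def using AE_poisson_limit[OF fint]
  proof eventually_elim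
    case (elim x)
    show ?case by (rule tendsto_at_right_cong[OF elim]) (simp add: rep)
  qed
  then show thesis by (rule thesis_rule[OF fm])
qed

section \<open>Recognising Hardy functions by Jensen's inequality\<close>

text \<open>Jensen's inequality for the exponential function, from its tangent at the mean \<open>c\<close>.\<close>

lemma exp_integral_ln_le:
  fixes q :: "real \<Rightarrow> complex"
  assumes w: "0 < Im w" and q: "AE t in lborel. q t \<noteq> 0" "integrable (pois w) (\<lambda>t. ln (norm (q t)))"
    "integrable (pois w) (\<lambda>t. norm (q t) powr p)"
  shows "exp (\<integral>t. ln (norm (q t)) \<partial>pois w) powr p \<le> (\<integral>t. norm (q t) powr p \<partial>pois w)"
proof -
  interpret prob_space "pois w" by (rule prob_space_pois[OF w])
  define c where "c = p * (\<integral>t. ln (norm (q t)) \<partial>pois w)"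
  have "exp c = (\<integral>t. exp c * (1 + (p * ln (norm (q t)) - c)) \<partial>pois w)"
    using q(2) prob_space by (simp add: c_def)
  also have "\<dots> \<le> (\<integral>t. norm (q t) powr p \<partial>pois w)"
  proof (rule integral_mono_AE)
    show "integrable (pois w) (\<lambda>t. exp c * (1 + (p * ln (norm (q t)) - c)))" using q(2) by simp
    show "integrable (pois w) (\<lambda>t. norm (q t) powr p)" by fact
    have "AE t in pois w. q t \<noteq> 0" using q(1) by (simp add: AE_pois_iff[OF w])
    then show "AE t in pois w. exp c * (1 + (p * ln (norm (q t)) - c)) \<le> norm (q t) powr p"
    proof eventually_elim
      case (elim t)
      have "exp c * (1 + (p * ln (norm (q t)) - c)) \<le> exp c * exp (p * ln (norm (q t)) - c)"
        by (intro mult_left_mono exp_ge_add_one_self) auto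
      also have "\<dots> = norm (q t) powr p" using elim by (simp add: powr_def exp_diff)
      finally show ?case .
    qed
  qed
  finally show ?thesis by (simp add: c_def powr_def)
qed

lemma poisson_kernel_swap: "poisson_kernel (Complex x y) t = poisson_kernel (Complex t y) x"
  by (simp add: poisson_kernel_def power2_commute)

text \<open>The kernel is symmetric in \<open>x\<close> and \<open>t\<close>, so the exchanged inner integral is 1.\<close>

lemma poisson_mean_integral:
  assumes [measurable]: "u \<in> borel_measurable borel" and y: "0 < y"
  shows "(\<integral>\<^sup>+x. (\<integral>\<^sup>+t. u t \<partial>pois (Complex x y)) \<partial>lborel) = (\<integral>\<^sup>+t. u t \<partial>lborel)"
proof -
  have pm [measurable]: "(\<lambda>(x, t). poisson_kernel (Complex x y) t) \<in> borel_measurable (borel \<Otimes>\<^sub>M borel)"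
    unfolding poisson_kernel_def by simp
  have m: "(\<lambda>(x, t). ennreal (poisson_kernel (Complex x y) t) * u t) \<in> borel_measurable (lborel \<Otimes>\<^sub>M lborel)"
    by measurable
  have "(\<integral>\<^sup>+x. (\<integral>\<^sup>+t. u t \<partial>pois (Complex x y)) \<partial>lborel) = (\<integral>\<^sup>+x. (\<integral>\<^sup>+t. ennreal (poisson_kernel (Complex x y) t) * u t \<partial>lborel) \<partial>lborel)"
    by (intro nn_integral_cong nn_integral_pois) simp
  also have "\<dots> = (\<integral>\<^sup>+t. (\<integral>\<^sup>+x. ennreal (poisson_kernel (Complex x y) t) * u t \<partial>lborel) \<partial>lborel)"
    by (rule lborel_pair.Fubini'[symmetric]) (use m in simp)
  also have "\<dots> = (\<integral>\<^sup>+t. u t \<partial>lborel)"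
  proof (rule nn_integral_cong)
    fix t
    have "(\<integral>\<^sup>+x. ennreal (poisson_kernel (Complex x y) t) * u t \<partial>lborel) = (\<integral>\<^sup>+x. ennreal (poisson_kernel (Complex t y) x) \<partial>lborel) * u t"
      by (subst poisson_kernel_swap) (rule nn_integral_multc, measurable)
    also have "(\<integral>\<^sup>+x. ennreal (poisson_kernel (Complex t y) x) \<partial>lborel) = ennreal 1"
      using has_bochner_integral_poisson_kernel[of "Complex t y"] poisson_kernel_pos[of "Complex t y"] y
      by (subst nn_integral_eq_integral) (auto simp: has_bochner_integral_iff intro: less_imp_le)
    finally show "(\<integral>\<^sup>+x. ennreal (poisson_kernel (Complex x y) t) * u t \<partial>lborel) = u t" by simp
  qed
  finally show ?thesis .
qed

text \<open>A converse to Jensen's inequality: a function that satisfies it belongs to \<open>H\<^sup>p\<close> as soon as its boundary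
function belongs to \<open>L\<^sub>p\<close>.\<close>

lemma hardy_pairI_jensen:
  assumes Q: "Q holomorphic_on upper" and q: "Lp_bound p q D" "boundary_of Q q" and p: "1 \<le> p"
    and nz: "AE t in lborel. q t \<noteq> 0" and int: "integrable (pois \<i>) (\<lambda>t. ln (norm (q t)))"
    and le: "\<And>w. 0 < Im w \<Longrightarrow> norm (Q w) \<le> exp (\<integral>t. ln (norm (q t)) \<partial>pois w)"
  shows "hardy_pair p Q q"
proof -
  have [measurable]: "q \<in> borel_measurable borel" using q by (simp add: Lp_bound_def)
  have "hardy_means p Q D"
    unfolding hardy_means_def
  proof (intro conjI allI impI Q)
    show "0 \<le> D" using q by (simp add: Lp_bound_def)
    fix y :: real assume y: "0 < y"
    have "(\<integral>\<^sup>+x. ennreal (norm (Q (Complex x y)) powr p) \<partial>lborel) \<le> (\<integral>\<^sup>+x. (\<integral>\<^sup>+t. ennreal (norm (q t) powr p) \<partial>pois (Complex x y)) \<partial>lborel)"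
    proof (rule nn_integral_mono)
      fix x
      have up: "0 < Im (Complex x y)" using y by simp
      note i = Lp_bound_integrable_pois[OF q(1) p up]
      have "norm (Q (Complex x y)) powr p \<le> exp (\<integral>t. ln (norm (q t)) \<partial>pois (Complex x y)) powr p"
        using p by (intro powr_mono2 le up) auto
      also have "\<dots> \<le> (\<integral>t. norm (q t) powr p \<partial>pois (Complex x y))"
        by (intro exp_integral_ln_le up nz i integrable_pois_transfer[OF int]) auto
      finally have "ennreal (norm (Q (Complex x y)) powr p) \<le> ennreal (\<integral>t. norm (q t) powr p \<partial>pois (Complex x y))"
        by (rule ennreal_leI)
      also have "\<dots> = (\<integral>\<^sup>+t. ennreal (norm (q t) powr p) \<partial>pois (Complex x y))"
        using i(2) by (intro nn_integral_eq_integral[symmetric]) auto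
      finally show "ennreal (norm (Q (Complex x y)) powr p) \<le> (\<integral>\<^sup>+t. ennreal (norm (q t) powr p) \<partial>pois (Complex x y))" .
    qed
    also have "\<dots> = (\<integral>\<^sup>+t. ennreal (norm (q t) powr p) \<partial>lborel)" by (rule poisson_mean_integral[OF _ y]) measurable
    finally show "(\<integral>\<^sup>+x. ennreal (norm (Q (Complex x y)) powr p) \<partial>lborel) \<le> ennreal D"
      using q(1) unfolding Lp_bound_def by (auto intro: order_trans)
  qed
  then show ?thesis using q unfolding hardy_pair_def by blast
qed

section \<open>Inner-outer factorisation\<close>

text \<open>Outer functions are those with equality in Jensen's inequality at every point.\<close>

definition outer_pair :: "(complex \<Rightarrow> complex) \<Rightarrow> (real \<Rightarrow> complex) \<Rightarrow> bool" where
  "outer_pair U u \<longleftrightarrow> (AE t in lborel. u t \<noteq> 0) \<and> integrable (pois \<i>) (\<lambda>t. ln (norm (u t))) \<and>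
     (\<forall>w. 0 < Im w \<longrightarrow> norm (U w) = exp (\<integral>t. ln (norm (u t)) \<partial>pois w))"

text \<open>The outer factor is the exponential of the Schwarz integral of \<open>ln \<bar>v\<bar>\<close>. By Jensen's inequality the quotient
\<open>I\<close> is bounded by 1, so it has boundary values, and they are unimodular because
\<open>\<bar>V\<bar>\<close> and \<open>\<bar>U\<bar>\<close> have the same boundary values. The boundary values of \<open>U\<close> itself, which
involve a conjugate function, are then those of \<open>V / I\<close>.\<close>

theorem inner_outer_factorisation:
  assumes V: "hardy_pair p V v" and p: "1 < p" and nz: "w0 \<in> upper" "V w0 \<noteq> 0"
  obtains I \<iota> U u where "I holomorphic_on upper" "\<And>w. w \<in> upper \<Longrightarrow> norm (I w) \<le> 1" "\<iota> \<in> borel_measurable borel"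
    "boundary_of I \<iota>" "AE t in lborel. norm (\<iota> t) = 1" "hardy_pair p U u" "outer_pair U u"
    "AE t in lborel. v t = \<iota> t * u t"
proof -
  note thesis_rule = that
  obtain C D where C: "hardy_means p V C" and D: "Lp_bound p v D" using V by (auto simp: hardy_pair_def)
  have Vhol: "V holomorphic_on upper" using C by (simp add: hardy_means_def)
  have Vb: "boundary_of V v" using V by (simp add: hardy_pair_def)
  have vm [measurable]: "v \<in> borel_measurable borel" using D by (simp add: Lp_bound_def)
  define l where "l = (\<lambda>t. ln (norm (v t)))"
  note J = hardy_jensen[OF V p nz, folded l_def]
  have lint: "integrable (pois \<i>) l" using J(2) by (simp add: l_def)
  have Jle: "norm (V w) \<le> exp (\<integral>t. l t \<partial>pois w)" if "0 < Im w" for w using J(3)[OF that] by (simp add: l_def)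
  define U where "U = (\<lambda>w. exp (schwarz l w))"
  have Unorm: "norm (U w) = exp (\<integral>t. l t \<partial>pois w)" if "0 < Im w" for w
    using Re_schwarz[OF that lint] by (simp add: U_def)
  have Uhol: "U holomorphic_on upper" unfolding U_def by (intro holomorphic_intros holomorphic_schwarz lint)
  define I where "I = (\<lambda>w. V w / U w)"
  have Ihol: "I holomorphic_on upper" unfolding I_def by (intro holomorphic_intros Vhol Uhol) (simp add: U_def)
  have Ile: "norm (I w) \<le> 1" if "w \<in> upper" for w
    using that Jle[of w] Unorm[of w] by (simp add: I_def norm_divide)
  obtain \<iota>0 where \<iota>0: "\<iota>0 \<in> borel_measurable borel" "boundary_of I \<iota>0"
    using bounded_holomorphic_boundary[OF Ihol Ile] by blast
  have norm1: "AE t in lborel. norm (\<iota>0 t) = 1"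
    using \<iota>0(2)[unfolded boundary_of_def] Vb[unfolded boundary_of_def] AE_poisson_limit[OF lint] J(1)
  proof eventually_elim
    case (elim x)
    have "((\<lambda>y. norm (V (Complex x y)) / exp (\<integral>t. l t \<partial>pois (Complex x y))) \<longlongrightarrow> norm (v x) / exp (l x)) (at_right 0)"
      by (intro tendsto_intros elim) simp
    moreover have "norm (v x) / exp (l x) = 1" using elim by (simp add: l_def)
    ultimately have "((\<lambda>y. norm (I (Complex x y))) \<longlongrightarrow> 1) (at_right 0)"
      using Unorm by (auto simp: I_def norm_divide intro: tendsto_at_right_cong)
    then show ?case using tendsto_norm[OF elim(1)] tendsto_unique[of "at_right (0::real)"] by fastforce
  qed
  define u where "u = (\<lambda>t. v t / \<iota>0 t)"
  have um [measurable]: "u \<in> borel_measurable borel" unfolding u_def using \<iota>0(1) by measurable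
  have u_norm: "AE t in lborel. norm (u t) = norm (v t)"
    using norm1 by eventually_elim (simp add: u_def norm_divide)
  have vu: "AE t in lborel. v t = \<iota>0 t * u t"
    using norm1 by eventually_elim (auto simp: u_def)
  have u_nz: "AE t in lborel. u t \<noteq> 0" using u_norm J(1) by eventually_elim auto
  have ln_eq: "AE t in pois w. ln (norm (u t)) = l t" if "0 < Im w" for w
    using u_norm unfolding AE_pois_iff[OF that] by eventually_elim (simp add: l_def)
  have lm [measurable]: "l \<in> borel_measurable borel" unfolding l_def by measurable
  have uint: "integrable (pois \<i>) (\<lambda>t. ln (norm (u t)))"
    using lint by (subst integrable_cong_AE[OF _ _ ln_eq]) auto
  have ueq: "(\<integral>t. ln (norm (u t)) \<partial>pois w) = (\<integral>t. l t \<partial>pois w)" if "0 < Im w" for w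
    by (intro integral_cong_AE ln_eq that) auto
  have ob: "boundary_of U u"
    unfolding boundary_of_def
    using \<iota>0(2)[unfolded boundary_of_def] Vb[unfolded boundary_of_def] norm1
  proof eventually_elim
    case (elim x)
    have nz: "\<iota>0 x \<noteq> 0" using elim by auto
    have "((\<lambda>y. V (Complex x y) / I (Complex x y)) \<longlongrightarrow> u x) (at_right 0)"
      unfolding u_def by (intro tendsto_intros elim nz)
    moreover have "\<forall>\<^sub>F y in at_right 0. I (Complex x y) \<noteq> 0"
      using elim(1) nz by (rule tendsto_imp_eventually_ne)
    then have "\<forall>\<^sub>F y in at_right 0. V (Complex x y) / I (Complex x y) = U (Complex x y)"
      by eventually_elim (auto simp: I_def)
    ultimately show ?case by (rule Lim_transform_eventually)
  qed
  have outer: "outer_pair U u"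
    unfolding outer_pair_def using u_nz uint Unorm ueq by auto
  have "hardy_pair p U u"
  proof (rule hardy_pairI_jensen[OF Uhol _ ob _ u_nz uint])
    have "(\<integral>\<^sup>+x. ennreal (norm (u x) powr p) \<partial>lborel) = (\<integral>\<^sup>+x. ennreal (norm (v x) powr p) \<partial>lborel)"
      using u_norm by (intro nn_integral_cong_AE) (auto elim: eventually_mono)
    then show "Lp_bound p u D" using D by (simp add: Lp_bound_def)
    show "norm (U w) \<le> exp (\<integral>t. ln (norm (u t)) \<partial>pois w)" if "0 < Im w" for w
      using Unorm[OF that] ueq[OF that] by simp
  qed (use p in simp)
  then show thesis
    by (intro thesis_rule[of I \<iota>0 U u] Ihol Ile \<iota>0 norm1 outer vu) auto
qed

text \<open>The quotient \<open>A B / U\<close> satisfies Jensen's inequality: add those for \<open>A\<close> and \<open>B\<close> and subtract the equality for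
\<open>U\<close>.\<close>

theorem outer_quotient:
  assumes A: "hardy_pair p A a" and B: "hardy_pair p B b" and U: "hardy_pair p U u" and outer: "outer_pair U u"
    and p: "1 < p" and q: "Lp_bound p q D" and eq: "AE t in lborel. q t * u t = a t * b t"
  shows "\<exists>Q. hardy_pair p Q q"
proof (cases "(\<forall>w\<in>upper. A w = 0) \<or> (\<forall>w\<in>upper. B w = 0)")
  case True
  have "AE t in lborel. a t * b t = 0"
  proof (cases "\<forall>w\<in>upper. A w = 0")
    case True
    then have "AE t in lborel. a t = 0" using A boundary_of_zero[of A a] by (auto simp: hardy_pair_def)
    then show ?thesis by eventually_elim simp
  next
    case False
    then have "AE t in lborel. b t = 0" using \<open>_ \<or> _\<close> B boundary_of_zero[of B b] by (auto simp: hardy_pair_def)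
    then show ?thesis by eventually_elim simp
  qed
  then have "AE t in lborel. q t = 0"
    using eq outer unfolding outer_pair_def by (elim conjE) (elim AE_mp, intro AE_I2, auto)
  then show ?thesis using hardy_pair_zero[of q p] q by (auto simp: Lp_bound_def)
next
  case False
  then obtain wa wb where wa: "wa \<in> upper" "A wa \<noteq> 0" and wb: "wb \<in> upper" "B wb \<noteq> 0" by blast
  note JA = hardy_jensen[OF A p wa] and JB = hardy_jensen[OF B p wb]
  have u: "AE t in lborel. u t \<noteq> 0" "integrable (pois \<i>) (\<lambda>t. ln (norm (u t)))"
     "\<And>w. 0 < Im w \<Longrightarrow> norm (U w) = exp (\<integral>t. ln (norm (u t)) \<partial>pois w)"
    using outer by (auto simp: outer_pair_def)
  have hol: "A holomorphic_on upper" "B holomorphic_on upper" "U holomorphic_on upper"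
    using A B U by (auto simp: hardy_pair_def hardy_means_def)
  have bd: "boundary_of A a" "boundary_of B b" "boundary_of U u" using A B U by (auto simp: hardy_pair_def)
  have [measurable]: "a \<in> borel_measurable borel" "b \<in> borel_measurable borel" "u \<in> borel_measurable borel" "q \<in> borel_measurable borel"
    using A B U q by (auto simp: hardy_pair_def Lp_bound_def)
  have Unz: "U w \<noteq> 0" if "w \<in> upper" for w using u(3)[of w] that by auto
  define Q where "Q = (\<lambda>w. A w * B w / U w)"
  have Qhol: "Q holomorphic_on upper" unfolding Q_def by (intro holomorphic_intros hol Unz)
  have qeq: "AE t in lborel. q t = a t * b t / u t"
    using eq u(1) by eventually_elim (simp add: field_simps)
  have qb: "boundary_of Q q"
    unfolding boundary_of_def using bd[unfolded boundary_of_def] u(1) qeq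
  proof eventually_elim
    case (elim x)
    show ?case unfolding Q_def elim(5) by (intro tendsto_intros elim)
  qed
  have qnz: "AE t in lborel. q t \<noteq> 0" using qeq u(1) JA(1) JB(1) by eventually_elim simp
  define l where "l = (\<lambda>t. ln (norm (a t)) + ln (norm (b t)) - ln (norm (u t)))"
  have lm [measurable]: "l \<in> borel_measurable borel" unfolding l_def by measurable
  have lint: "integrable (pois \<i>) l" unfolding l_def using JA(2) JB(2) u(2) by auto
  have leq: "AE t in pois w. ln (norm (q t)) = l t" if "0 < Im w" for w
    unfolding AE_pois_iff[OF that] using qeq u(1) JA(1) JB(1)
    by eventually_elim (simp add: l_def norm_mult norm_divide ln_mult ln_div)
  have "hardy_pair p Q q"
  proof (rule hardy_pairI_jensen[OF Qhol q qb _ qnz])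
    show "integrable (pois \<i>) (\<lambda>t. ln (norm (q t)))" using lint by (subst integrable_cong_AE[OF _ _ leq]) auto
    fix w assume w: "0 < Im w"
    have i: "integrable (pois w) (\<lambda>t. ln (norm (a t)))" "integrable (pois w) (\<lambda>t. ln (norm (b t)))" "integrable (pois w) (\<lambda>t. ln (norm (u t)))"
      by (rule integrable_pois_transfer[OF _ _ w], rule JA JB u, simp)+
    have "norm (Q w) = norm (A w) * norm (B w) / norm (U w)" by (simp add: Q_def norm_mult norm_divide)
    also have "\<dots> \<le> exp (\<integral>t. ln (norm (a t)) \<partial>pois w) * exp (\<integral>t. ln (norm (b t)) \<partial>pois w) / norm (U w)"
      by (intro divide_right_mono mult_mono JA JB w) auto
    also have "\<dots> = exp ((\<integral>t. ln (norm (a t)) \<partial>pois w) + (\<integral>t. ln (norm (b t)) \<partial>pois w) - (\<integral>t. ln (norm (u t)) \<partial>pois w))"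
      using u(3)[OF w] by (simp add: exp_add exp_diff)
    also have "(\<integral>t. ln (norm (a t)) \<partial>pois w) + (\<integral>t. ln (norm (b t)) \<partial>pois w) - (\<integral>t. ln (norm (u t)) \<partial>pois w) = (\<integral>t. l t \<partial>pois w)"
      unfolding l_def using i by simp
    also have "(\<integral>t. l t \<partial>pois w) = (\<integral>t. ln (norm (q t)) \<partial>pois w)"
      by (intro integral_cong_AE AE_symmetric[OF leq] w) auto
    finally show "norm (Q w) \<le> exp (\<integral>t. ln (norm (q t)) \<partial>pois w)" .
  qed (use p in simp)
  then show ?thesis by blast
qed

section \<open>Zeros, division and the intersection with the conjugate space\<close>

text \<open>Outside a disc around \<open>a\<close> the quotient is at most a constant times \<open>F\<close>; in the disc it is
bounded by compactness, and the disc meets each horizontal line in a bounded segment.\<close>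

lemma hardy_divide:
  assumes F: "hardy_pair p F f" and p: "1 < p" and a: "a \<in> upper" and zero: "F a = 0"
  shows "\<exists>Q. hardy_pair p Q (\<lambda>t. f t / (of_real t - a))"
proof -
  obtain C D where C: "hardy_means p F C" and D: "Lp_bound p f D" using F by (auto simp: hardy_pair_def)
  have hol: "F holomorphic_on upper" using C by (simp add: hardy_means_def)
  have ia: "0 < Im a" using a by simp
  define Q where "Q = (\<lambda>z. if z = a then deriv F a else (F z - F a) / (z - a))"
  have Qhol: "Q holomorphic_on upper"
    unfolding Q_def using a open_upper by (intro pole_lemma[OF hol]) (simp add: interior_open)
  define \<rho> where "\<rho> = Im a / 2"
  have \<rho>: "0 < \<rho>" using ia by (simp add: \<rho>_def)
  have sub: "cball a \<rho> \<subseteq> upper"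
  proof
    fix z assume "z \<in> cball a \<rho>"
    then have "Im a - Im z \<le> \<rho>" using abs_Im_le_cmod[of "a - z"] by (simp add: dist_norm)
    then show "z \<in> upper" using \<rho> by (simp add: \<rho>_def)
  qed
  have "compact (Q ` cball a \<rho>)"
    using sub by (intro compact_continuous_image continuous_on_subset[OF holomorphic_on_imp_continuous_on[OF Qhol]]) auto
  then have "bounded (Q ` cball a \<rho>)" by (rule compact_imp_bounded)
  then obtain M where M: "\<And>z. z \<in> cball a \<rho> \<Longrightarrow> norm (Q z) \<le> M"
    unfolding bounded_iff by blast
  have M0: "0 \<le> M" using order_trans[OF norm_ge_zero M[of a]] \<rho> by simp
  have bd: "boundary_of Q (\<lambda>t. f t / (of_real t - a))"
    using F unfolding hardy_pair_def
  proof (elim conjE)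
    assume "boundary_of F f"
    then show ?thesis unfolding boundary_of_def
    proof eventually_elim
      case (elim x)
      have nz: "of_real x - a \<noteq> 0" using ia by (auto simp: complex_eq_iff)
      have c: "((\<lambda>y. Complex x y) \<longlongrightarrow> of_real x) (at_right 0)"
        unfolding complex_of_real_def by (intro tendsto_Complex tendsto_intros)
      have "((\<lambda>y. F (Complex x y) / (Complex x y - a)) \<longlongrightarrow> f x / (of_real x - a)) (at_right 0)"
        by (intro tendsto_intros elim c nz)
      moreover have "\<forall>\<^sub>F y in at_right 0. Complex x y \<noteq> a"
        using tendsto_imp_eventually_ne[OF c, of a] nz by auto
      then have "\<forall>\<^sub>F y in at_right 0. F (Complex x y) / (Complex x y - a) = Q (Complex x y)"
        by eventually_elim (simp add: Q_def zero)
      ultimately show ?case by (rule Lim_transform_eventually)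
    qed
  qed
  have bnd: "Lp_bound p (\<lambda>t. 1 / (of_real t - a) * f t) ((1 / Im a) powr p * D)"
  proof (rule Lp_bound_mult[OF D])
    show "AE t in lborel. norm (1 / (of_real t - a)) \<le> 1 / Im a"
    proof (intro AE_I2)
      fix t
      have "Im a \<le> norm (of_real t - a)" using abs_Im_le_cmod[of "of_real t - a"] ia by simp
      then show "norm (1 / (of_real t - a)) \<le> 1 / Im a" using ia by (simp add: norm_divide frac_le)
    qed
  qed (use p ia in auto)
  have "hardy_means p Q ((1 / \<rho>) powr p * C + M powr p * (2 * \<rho>))"
    unfolding hardy_means_def
  proof (intro conjI allI impI Qhol)
    show "0 \<le> (1 / \<rho>) powr p * C + M powr p * (2 * \<rho>)" using C \<rho> by (auto simp: hardy_means_def)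
    fix y :: real assume y: "0 < y"
    have Fm [measurable]: "(\<lambda>x. F (Complex x y)) \<in> borel_measurable borel" by (rule holomorphic_horizontal_measurable[OF hol y])
    have "(\<integral>\<^sup>+x. ennreal (norm (Q (Complex x y)) powr p) \<partial>lborel) \<le>
      (\<integral>\<^sup>+x. ennreal ((1 / \<rho>) powr p) * ennreal (norm (F (Complex x y)) powr p) + ennreal (M powr p) * indicator {Re a - \<rho>..Re a + \<rho>} x \<partial>lborel)"
    proof (rule nn_integral_mono)
      fix x
      show "ennreal (norm (Q (Complex x y)) powr p) \<le>
        ennreal ((1 / \<rho>) powr p) * ennreal (norm (F (Complex x y)) powr p) + ennreal (M powr p) * indicator {Re a - \<rho>..Re a + \<rho>} x"
      proof (cases "Complex x y \<in> cball a \<rho>")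
        case True
        have "\<bar>Re (a - Complex x y)\<bar> \<le> \<rho>" using True abs_Re_le_cmod[of "a - Complex x y"] by (simp add: dist_norm)
        then have "x \<in> {Re a - \<rho>..Re a + \<rho>}" by (auto simp: abs_le_iff)
        moreover have "norm (Q (Complex x y)) powr p \<le> M powr p" using M[OF True] p by (intro powr_mono2) auto
        ultimately show ?thesis by (simp add: ennreal_leI add_increasing)
      next
        case False
        then have far: "\<rho> < norm (Complex x y - a)" by (simp add: dist_norm norm_minus_commute)
        then have "Complex x y \<noteq> a" using \<rho> by auto
        then have "norm (Q (Complex x y)) = norm (F (Complex x y)) / norm (Complex x y - a)"
          by (simp add: Q_def zero norm_divide)
        also have "\<dots> \<le> norm (F (Complex x y)) / \<rho>" using far \<rho> by (intro divide_left_mono mult_pos_pos) auto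
        finally have "norm (Q (Complex x y)) powr p \<le> (1 / \<rho> * norm (F (Complex x y))) powr p"
          using p by (intro powr_mono2) auto
        also have "\<dots> = (1 / \<rho>) powr p * norm (F (Complex x y)) powr p" by (rule powr_mult)
        finally have "ennreal (norm (Q (Complex x y)) powr p) \<le> ennreal ((1 / \<rho>) powr p) * ennreal (norm (F (Complex x y)) powr p)"
          by (simp add: ennreal_mult[symmetric] ennreal_leI)
        then show ?thesis by (simp add: add_increasing2)
      qed
    qed
    also have "\<dots> = ennreal ((1 / \<rho>) powr p) * (\<integral>\<^sup>+x. ennreal (norm (F (Complex x y)) powr p) \<partial>lborel) + ennreal (M powr p) * ennreal (2 * \<rho>)"
      using \<rho> by (simp add: nn_integral_add nn_integral_cmult)
    also have "\<dots> \<le> ennreal ((1 / \<rho>) powr p) * ennreal C + ennreal (M powr p) * ennreal (2 * \<rho>)"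
      using C y by (intro add_right_mono mult_left_mono) (auto simp: hardy_means_def)
    also have "\<dots> = ennreal ((1 / \<rho>) powr p * C + M powr p * (2 * \<rho>))"
      using C \<rho> by (simp add: hardy_means_def ennreal_mult ennreal_plus)
    finally show "(\<integral>\<^sup>+x. ennreal (norm (Q (Complex x y)) powr p) \<partial>lborel) \<le> ennreal ((1 / \<rho>) powr p * C + M powr p * (2 * \<rho>))" .
  qed
  moreover have "Lp_bound p (\<lambda>t. f t / (of_real t - a)) ((1 / Im a) powr p * D)" using bnd by simp
  ultimately show ?thesis using bd unfolding hardy_pair_def by blast
qed

text \<open>The image of a nonconstant holomorphic function is open.\<close>

lemma real_valued_holomorphic_constant:
  assumes "H holomorphic_on upper" "\<And>w. w \<in> upper \<Longrightarrow> Im (H w) = 0"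
  shows "H constant_on upper"
proof (rule ccontr)
  assume "\<not> H constant_on upper"
  then have op: "open (H ` upper)"
    using assms(1) open_upper convex_connected[OF convex_upper] by (intro open_mapping_thm[of H upper]) auto
  have "H \<i> \<in> H ` upper" by auto
  then obtain e where e: "0 < e" "ball (H \<i>) e \<subseteq> H ` upper" using op open_contains_ball by blast
  have "H \<i> + \<i> * of_real (e / 2) \<in> ball (H \<i>) e" using e by (simp add: dist_norm norm_mult)
  then have "H \<i> + \<i> * of_real (e / 2) \<in> H ` upper" using e(2) by (rule subsetD[rotated])
  then obtain w where w: "H \<i> + \<i> * of_real (e / 2) = H w" "w \<in> upper" by (rule imageE)
  have "H w = H \<i> + \<i> * of_real (e / 2)" "w \<in> upper" using w by simp_all
  then have "Im (H w) = Im (H \<i>) + e / 2" by simp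
  then show False using assms(2)[of w] assms(2)[of \<i>] \<open>w \<in> upper\<close> e by simp
qed

text \<open>By the Poisson representation the extensions are conjugate to each other, so they are constant, and the only
constant with finite \<open>p\<close>-means is 0.\<close>

lemma hardy_conjugate_zero:
  assumes F: "hardy_pair p F f" and G: "hardy_pair p G (\<lambda>t. cnj (f t))" and p: "1 < p"
  shows "AE t in lborel. f t = 0"
proof -
  have eq: "G w = cnj (F w)" if "w \<in> upper" for w
    using that hardy_poisson_representation[OF F p, of w] hardy_poisson_representation[OF G p, of w] by simp
  obtain C where C: "hardy_means p F C" using F by (auto simp: hardy_pair_def)
  have hol: "F holomorphic_on upper" "G holomorphic_on upper" using F G by (auto simp: hardy_pair_def hardy_means_def)
  have "(\<lambda>w. F w + G w) constant_on upper"
    by (rule real_valued_holomorphic_constant) (auto intro!: holomorphic_intros hol simp: eq)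
  moreover have "(\<lambda>w. \<i> * (F w - G w)) constant_on upper"
    by (rule real_valued_holomorphic_constant) (auto intro!: holomorphic_intros hol simp: eq)
  ultimately obtain c d where cd: "\<And>w. w \<in> upper \<Longrightarrow> F w + G w = c" "\<And>w. w \<in> upper \<Longrightarrow> \<i> * (F w - G w) = d"
    unfolding constant_on_def by blast
  have Fc: "F w = F \<i>" if "w \<in> upper" for w
  proof -
    have "F w + G w = F \<i> + G \<i>" "\<i> * (F w - G w) = \<i> * (F \<i> - G \<i>)"
      using cd(1)[OF that] cd(1)[of \<i>] cd(2)[OF that] cd(2)[of \<i>] by auto
    then have "(F w + G w) + (F w - G w) = (F \<i> + G \<i>) + (F \<i> - G \<i>)" by simp
    then show ?thesis by simp
  qed
  have "F \<i> = 0"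
  proof (rule ccontr)
    assume nz: "F \<i> \<noteq> 0"
    have FC: "F (Complex x 1) = F \<i>" for x by (rule Fc) simp
    have "(\<integral>\<^sup>+x. ennreal (norm (F \<i>) powr p) \<partial>(lborel :: real measure)) = (\<integral>\<^sup>+x. ennreal (norm (F (Complex x 1)) powr p) \<partial>lborel)"
      by (simp only: FC)
    also have "\<dots> \<le> ennreal C" using C unfolding hardy_means_def by (elim conjE allE[of _ 1]) simp
    finally have "ennreal (norm (F \<i>) powr p) * emeasure (lborel :: real measure) UNIV \<le> ennreal C" by simp
    then show False using nz by (simp add: ennreal_mult_top top_unique)
  qed
  then have "F w = 0" if "w \<in> upper" for w using Fc[OF that] by simp
  then show ?thesis using F by (intro boundary_of_zero[of F f]) (auto simp: hardy_pair_def)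
qed

lemma blaschke_quotient_norm:
  assumes a: "0 < Im a" and w: "0 < Im w"
  shows "norm ((w - a) / (w - cnj a)) < 1"
proof -
  have "(norm (w - a))\<^sup>2 < (norm (w - cnj a))\<^sup>2"
    unfolding cmod_power2 using a w by (simp add: power2_eq_square algebra_simps)
  then have "norm (w - a) < norm (w - cnj a)" by (rule power2_less_imp_less) simp
  moreover from this have "0 < norm (w - cnj a)" by (metis norm_ge_zero order_le_less_trans)
  ultimately show ?thesis by (simp add: norm_divide)
qed

text \<open>Dividing \<open>F\<close> by the \<open>n\<close>-th power of the Blaschke factor \<open>b\<close> does not change the modulus on the boundary, so by
the Poisson representation all the quotients obey the same bound \<open>c\<close> at \<open>w\<close>; hence
\<open>\<bar>F w\<bar>\<close> is at most \<open>\<bar>b w\<bar>\<^sup>n c\<close> for all \<open>n\<close>.\<close>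

lemma hardy_infinite_zero:
  assumes a: "0 < Im a" and p: "1 < p" and f: "f \<in> borel_measurable borel"
    and H: "\<And>n. \<exists>Q. hardy_pair p Q (\<lambda>t. ((of_real t - cnj a) / (of_real t - a)) ^ n * f t)"
  shows "AE t in lborel. f t = 0"
proof -
  define b where "b = (\<lambda>w. (w - a) / (w - cnj a))"
  have bnz: "w - cnj a \<noteq> 0" if "0 \<le> Im w" for w using that a by (auto simp: complex_eq_iff)
  obtain F where F: "hardy_pair p F f" using H[of 0] by auto
  have fi: "integrable (pois w) (\<lambda>t. norm (f t))" if "0 < Im w" for w
    using F Lp_bound_integrable_pois(1)[of p f _ w] p that by (auto simp: hardy_pair_def)
  have F0: "F w = 0" if w: "w \<in> upper" for w
  proof -
    have w': "0 < Im w" using w by simp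
    define c where "c = (\<integral>t. norm (f t) \<partial>pois w)"
    have le: "norm (F w) \<le> norm (b w) ^ n * c" for n
    proof -
      obtain Q where Q: "hardy_pair p Q (\<lambda>t. ((of_real t - cnj a) / (of_real t - a)) ^ n * f t)" using H by blast
      have un: "norm ((of_real t - cnj a) / (of_real t - a)) = 1" for t
      proof -
        have "norm (of_real t - cnj a) = norm (of_real t - a)"
          by (metis complex_cnj_complex_of_real complex_cnj_diff complex_mod_cnj)
        moreover have "of_real t - a \<noteq> 0" by (rule of_real_minus_upper[OF a])
        ultimately show ?thesis by (simp add: norm_divide)
      qed
      have bt: "b (of_real t) * ((of_real t - cnj a) / (of_real t - a)) = 1" for t
        using of_real_minus_upper[OF a, of t] bnz[of "of_real t"] by (simp add: b_def)
      have "hardy_pair p (\<lambda>w. b w ^ n * Q w) (\<lambda>t. b (of_real t) ^ n * (((of_real t - cnj a) / (of_real t - a)) ^ n * f t))"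
      proof (rule hardy_pair_mult_bounded[OF Q])
        show "(\<lambda>w. b w ^ n) holomorphic_on upper" unfolding b_def using bnz by (intro holomorphic_intros) auto
        show "norm (b w ^ n) \<le> 1" if "w \<in> upper" for w
          using that blaschke_quotient_norm[OF a, of w] by (simp add: norm_power power_le_one b_def)
        show "(\<lambda>t. b (of_real t) ^ n) \<in> borel_measurable borel" unfolding b_def by measurable
        show "boundary_of (\<lambda>w. b w ^ n) (\<lambda>t. b (of_real t) ^ n)"
          using bnz by (intro boundary_of_continuous[of "\<lambda>w. b w ^ n"]) (auto simp: b_def intro!: continuous_intros)
      qed (use p in simp)
      moreover have "b (of_real t) ^ n * (((of_real t - cnj a) / (of_real t - a)) ^ n * f t) = f t" for t
        by (simp only: mult.assoc[symmetric] power_mult_distrib[symmetric] bt power_one mult_1)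
      ultimately have "hardy_pair p (\<lambda>w. b w ^ n * Q w) f" by simp
      then have "F w = b w ^ n * Q w" using w by (intro hardy_pair_unique[OF F _ p]) auto
      moreover have "norm (Q w) \<le> c"
      proof -
        have "norm (Q w) \<le> (\<integral>t. norm (((of_real t - cnj a) / (of_real t - a)) ^ n * f t) \<partial>pois w)"
          unfolding hardy_poisson_representation[OF Q p w'] by (rule integral_norm_bound)
        also have "\<dots> = c" unfolding c_def by (simp only: norm_mult norm_power un power_one mult_1)
        finally show ?thesis .
      qed
      ultimately show ?thesis by (simp add: norm_mult norm_power mult_left_mono)
    qed
    have "norm (b w) < 1" unfolding b_def by (rule blaschke_quotient_norm[OF a w'])
    then have "(\<lambda>n. norm (b w) ^ n * c) \<longlonglongrightarrow> 0 * c" by (intro tendsto_intros LIMSEQ_power_zero) simp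
    then have "norm (F w) \<le> 0 * c" using le by (intro LIMSEQ_le_const[of _ "0 * c"]) auto
    then show ?thesis by simp
  qed
  show ?thesis using F F0 by (intro boundary_of_zero[of F f]) (auto simp: hardy_pair_def)
qed

section \<open>Classes of functions and their representatives\<close>

lemma aefun_cases:
  obtains f where "f \<in> borel_measurable borel" "h = abs_aefun f"
proof -
  have "\<exists>f. f \<in> borel_measurable borel \<and> h = abs_aefun f"
    by (rule aefun.abs_induct[of "\<lambda>h. \<exists>f. f \<in> borel_measurable borel \<and> h = abs_aefun f"]) (auto simp: ae_rel_def)
  then show thesis using that by blast
qed

lemma ae_rel_self: "f \<in> borel_measurable borel \<Longrightarrow> ae_rel f f"
  by (simp add: ae_rel_def)

lemma abs_aefun_eq_iff:
  assumes "f \<in> borel_measurable borel" "g \<in> borel_measurable borel"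
  shows "abs_aefun f = abs_aefun g \<longleftrightarrow> (AE x in lborel. f x = g x)"
  using assms Quotient_rel[OF Quotient_aefun, of f g] ae_rel_self[of f] ae_rel_self[of g]
  by (auto simp: ae_rel_def)

lemma abs_mult:
  assumes "f \<in> borel_measurable borel" "g \<in> borel_measurable borel"
  shows "abs_aefun f * abs_aefun g = abs_aefun (\<lambda>x. f x * g x)"
  using assms by (intro times_aefun.abs_eq ae_rel_self)

lemma abs_diff:
  assumes "f \<in> borel_measurable borel" "g \<in> borel_measurable borel"
  shows "abs_aefun f - abs_aefun g = abs_aefun (\<lambda>x. f x - g x)"
  using assms by (intro minus_aefun.abs_eq ae_rel_self)

lemma abs_scale:
  assumes "f \<in> borel_measurable borel"
  shows "scale_aefun c (abs_aefun f) = abs_aefun (\<lambda>x. c * f x)"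
  using assms by (intro scale_aefun.abs_eq ae_rel_self)

lemma abs_zero: "(0 :: aefun) = abs_aefun (\<lambda>_. 0)"
  by (simp add: zero_aefun_def)

lemma abs_one: "(1 :: aefun) = abs_aefun (\<lambda>_. 1)"
  by (simp add: one_aefun_def)

lemma borel_measurable_cnj [measurable (raw)]:
  "f \<in> borel_measurable M \<Longrightarrow> (\<lambda>x. cnj (f x)) \<in> borel_measurable M"
  by (rule borel_measurable_continuous_on[OF continuous_on_cnj[OF continuous_on_id]])

lift_definition conj_aefun :: "aefun \<Rightarrow> aefun" is "\<lambda>f x. cnj (f x)"
  unfolding ae_rel_def by (auto elim: eventually_mono)

lift_definition recip :: "complex \<Rightarrow> aefun" is "\<lambda>a x. 1 / (complex_of_real x - a)"
  by (simp add: ae_rel_def)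

lemma conj_conj [simp]: "conj_aefun (conj_aefun f) = f"
  by transfer (simp add: ae_rel_def)

lemma conj_mult: "conj_aefun (f * g) = conj_aefun f * conj_aefun g"
  by transfer (simp add: ae_rel_def)

lemma conj_scale: "conj_aefun (scale_aefun c f) = scale_aefun (cnj c) (conj_aefun f)"
  by transfer (simp add: ae_rel_def)

lemma conj_zero [simp]: "conj_aefun 0 = 0"
  by transfer (simp add: ae_rel_def)

lemma conj_one [simp]: "conj_aefun 1 = 1"
  by transfer (simp add: ae_rel_def)

lemma conj_eq_zero_iff [simp]: "conj_aefun f = 0 \<longleftrightarrow> f = 0"
  by (metis conj_conj conj_zero)

lemma conj_lin: "conj_aefun (lin a) = lin (cnj a)"
  by transfer (simp add: ae_rel_def)

lemma conj_recip: "conj_aefun (recip a) = recip (cnj a)"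
  by transfer (simp add: ae_rel_def)

lemma conj_power: "conj_aefun (f ^ n) = conj_aefun f ^ n"
  by (induct n) (auto simp: conj_mult)

lemma lin_mult_recip [simp]: "lin a * recip a = 1"
proof transfer
  fix a
  have "AE x in lborel. x \<noteq> Re a" by (rule AE_lborel_singleton)
  then have "AE x in lborel. (complex_of_real x - a) * (1 / (complex_of_real x - a)) = 1"
    by eventually_elim (auto simp: complex_eq_iff)
  then show "ae_rel (\<lambda>x. (complex_of_real x - a) * (1 / (complex_of_real x - a))) (\<lambda>_. 1)"
    by (simp add: ae_rel_def)
qed

lemma recip_mult_lin [simp]: "recip a * lin a = 1"
  by (simp add: mult.commute)

lemma scale_mult: "scale_aefun c f * g = scale_aefun c (f * g)" "f * scale_aefun c g = scale_aefun c (f * g)"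
  by (transfer, simp add: ae_rel_def mult_ac)+

lemma lin_split: "lin b = lin a + scale_aefun (a - b) 1"
  by transfer (simp add: ae_rel_def)

lemma lin_recip: "lin b * recip a = 1 + scale_aefun (a - b) (recip a)"
  by (subst lin_split[of b a]) (simp add: distrib_right scale_mult)

lemma blaschke_factor_eq: "blaschke_factor w = lin w * recip (cnj w)"
  by transfer (simp add: ae_rel_def)

section \<open>Hardy classes\<close>

lemma hardy_pair_ae_rel: "ae_rel f g \<Longrightarrow> hardy_pair p F f \<longleftrightarrow> hardy_pair p F g"
  using hardy_pair_cong[of p F f g] hardy_pair_cong[of p F g f]
  by (auto simp: ae_rel_def eq_commute)

text \<open>The relation between an element of \<open>H\<^sup>p\<close> and its holomorphic extension, on classes.\<close>

lift_definition extension :: "real \<Rightarrow> (complex \<Rightarrow> complex) \<Rightarrow> aefun \<Rightarrow> bool" is hardy_pair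
  by (rule hardy_pair_ae_rel)

lemma extension_abs: "f \<in> borel_measurable borel \<Longrightarrow> extension p F (abs_aefun f) \<longleftrightarrow> hardy_pair p F f"
  by (intro extension.abs_eq ae_rel_self)

lemma hardy_abs:
  assumes f: "f \<in> borel_measurable borel"
  shows "abs_aefun f \<in> hardy \<sigma> p \<longleftrightarrow> (\<integral>\<^sup>+x. ennreal (norm (f x) powr p) \<partial>lborel) < \<infinity> \<and>
     (\<exists>F\<in>hardy_holomorphic \<sigma> p. AE x in lborel. ((\<lambda>y. F (Complex x (\<sigma> * y))) \<longlongrightarrow> f x) (at_right 0))"
  using f by (simp add: hardy_def Lp_def in_Lp.abs_eq has_boundary_values.abs_eq ae_rel_self)

lemma upper_eq: "half_plane 1 = upper" "half_plane (- 1) = {w. Im w < 0}"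
  by (auto simp: half_plane_def)

lemma hardy_means_iff: "(\<exists>C. hardy_means p F C) \<longleftrightarrow> F \<in> hardy_holomorphic 1 p"
proof
  assume "F \<in> hardy_holomorphic 1 p"
  then obtain C where C: "F holomorphic_on upper"
    "\<And>y. 0 < y \<Longrightarrow> (\<integral>\<^sup>+x. ennreal (norm (F (Complex x y)) powr p) \<partial>lborel) \<le> ennreal C"
    by (auto simp: hardy_holomorphic_def upper_eq)
  have "ennreal C \<le> ennreal (max C 0)" by (intro ennreal_leI) simp
  then have "hardy_means p F (max C 0)" using C by (auto simp: hardy_means_def intro: order_trans)
  then show "\<exists>C. hardy_means p F C" ..
qed (auto simp: hardy_holomorphic_def upper_eq hardy_means_def)

lemma H_plus_iff: "h \<in> H_plus p \<longleftrightarrow> (\<exists>F. extension p F h)"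
proof -
  obtain f where f: "f \<in> borel_measurable borel" "h = abs_aefun f" by (rule aefun_cases)
  have "(\<exists>C. Lp_bound p f C) \<longleftrightarrow> (\<integral>\<^sup>+x. ennreal (norm (f x) powr p) \<partial>lborel) < \<infinity>"
  proof
    assume "\<exists>C. Lp_bound p f C"
    then show "(\<integral>\<^sup>+x. ennreal (norm (f x) powr p) \<partial>lborel) < \<infinity>" by (auto simp: Lp_bound_def order_le_less_trans)
  next
    assume "(\<integral>\<^sup>+x. ennreal (norm (f x) powr p) \<partial>lborel) < \<infinity>"
    then show "\<exists>C. Lp_bound p f C" by (rule Lp_boundI[OF f(1)]) auto
  qed
  then show ?thesis
    using f by (auto simp: hardy_abs extension_abs hardy_pair_def boundary_of_def hardy_means_iff)
qed

lemma hardy_holomorphic_conj: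
  assumes "F \<in> hardy_holomorphic \<sigma> p"
  shows "(\<lambda>w. cnj (F (cnj w))) \<in> hardy_holomorphic (- \<sigma>) p"
proof -
  have "cnj \<circ> F \<circ> cnj holomorphic_on half_plane (- \<sigma>)"
  proof (rule holomorphic_on_compose_cnj_cnj)
    have "cnj ` half_plane (- \<sigma>) = half_plane \<sigma>"
      by (force simp: half_plane_def image_iff intro: exI[of _ "cnj _"])
    then show "F holomorphic_on cnj ` half_plane (- \<sigma>)" using assms by (simp add: hardy_holomorphic_def)
    have "half_plane (- \<sigma>) = (\<lambda>w. - \<sigma> * Im w) -` {0<..}" by (auto simp: half_plane_def)
    moreover have "open \<dots>" by (intro continuous_open_vimage continuous_intros) auto
    ultimately show "open (half_plane (- \<sigma>))" by simp
  qed
  moreover have "cnj (Complex x y) = Complex x (- y)" for x y by (simp add: complex_eq_iff)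
  ultimately show ?thesis using assms by (auto simp: hardy_holomorphic_def comp_def)
qed

lemma hardy_conj:
  assumes "h \<in> hardy \<sigma> p"
  shows "conj_aefun h \<in> hardy (- \<sigma>) p"
proof -
  obtain f where f: "f \<in> borel_measurable borel" "h = abs_aefun f" by (rule aefun_cases)
  have cf: "(\<lambda>x. cnj (f x)) \<in> borel_measurable borel" "conj_aefun h = abs_aefun (\<lambda>x. cnj (f x))"
    using f by (auto simp: conj_aefun.abs_eq ae_rel_self)
  obtain F where F: "F \<in> hardy_holomorphic \<sigma> p" "AE x in lborel. ((\<lambda>y. F (Complex x (\<sigma> * y))) \<longlongrightarrow> f x) (at_right 0)"
    using assms f by (auto simp: hardy_abs)
  have "AE x in lborel. ((\<lambda>y. cnj (F (cnj (Complex x (- \<sigma> * y))))) \<longlongrightarrow> cnj (f x)) (at_right 0)"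
    using F(2)
  proof eventually_elim
    case (elim x)
    have "cnj (Complex x (- \<sigma> * y)) = Complex x (\<sigma> * y)" for y by (simp add: complex_eq_iff)
    then show ?case using tendsto_cnj[OF elim] by simp
  qed
  then show ?thesis
    using assms f cf hardy_holomorphic_conj[OF F(1)] by (auto simp: hardy_abs)
qed

lemma hardy_conj_iff: "conj_aefun h \<in> hardy (- \<sigma>) p \<longleftrightarrow> h \<in> hardy \<sigma> p"
  using hardy_conj[of h \<sigma> p] hardy_conj[of "conj_aefun h" "- \<sigma>" p] by auto

lemma H_minus_iff: "h \<in> H_minus p \<longleftrightarrow> conj_aefun h \<in> H_plus p"
  using hardy_conj_iff[of h "-1" p] by simp

section \<open>Linear structure and evaluation at points of the half-plane\<close>

lemma hardy_pair_diff:
  assumes F: "hardy_pair p F f" and G: "hardy_pair p G g" and p: "0 < p"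
  shows "hardy_pair p (\<lambda>w. F w - G w) (\<lambda>t. f t - g t)"
proof -
  obtain C C' D D' where C: "hardy_means p F C" "hardy_means p G C'" and D: "Lp_bound p f D" "Lp_bound p g D'"
    using F G by (auto simp: hardy_pair_def)
  have "hardy_means p (\<lambda>w. F w - G w) (2 powr p * (C + C'))"
    unfolding hardy_means_def
  proof (intro conjI allI impI)
    show "(\<lambda>w. F w - G w) holomorphic_on upper" using C by (intro holomorphic_intros) (auto simp: hardy_means_def)
    show "0 \<le> 2 powr p * (C + C')" using C by (auto simp: hardy_means_def)
    fix y :: real assume "0 < y"
    then show "(\<integral>\<^sup>+x. ennreal (norm (F (Complex x y) - G (Complex x y)) powr p) \<partial>lborel) \<le> ennreal (2 powr p * (C + C'))"
      using Lp_bound_diff[OF hardy_means_Lp_bound[OF C(1)] hardy_means_Lp_bound[OF C(2)] p] by (simp add: Lp_bound_def)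
  qed
  moreover have "boundary_of (\<lambda>w. F w - G w) (\<lambda>t. f t - g t)"
    using F G unfolding hardy_pair_def boundary_of_def
    by (elim conjE, (elim AE_mp, intro AE_I2 impI)) (intro tendsto_diff; assumption)
  ultimately show ?thesis using Lp_bound_diff[OF D p] unfolding hardy_pair_def by blast
qed

lemma extension_diff:
  assumes "extension p F f" "extension p G g" "0 < p"
  shows "extension p (\<lambda>w. F w - G w) (f - g)"
proof -
  obtain f0 g0 where [simp, measurable]: "f0 \<in> borel_measurable borel" "g0 \<in> borel_measurable borel" and [simp]: "f = abs_aefun f0" "g = abs_aefun g0" using aefun_cases by metis
  show ?thesis using assms by (simp add: extension_abs abs_diff hardy_pair_diff)
qed

lemma extension_mult:
  assumes "extension p F f" "0 < p" "B holomorphic_on upper" "\<And>w. w \<in> upper \<Longrightarrow> norm (B w) \<le> M"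
    "b \<in> borel_measurable borel" "boundary_of B b"
  shows "extension p (\<lambda>w. B w * F w) (abs_aefun b * f)"
proof -
  obtain f0 where [simp, measurable]: "f0 \<in> borel_measurable borel" and [simp]: "f = abs_aefun f0" by (rule aefun_cases)
  have "hardy_pair p (\<lambda>w. B w * F w) (\<lambda>t. b t * f0 t)"
    by (rule hardy_pair_mult_bounded[OF _ assms(2-6)]) (use assms(1) in \<open>simp_all add: extension_abs\<close>)
  then show ?thesis using assms(5) by (simp add: extension_abs abs_mult)
qed

lemma extension_scale:
  assumes "extension p F f" "0 < p"
  shows "extension p (\<lambda>w. c * F w) (scale_aefun c f)"
proof -
  have "extension p (\<lambda>w. c * F w) (abs_aefun (\<lambda>_. c) * f)"
    by (rule extension_mult[OF assms, of "\<lambda>_. c" "norm c"]) (auto simp: boundary_of_def)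
  moreover have "abs_aefun (\<lambda>_. c) = scale_aefun c 1"
    unfolding abs_one by (subst abs_scale) auto
  ultimately show ?thesis by (simp add: scale_mult)
qed

lemma extension_recip:
  assumes "extension p F f" "0 < p" "Im a < 0"
  shows "extension p (\<lambda>w. 1 / (w - a) * F w) (recip a * f)"
proof -
  have nz: "w - a \<noteq> 0" if "0 \<le> Im w" for w using that assms by (auto simp: complex_eq_iff)
  have "extension p (\<lambda>w. 1 / (w - a) * F w) (abs_aefun (\<lambda>t. 1 / (of_real t - a)) * f)"
  proof (rule extension_mult[OF assms(1,2)])
    show "(\<lambda>w. 1 / (w - a)) holomorphic_on upper" using nz by (intro holomorphic_intros) auto
    show "norm (1 / (w - a)) \<le> 1 / (- Im a)" if "w \<in> upper" for w
    proof -
      have "- Im a \<le> norm (w - a)" using abs_Im_le_cmod[of "w - a"] that by simp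
      then have "1 / norm (w - a) \<le> 1 / (- Im a)" using assms(3) by (intro frac_le) auto
      then show ?thesis by (simp only: norm_divide norm_one)
    qed
    show "boundary_of (\<lambda>w. 1 / (w - a)) (\<lambda>t. 1 / (of_real t - a))"
      using nz by (intro boundary_of_continuous[of "\<lambda>w. 1 / (w - a)"]) (auto intro!: continuous_intros)
  qed measurable
  then show ?thesis by (simp add: recip_def)
qed

lemma extension_unique:
  assumes "extension p F f" "extension p G f" "1 < p" "w \<in> upper"
  shows "F w = G w"
proof -
  obtain f0 where [simp, measurable]: "f0 \<in> borel_measurable borel" and [simp]: "f = abs_aefun f0" by (rule aefun_cases)
  show ?thesis using assms by (auto simp: extension_abs intro: hardy_pair_unique)
qed

lemma extension_divide:
  assumes "extension p F f" "1 < p" "0 < Im a" "F a = 0"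
  shows "recip a * f \<in> H_plus p"
proof -
  obtain f0 where [simp, measurable]: "f0 \<in> borel_measurable borel" and [simp]: "f = abs_aefun f0" by (rule aefun_cases)
  have "\<exists>Q. hardy_pair p Q (\<lambda>t. f0 t / (of_real t - a))"
    using assms by (intro hardy_divide[where F = F]) (auto simp: extension_abs)
  moreover have "recip a * f = abs_aefun (\<lambda>t. f0 t / (of_real t - a))"
    by (simp add: recip_def abs_mult)
  ultimately show ?thesis by (auto simp: H_plus_iff extension_abs)
qed

lemma abs_power_mult:
  assumes "b \<in> borel_measurable borel" "f \<in> borel_measurable borel"
  shows "abs_aefun b ^ n * abs_aefun f = abs_aefun (\<lambda>t. b t ^ n * f t)"
  using assms
proof (induct n)
  case (Suc n)
  have "abs_aefun b ^ Suc n * abs_aefun f = abs_aefun b * abs_aefun (\<lambda>t. b t ^ n * f t)"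
    using Suc by (simp add: mult.assoc)
  also have "\<dots> = abs_aefun (\<lambda>t. b t * (b t ^ n * f t))" using Suc(2,3) by (intro abs_mult) auto
  finally show ?case by (simp add: mult.assoc)
qed simp

lemma lin_recip_abs: "lin b * recip a = abs_aefun (\<lambda>t. (of_real t - b) / (of_real t - a))"
  unfolding lin_def recip_def map_fun_def comp_def id_def by (subst abs_mult) auto

lemma H_plus_infinite_zero:
  assumes "0 < Im a" "1 < p" and H: "\<And>n. (lin (cnj a) * recip a) ^ n * f \<in> H_plus p"
  shows "f = 0"
proof -
  obtain f0 where f0m [simp, measurable]: "f0 \<in> borel_measurable borel" and f0 [simp]: "f = abs_aefun f0" by (rule aefun_cases)
  have "AE t in lborel. f0 t = 0"
  proof (rule hardy_infinite_zero[OF assms(1,2) f0m])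
    fix n
    have "(lin (cnj a) * recip a) ^ n * f = abs_aefun (\<lambda>t. ((of_real t - cnj a) / (of_real t - a)) ^ n * f0 t)"
      unfolding lin_recip_abs f0 by (intro abs_power_mult) auto
    then show "\<exists>Q. hardy_pair p Q (\<lambda>t. ((of_real t - cnj a) / (of_real t - a)) ^ n * f0 t)"
      using H[of n] by (simp add: H_plus_iff extension_abs)
  qed
  then show ?thesis by (simp add: abs_zero abs_aefun_eq_iff)
qed

lemma H_plus_inter_H_minus:
  assumes "f \<in> H_plus p" "f \<in> H_minus p" "1 < p"
  shows "f = 0"
proof -
  obtain f0 where f0m [simp, measurable]: "f0 \<in> borel_measurable borel" and f0 [simp]: "f = abs_aefun f0" by (rule aefun_cases)
  have "conj_aefun f = abs_aefun (\<lambda>t. cnj (f0 t))" by (simp add: conj_aefun.abs_eq ae_rel_self)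
  then obtain F G where "hardy_pair p F f0" "hardy_pair p G (\<lambda>t. cnj (f0 t))"
    using assms by (auto simp: H_minus_iff H_plus_iff extension_abs)
  then have "AE t in lborel. f0 t = 0" by (rule hardy_conjugate_zero[OF _ _ assms(3)])
  then show ?thesis by (simp add: abs_zero abs_aefun_eq_iff)
qed

definition val_plus :: "real \<Rightarrow> aefun \<Rightarrow> complex \<Rightarrow> complex" where
  "val_plus p f = (SOME F. extension p F f)"

text \<open>The value at \<open>a\<close> of the holomorphic extension to the half-plane that contains \<open>a\<close>; the lower half-plane is
reduced to the upper one by reflection. The evaluations are linear, compatible with multiplication by \<open>recip b\<close>,
and their zeros can be divided out; this makes the theory of Toeplitz kernels below purely algebraic.\<close>

definition val :: "real \<Rightarrow> aefun \<Rightarrow> complex \<Rightarrow> complex" where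
  "val p f a = (if 0 < Im a then val_plus p f a else cnj (val_plus p (conj_aefun f) (cnj a)))"

lemma val_plus_ext: "f \<in> H_plus p \<Longrightarrow> extension p (val_plus p f) f"
  unfolding val_plus_def H_plus_iff by (rule someI_ex[of "\<lambda>F. extension p F f"])

lemma val_plus_eq:
  assumes "extension p F f" "1 < p" "0 < Im a"
  shows "val_plus p f a = F a"
  using assms by (intro extension_unique[OF val_plus_ext assms(1)]) (auto simp: H_plus_iff)

lemma H_plus_diff: "f \<in> H_plus p \<Longrightarrow> g \<in> H_plus p \<Longrightarrow> 0 < p \<Longrightarrow> f - g \<in> H_plus p"
  using extension_diff unfolding H_plus_iff by blast

lemma H_plus_scale: "f \<in> H_plus p \<Longrightarrow> 0 < p \<Longrightarrow> scale_aefun c f \<in> H_plus p"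
  using extension_scale unfolding H_plus_iff by blast

lemma H_plus_recip: "f \<in> H_plus p \<Longrightarrow> 0 < p \<Longrightarrow> Im a < 0 \<Longrightarrow> recip a * f \<in> H_plus p"
  using extension_recip unfolding H_plus_iff by blast

lemma conj_diff: "conj_aefun (f - g) = conj_aefun f - conj_aefun g"
  by transfer (simp add: ae_rel_def)

lemma hardy_diff:
  assumes "\<sigma> = 1 \<or> \<sigma> = - 1" "1 < p" "f \<in> hardy \<sigma> p" "g \<in> hardy \<sigma> p"
  shows "f - g \<in> hardy \<sigma> p"
  using assms H_plus_diff[of f p g] H_plus_diff[of "conj_aefun f" p "conj_aefun g"]
  by (auto simp: H_minus_iff conj_diff)

lemma hardy_scale:
  assumes "\<sigma> = 1 \<or> \<sigma> = - 1" "1 < p" "f \<in> hardy \<sigma> p"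
  shows "scale_aefun c f \<in> hardy \<sigma> p"
  using assms H_plus_scale[of f p c] H_plus_scale[of "conj_aefun f" p "cnj c"]
  by (auto simp: H_minus_iff conj_scale)

lemma hardy_add:
  assumes "\<sigma> = 1 \<or> \<sigma> = - 1" "1 < p" "f \<in> hardy \<sigma> p" "g \<in> hardy \<sigma> p"
  shows "f + g \<in> hardy \<sigma> p"
proof -
  have "scale_aefun (- 1) g \<in> hardy \<sigma> p" by (rule hardy_scale[OF assms(1,2,4)])
  then have "f - scale_aefun (- 1) g \<in> hardy \<sigma> p" by (rule hardy_diff[OF assms(1-3)])
  then show ?thesis by simp
qed

lemma hardy_recip:
  assumes "\<sigma> = 1 \<or> \<sigma> = - 1" "1 < p" "f \<in> hardy \<sigma> p" "\<sigma> * Im a < 0"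
  shows "recip a * f \<in> hardy \<sigma> p"
  using assms H_plus_recip[of f p a] H_plus_recip[of "conj_aefun f" p "cnj a"]
  by (auto simp: H_minus_iff conj_mult conj_recip)

lemma hardy_lin_recip:
  assumes "\<sigma> = 1 \<or> \<sigma> = - 1" "1 < p" "f \<in> hardy \<sigma> p" "\<sigma> * Im a < 0"
  shows "lin b * recip a * f \<in> hardy \<sigma> p"
  unfolding lin_recip distrib_right scale_mult mult_1
  by (intro hardy_add hardy_scale hardy_recip assms)

lemma val_diff:
  assumes "\<sigma> = 1 \<or> \<sigma> = - 1" "1 < p" "f \<in> hardy \<sigma> p" "g \<in> hardy \<sigma> p" "0 < \<sigma> * Im a"
  shows "val p (f - g) a = val p f a - val p g a"
proof -
  have *: "val_plus p (f - g) a = val_plus p f a - val_plus p g a" if "f \<in> H_plus p" "g \<in> H_plus p" "0 < Im a" for f g a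
    using extension_diff[OF val_plus_ext val_plus_ext] that assms(2) by (intro val_plus_eq) auto
  show ?thesis using assms *[of f g a] *[of "conj_aefun f" "conj_aefun g" "cnj a"]
    by (auto simp: val_def conj_diff H_minus_iff)
qed

lemma val_scale:
  assumes "\<sigma> = 1 \<or> \<sigma> = - 1" "1 < p" "f \<in> hardy \<sigma> p" "0 < \<sigma> * Im a"
  shows "val p (scale_aefun c f) a = c * val p f a"
proof -
  have *: "val_plus p (scale_aefun c f) a = c * val_plus p f a" if "f \<in> H_plus p" "0 < Im a" for f c a
    using extension_scale[OF val_plus_ext] that assms(2) by (intro val_plus_eq) auto
  show ?thesis using assms *[of f a c] *[of "conj_aefun f" "cnj a" "cnj c"]
    by (auto simp: val_def conj_scale H_minus_iff)
qed

lemma val_add: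
  assumes "\<sigma> = 1 \<or> \<sigma> = - 1" "1 < p" "f \<in> hardy \<sigma> p" "g \<in> hardy \<sigma> p" "0 < \<sigma> * Im a"
  shows "val p (f + g) a = val p f a + val p g a"
proof -
  have g: "scale_aefun (- 1) g \<in> hardy \<sigma> p" by (rule hardy_scale[OF assms(1,2,4)])
  show ?thesis using val_diff[OF assms(1-3) g assms(5)] val_scale[OF assms(1,2,4,5), of "-1"] by simp
qed

lemma val_recip:
  assumes "\<sigma> = 1 \<or> \<sigma> = - 1" "1 < p" "f \<in> hardy \<sigma> p" "\<sigma> * Im b < 0" "0 < \<sigma> * Im a"
  shows "val p (recip b * f) a = val p f a / (a - b)"
proof -
  have *: "val_plus p (recip b * f) a = val_plus p f a / (a - b)" if "f \<in> H_plus p" "0 < Im a" "Im b < 0" for f a b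
    using val_plus_eq[OF extension_recip[OF val_plus_ext]] that assms(2) by simp
  show ?thesis using assms *[of f a b] *[of "conj_aefun f" "cnj a" "cnj b"]
    by (auto simp: val_def conj_mult conj_recip H_minus_iff)
qed

lemma val_lin_recip:
  assumes "\<sigma> = 1 \<or> \<sigma> = - 1" "1 < p" "f \<in> hardy \<sigma> p" "\<sigma> * Im b < 0" "0 < \<sigma> * Im a"
  shows "val p (lin c * recip b * f) a = val p f a * (a - c) / (a - b)"
proof -
  have ab: "a - b \<noteq> 0" using assms(1,4,5) by auto
  have rf: "recip b * f \<in> hardy \<sigma> p" by (rule hardy_recip[OF assms(1-4)])
  have "val p (lin c * recip b * f) a = val p f a + (b - c) * (val p f a / (a - b))"
    unfolding lin_recip distrib_right scale_mult mult_1
    using val_add[OF assms(1-3) hardy_scale[OF assms(1,2) rf] assms(5)] val_scale[OF assms(1,2) rf assms(5)]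
      val_recip[OF assms] by simp
  also have "\<dots> = val p f a * (a - c) / (a - b)" using ab by (simp add: field_simps)
  finally show ?thesis .
qed

lemma hardy_divide_zero:
  assumes "\<sigma> = 1 \<or> \<sigma> = - 1" "1 < p" "f \<in> hardy \<sigma> p" "0 < \<sigma> * Im a" "val p f a = 0"
  shows "recip a * f \<in> hardy \<sigma> p"
  using assms extension_divide[OF val_plus_ext, of f p a] extension_divide[OF val_plus_ext, of "conj_aefun f" p "cnj a"]
  by (auto simp: val_def H_minus_iff conj_mult conj_recip)

lemma hardy_all_zeros:
  assumes "\<sigma> = 1 \<or> \<sigma> = - 1" "1 < p" "0 < \<sigma> * Im a"
    and H: "\<And>n. (lin (cnj a) * recip a) ^ n * f \<in> hardy \<sigma> p"
  shows "f = 0"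
  using assms(1)
proof
  assume "\<sigma> = 1" then show ?thesis using assms H_plus_infinite_zero[of a p f] by simp
next
  assume s: "\<sigma> = - 1"
  have "conj_aefun f = 0"
  proof (rule H_plus_infinite_zero[of "cnj a" p])
    show "(lin (cnj (cnj a)) * recip (cnj a)) ^ n * conj_aefun f \<in> H_plus p" for n
      using H[of n] s by (simp add: H_minus_iff conj_mult conj_power conj_lin conj_recip)
  qed (use assms s in auto)
  then show ?thesis by simp
qed

section \<open>Reciprocals of linear functions\<close>

lemma nn_integral_powr_tail:
  assumes "1 < p"
  shows "(\<integral>\<^sup>+t. ennreal (t powr (- p)) * indicator {1..} t \<partial>lborel) = ennreal (1 / (p - 1))"
proof -
  have "(\<integral>\<^sup>+t. ennreal (t powr (- p)) * indicator {1..} t \<partial>lborel) = ennreal (0 - 1 powr (1 - p) / (1 - p))"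
  proof (rule nn_integral_FTC_atLeast[where f = "\<lambda>t. t powr (- p)" and F = "\<lambda>t. t powr (1 - p) / (1 - p)" and a = 1 and T = 0])
    show "DERIV (\<lambda>t. t powr (1 - p) / (1 - p)) t :> t powr (- p)" if "1 \<le> t" for t
      using that assms by (auto intro!: derivative_eq_intros)
    have "((\<lambda>t. t powr (1 - p)) \<longlongrightarrow> 0) at_top"
      using assms by (intro tendsto_neg_powr filterlim_ident) auto
    then have "((\<lambda>t. t powr (1 - p) / (1 - p)) \<longlongrightarrow> 0 / (1 - p)) at_top"
      using assms by (intro tendsto_divide tendsto_const) auto
    then show "((\<lambda>t. t powr (1 - p) / (1 - p)) \<longlongrightarrow> 0) at_top" by simp
  qed auto
  also have "0 - 1 powr (1 - p) / (1 - p) = 1 / (p - 1)" using assms by (simp add: field_simps)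
  finally show ?thesis .
qed

text \<open>The integrand is bounded near \<open>Re a\<close> and at most \<open>\<bar>t\<bar> powr - p\<close> away from it.\<close>

lemma Lp_bound_recip:
  assumes p: "1 < p" and a: "Im a \<noteq> 0"
  obtains C where "Lp_bound p (\<lambda>t. 1 / (of_real t - a)) C"
proof -
  define h where "h = (\<lambda>t. ennreal (t powr (- p)) * indicator {1..} t)"
  have hm [measurable]: "h \<in> borel_measurable borel" unfolding h_def by measurable
  define K where "K = (1 / \<bar>Im a\<bar>) powr p"
  have pw: "ennreal (norm (1 / (of_real (Re a + t) - a)) powr p) \<le> ennreal K * indicator {-1..1} t + (h t + h (- t))" for t
  proof -
    define N where "N = norm (of_real (Re a + t) - a)"
    have N: "\<bar>Im a\<bar> \<le> N" "\<bar>t\<bar> \<le> N"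
      using abs_Im_le_cmod[of "of_real (Re a + t) - a"] abs_Re_le_cmod[of "of_real (Re a + t) - a"] by (auto simp: N_def)
    have eq: "norm (1 / (of_real (Re a + t) - a)) = 1 / N" by (simp add: N_def norm_divide)
    show ?thesis
    proof (cases "t \<in> {-1..1}")
      case True
      have "(1 / N) powr p \<le> K" unfolding K_def using N a p by (intro powr_mono2 frac_le) auto
      then show ?thesis using True eq by (simp add: ennreal_leI add_increasing2)
    next
      case False
      then have t1: "1 < \<bar>t\<bar>" by auto
      have "(1 / N) powr p \<le> (1 / \<bar>t\<bar>) powr p" using N t1 p by (intro powr_mono2 frac_le) auto
      also have "\<dots> = \<bar>t\<bar> powr (- p)" using t1 by (simp add: powr_minus powr_divide inverse_eq_divide)
      finally have "ennreal ((1 / N) powr p) \<le> ennreal (\<bar>t\<bar> powr (- p))" by (rule ennreal_leI)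
      also have "\<dots> \<le> h t + h (- t)"
        using t1 by (cases "0 \<le> t") (auto simp: h_def)
      finally show ?thesis using eq by (simp add: add_increasing)
    qed
  qed
  have "(\<integral>\<^sup>+t. ennreal (norm (1 / (of_real t - a)) powr p) \<partial>lborel) = (\<integral>\<^sup>+t. ennreal (norm (1 / (of_real (Re a + t) - a)) powr p) \<partial>lborel)"
    using nn_integral_real_affine[of "\<lambda>t. ennreal (norm (1 / (of_real t - a)) powr p)" 1 "Re a"] by simp
  also have "\<dots> \<le> (\<integral>\<^sup>+t. ennreal K * indicator {-1..1} t + (h t + h (- t)) \<partial>lborel)"
    by (intro nn_integral_mono pw)
  also have "\<dots> = ennreal K * 2 + ((\<integral>\<^sup>+t. h t \<partial>lborel) + (\<integral>\<^sup>+t. h (- t) \<partial>lborel))"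
    by (simp add: nn_integral_add nn_integral_cmult)
  also have "(\<integral>\<^sup>+t. h (- t) \<partial>lborel) = (\<integral>\<^sup>+t. h t \<partial>lborel)"
    using nn_integral_real_affine[of h "-1" 0] by simp
  also have "(\<integral>\<^sup>+t. h t \<partial>lborel) = ennreal (1 / (p - 1))"
    unfolding h_def by (rule nn_integral_powr_tail[OF p])
  also have "ennreal K * 2 + (ennreal (1 / (p - 1)) + ennreal (1 / (p - 1))) < \<infinity>"
    by (simp add: ennreal_mult_less_top)
  finally have fin: "(\<integral>\<^sup>+t. ennreal (norm (1 / (of_real t - a)) powr p) \<partial>lborel) < \<infinity>" .
  show thesis by (rule Lp_boundI[OF _ fin that]) measurable
qed

lemma recip_H_plus:
  assumes p: "1 < p" and a: "Im a < 0"
  shows "extension p (\<lambda>w. 1 / (w - a)) (recip a)"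
proof -
  have nz: "w - a \<noteq> 0" if "0 \<le> Im w" for w using that a by (auto simp: complex_eq_iff)
  obtain C where C: "Lp_bound p (\<lambda>t. 1 / (of_real t - a)) C" by (rule Lp_bound_recip[OF p, of a]) (use a in auto)
  have "hardy_means p (\<lambda>w. 1 / (w - a)) C"
    unfolding hardy_means_def
  proof (intro conjI allI impI)
    show "(\<lambda>w. 1 / (w - a)) holomorphic_on upper" using nz by (intro holomorphic_intros) auto
    show "0 \<le> C" using C by (simp add: Lp_bound_def)
    fix y :: real assume y: "0 < y"
    have "(\<integral>\<^sup>+x. ennreal (norm (1 / (Complex x y - a)) powr p) \<partial>lborel) \<le> (\<integral>\<^sup>+x. ennreal (norm (1 / (of_real x - a)) powr p) \<partial>lborel)"
    proof (intro nn_integral_mono ennreal_leI powr_mono2)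
      fix x
      have "(norm (of_real x - a))\<^sup>2 \<le> (norm (Complex x y - a))\<^sup>2"
        unfolding cmod_power2 using y a by (simp add: power2_eq_square algebra_simps)
      then have "norm (of_real x - a) \<le> norm (Complex x y - a)" by (rule power2_le_imp_le) simp
      moreover have "0 < norm (of_real x - a)" using nz[of "of_real x"] by simp
      ultimately show "norm (1 / (Complex x y - a)) \<le> norm (1 / (of_real x - a))" by (simp add: norm_divide frac_le)
    qed (use p in auto)
    then show "(\<integral>\<^sup>+x. ennreal (norm (1 / (Complex x y - a)) powr p) \<partial>lborel) \<le> ennreal C"
      using C unfolding Lp_bound_def by (auto intro: order_trans)
  qed
  moreover have "boundary_of (\<lambda>w. 1 / (w - a)) (\<lambda>t. 1 / (of_real t - a))"
    using nz by (intro boundary_of_continuous[of "\<lambda>w. 1 / (w - a)"]) (auto intro!: continuous_intros)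
  ultimately have "hardy_pair p (\<lambda>w. 1 / (w - a)) (\<lambda>t. 1 / (of_real t - a))"
    using C unfolding hardy_pair_def by blast
  then show ?thesis by (simp add: recip_def extension_abs)
qed

lemma recip_mem_hardy:
  assumes "\<sigma> = 1 \<or> \<sigma> = - 1" "1 < p" "\<sigma> * Im a < 0"
  shows "recip a \<in> hardy \<sigma> p"
  using assms recip_H_plus[of p a] recip_H_plus[of p "cnj a"]
  by (auto simp: H_minus_iff H_plus_iff conj_recip)

lemma val_recip_self:
  assumes "\<sigma> = 1 \<or> \<sigma> = - 1" "1 < p" "\<sigma> * Im a < 0" "0 < \<sigma> * Im b"
  shows "val p (recip a) b = 1 / (b - a)"
  using assms val_plus_eq[OF recip_H_plus, of p a b] val_plus_eq[OF recip_H_plus, of p "cnj a" "cnj b"]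
  by (auto simp: val_def conj_recip)

section \<open>Bounded functions\<close>

lemma Linf_abs: "f \<in> borel_measurable borel \<Longrightarrow> abs_aefun f \<in> Linf \<longleftrightarrow> (\<exists>C. AE x in lborel. norm (f x) \<le> C)"
  by (simp add: Linf_def in_Linf.abs_eq ae_rel_self)

lemma Linf_mult:
  assumes "f \<in> Linf" "g \<in> Linf"
  shows "f * g \<in> Linf"
proof -
  obtain f0 g0 where [simp, measurable]: "f0 \<in> borel_measurable borel" "g0 \<in> borel_measurable borel" and [simp]: "f = abs_aefun f0" "g = abs_aefun g0" using aefun_cases by metis
  obtain C D where "AE x in lborel. norm (f0 x) \<le> C" "AE x in lborel. norm (g0 x) \<le> D" using assms by (auto simp: Linf_abs)
  then have "AE x in lborel. norm (f0 x * g0 x) \<le> \<bar>C\<bar> * \<bar>D\<bar>"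
    by eventually_elim (auto simp: norm_mult intro!: mult_mono)
  then show ?thesis by (auto simp: abs_mult Linf_abs)
qed

lemma Linf_blaschke: "blaschke_factor w \<in> Linf"
proof -
  have "norm ((of_real x - w) / (of_real x - cnj w)) \<le> 1" for x
  proof -
    have "norm (of_real x - cnj w) = norm (of_real x - w)"
      by (metis complex_cnj_complex_of_real complex_cnj_diff complex_mod_cnj)
    then show ?thesis by (simp add: norm_divide divide_le_eq_1)
  qed
  then show ?thesis by (auto simp: blaschke_factor_def Linf_abs)
qed

lemma Linf_one: "1 \<in> Linf"
  unfolding abs_one by (subst Linf_abs) auto

lemma Lp_conj_mult_Linf:
  assumes "h \<in> Linf" "f \<in> Lp p" "0 < p"
  shows "h * f \<in> Lp p"
proof -
  obtain f0 g0 where [simp, measurable]: "f0 \<in> borel_measurable borel" "g0 \<in> borel_measurable borel" and [simp]: "f = abs_aefun f0" "h = abs_aefun g0" using aefun_cases by metis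
  obtain D where D: "AE x in lborel. norm (g0 x) \<le> D" using assms by (auto simp: Linf_abs)
  have D': "AE x in lborel. norm (g0 x) \<le> \<bar>D\<bar>" using D by eventually_elim auto
  have "(\<integral>\<^sup>+x. ennreal (norm (f0 x) powr p) \<partial>lborel) < \<infinity>"
    using assms(2) by (simp add: Lp_def in_Lp.abs_eq ae_rel_self)
  then obtain C where C: "Lp_bound p f0 C" by (rule Lp_boundI[rotated]) auto
  have "Lp_bound p (\<lambda>t. g0 t * f0 t) (\<bar>D\<bar> powr p * C)"
    by (rule Lp_bound_mult[OF C _ D' assms(3)]) auto
  then have "(\<integral>\<^sup>+x. ennreal (norm (g0 x * f0 x) powr p) \<partial>lborel) < \<infinity>"
    by (auto simp: Lp_bound_def order_le_less_trans)
  then show ?thesis by (simp add: abs_mult Lp_def in_Lp.abs_eq ae_rel_self)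
qed

lemma Lp_conj: "f \<in> Lp p \<Longrightarrow> conj_aefun f \<in> Lp p"
  unfolding Lp_def mem_Collect_eq by transfer simp

text \<open>The symbol \<open>cnj f / f\<close>; at the zeros of \<open>f\<close> both sides vanish whatever its value.\<close>

lemma unimodular_conjugation: "\<exists>h\<in>Linf. h * f = conj_aefun f"
proof -
  obtain f0 where [simp, measurable]: "f0 \<in> borel_measurable borel" and [simp]: "f = abs_aefun f0" by (rule aefun_cases)
  define h where "h = (\<lambda>x. cnj (f0 x) / f0 x)"
  have hm [simp, measurable]: "h \<in> borel_measurable borel" unfolding h_def by measurable
  have "norm (h x) \<le> 1" for x by (simp add: h_def norm_divide)
  then have "abs_aefun h \<in> Linf" by (auto simp: Linf_abs)
  moreover have "abs_aefun h * f = conj_aefun f"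
  proof -
    have "(\<lambda>x. h x * f0 x) = (\<lambda>x. cnj (f0 x))" by (auto simp: h_def)
    then show ?thesis by (simp add: abs_mult conj_aefun.abs_eq ae_rel_self)
  qed
  ultimately show ?thesis by blast
qed

section \<open>Boundary uniqueness, inner and outer factors\<close>

text \<open>A nonzero Hardy function is nonzero almost everywhere on the line.\<close>

lemma hardy_cancel:
  assumes f: "f \<in> H_plus p" "f \<noteq> 0" and p: "1 < p" and g: "g * f = 0"
  shows "g = 0"
proof -
  obtain f0 g0 where [simp, measurable]: "f0 \<in> borel_measurable borel" "g0 \<in> borel_measurable borel" and [simp]: "f = abs_aefun f0" "g = abs_aefun g0" using aefun_cases by metis
  obtain F where F: "hardy_pair p F f0" using f by (auto simp: H_plus_iff extension_abs)
  have "\<not> (\<forall>w\<in>upper. F w = 0)"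
  proof
    assume "\<forall>w\<in>upper. F w = 0"
    then have "AE t in lborel. f0 t = 0" using F boundary_of_zero[of F f0] by (auto simp: hardy_pair_def)
    then show False using f(2) by (simp add: abs_zero abs_aefun_eq_iff)
  qed
  then obtain w0 where "w0 \<in> upper" "F w0 \<noteq> 0" by blast
  then have nz: "AE t in lborel. f0 t \<noteq> 0" by (rule hardy_jensen(1)[OF F p])
  have "AE t in lborel. g0 t * f0 t = 0" using g by (simp add: abs_mult abs_zero abs_aefun_eq_iff)
  then have "AE t in lborel. g0 t = 0" using nz by eventually_elim auto
  then show ?thesis by (simp add: abs_zero abs_aefun_eq_iff)
qed

text \<open>The inner-outer factorisation in the algebraic form in which it is used: \<open>\<iota>\<close> is a unimodular multiplier, and
\<open>u\<close> can be cancelled from products of Hardy functions.\<close>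

lemma inner_outer:
  assumes v: "v \<in> H_plus p" "v \<noteq> 0" and p: "1 < p"
  obtains \<iota> u where "v = \<iota> * u" "\<iota> * conj_aefun \<iota> = 1" "u \<in> H_plus p" "\<And>f. f \<in> H_plus p \<Longrightarrow> \<iota> * f \<in> H_plus p"
    "\<And>a b q. a \<in> H_plus p \<Longrightarrow> b \<in> H_plus p \<Longrightarrow> q \<in> Lp p \<Longrightarrow> q * u = a * b \<Longrightarrow> q \<in> H_plus p"
proof -
  note thesis_rule = that
  obtain v0 where [simp, measurable]: "v0 \<in> borel_measurable borel" and [simp]: "v = abs_aefun v0" by (rule aefun_cases)
  obtain V where V: "hardy_pair p V v0" using v by (auto simp: H_plus_iff extension_abs)
  have "\<not> (\<forall>w\<in>upper. V w = 0)"
  proof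
    assume "\<forall>w\<in>upper. V w = 0"
    then have "AE t in lborel. v0 t = 0" using V boundary_of_zero[of V v0] by (auto simp: hardy_pair_def)
    then show False using v(2) by (simp add: abs_zero abs_aefun_eq_iff)
  qed
  then obtain w0 where w0: "w0 \<in> upper" "V w0 \<noteq> 0" by blast
  obtain I i0 U u0 where I: "I holomorphic_on upper" "\<And>w. w \<in> upper \<Longrightarrow> norm (I w) \<le> 1" "i0 \<in> borel_measurable borel"
    "boundary_of I i0" "AE t in lborel. norm (i0 t) = 1" and U: "hardy_pair p U u0" "outer_pair U u0"
    and vu: "AE t in lborel. v0 t = i0 t * u0 t"
    by (rule inner_outer_factorisation[OF V p w0]) blast
  have [simp, measurable]: "i0 \<in> borel_measurable borel" "u0 \<in> borel_measurable borel" using I U by (auto simp: hardy_pair_def Lp_bound_def)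
  show thesis
  proof (rule thesis_rule[of "abs_aefun i0" "abs_aefun u0"])
    show "v = abs_aefun i0 * abs_aefun u0" using vu by (simp add: abs_mult abs_aefun_eq_iff)
    have "AE t in lborel. i0 t * cnj (i0 t) = 1"
      using I(5) by eventually_elim (simp add: complex_norm_square[symmetric])
    then show "abs_aefun i0 * conj_aefun (abs_aefun i0) = 1"
      by (simp add: conj_aefun.abs_eq ae_rel_self abs_mult abs_one abs_aefun_eq_iff)
    show "abs_aefun u0 \<in> H_plus p" using U by (auto simp: H_plus_iff extension_abs)
    show "abs_aefun i0 * f \<in> H_plus p" if f: "f \<in> H_plus p" for f
    proof -
      obtain F where "extension p F f" using f by (auto simp: H_plus_iff)
      then have "extension p (\<lambda>w. I w * F w) (abs_aefun i0 * f)"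
        using p I by (intro extension_mult[of p F f I 1 i0]) auto
      then show ?thesis by (auto simp: H_plus_iff)
    qed
    fix a b q assume H: "a \<in> H_plus p" "b \<in> H_plus p" "q \<in> Lp p" "q * abs_aefun u0 = a * b"
    obtain a0 b0 q0 where [simp, measurable]: "a0 \<in> borel_measurable borel" "b0 \<in> borel_measurable borel" "q0 \<in> borel_measurable borel" and [simp]: "a = abs_aefun a0" "b = abs_aefun b0" "q = abs_aefun q0" using aefun_cases by metis
    obtain A B where AB: "hardy_pair p A a0" "hardy_pair p B b0" using H by (auto simp: H_plus_iff extension_abs)
    have "(\<integral>\<^sup>+x. ennreal (norm (q0 x) powr p) \<partial>lborel) < \<infinity>"
      using H(3) by (simp add: Lp_def in_Lp.abs_eq ae_rel_self)
    then obtain D where D: "Lp_bound p q0 D" by (rule Lp_boundI[rotated]) auto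
    have "AE t in lborel. q0 t * u0 t = a0 t * b0 t" using H(4) by (simp add: abs_mult abs_aefun_eq_iff)
    then have "\<exists>Q. hardy_pair p Q q0" by (rule outer_quotient[OF AB U p D])
    then show "q \<in> H_plus p" by (auto simp: H_plus_iff extension_abs)
  qed
qed

section \<open>Blaschke products, model spaces and Toeplitz kernels\<close>

lemma blaschke_conj_cancel: "blaschke_factor w * (lin (cnj w) * recip w) = 1"
proof -
  have "blaschke_factor w * (lin (cnj w) * recip w) = (lin w * recip w) * (lin (cnj w) * recip (cnj w))"
    by (simp only: blaschke_factor_eq mult_ac)
  then show ?thesis by simp
qed

text \<open>Finite Blaschke products are treated as lists of zeros, repeated according to multiplicity, and proofs
proceed by induction on the list.\<close>

definition blaschke :: "complex list \<Rightarrow> aefun" where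
  "blaschke ws = prod_list (map blaschke_factor ws)"

definition blaschke_inv :: "complex list \<Rightarrow> aefun" where
  "blaschke_inv ws = prod_list (map (\<lambda>w. lin (cnj w) * recip w) ws)"

lemma blaschke_simps [simp]:
  "blaschke [] = 1" "blaschke (w # ws) = blaschke_factor w * blaschke ws"
  "blaschke_inv [] = 1" "blaschke_inv (w # ws) = lin (cnj w) * recip w * blaschke_inv ws"
  by (simp_all add: blaschke_def blaschke_inv_def)

lemma blaschke_cancel: "blaschke ws * blaschke_inv ws = 1"
proof (induct ws)
  case (Cons w ws)
  have "blaschke (w # ws) * blaschke_inv (w # ws) =
      (blaschke_factor w * (lin (cnj w) * recip w)) * (blaschke ws * blaschke_inv ws)"
    by (simp only: blaschke_simps mult_ac)
  then show ?case using Cons by (simp add: blaschke_conj_cancel)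
qed simp

lemma mem_model_space: "k \<in> model_space p (blaschke ws) \<longleftrightarrow> k \<in> H_plus p \<and> blaschke_inv ws * k \<in> H_minus p"
proof -
  have "k \<in> blaschke ws *o H_minus p \<longleftrightarrow> blaschke_inv ws * k \<in> H_minus p"
  proof
    assume "k \<in> blaschke ws *o H_minus p"
    then obtain h where h: "h \<in> H_minus p" "k = blaschke ws * h" by (auto simp: elt_set_times_def)
    have "blaschke_inv ws * k = (blaschke ws * blaschke_inv ws) * h" by (simp only: h mult_ac)
    then show "blaschke_inv ws * k \<in> H_minus p" using h by (simp add: blaschke_cancel)
  next
    assume h: "blaschke_inv ws * k \<in> H_minus p"
    have "k = (blaschke ws * blaschke_inv ws) * k" by (simp add: blaschke_cancel)
    then have "k = blaschke ws * (blaschke_inv ws * k)" by (simp only: mult.assoc)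
    then show "k \<in> blaschke ws *o H_minus p" using h unfolding elt_set_times_def by blast
  qed
  then show ?thesis by (simp add: model_space_def)
qed

lemma mem_kernel: "f \<in> toeplitz_kernel p g \<longleftrightarrow> f \<in> H_plus p \<and> g * f \<in> H_minus p"
  by (simp add: toeplitz_kernel_eq)

lemma Linf_blaschke_list: "blaschke ws \<in> Linf"
  by (induct ws) (auto intro: Linf_mult Linf_blaschke Linf_one)

section \<open>Bounding dimensions\<close>

text \<open>A basis of a set that lies in a finitely generated space is finite, so the two conditions in the definition
combine into one about spanning sets.\<close>

lemma dim_at_most_iff: "dim_at_most V m \<longleftrightarrow> (\<exists>S. finite S \<and> card S \<le> m \<and> V \<subseteq> aefun.span S)"
proof
  assume V: "dim_at_most V m"
  then obtain S where S: "finite S" "V \<subseteq> aefun.span S" by (auto simp: dim_at_most_def)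
  obtain b where b: "b \<subseteq> V" "aefun.independent b" "V \<subseteq> aefun.span b" "card b = aefun.dim V"
    by (rule aefun.basis_exists)
  have "finite b" using aefun.independent_span_bound[OF S(1) b(2)] b(1) S(2) by blast
  then show "\<exists>S. finite S \<and> card S \<le> m \<and> V \<subseteq> aefun.span S" using b V by (auto simp: dim_at_most_def)
next
  assume "\<exists>S. finite S \<and> card S \<le> m \<and> V \<subseteq> aefun.span S"
  then obtain S where S: "finite S" "card S \<le> m" "V \<subseteq> aefun.span S" by blast
  then have "aefun.dim V \<le> m" using aefun.dim_le_card[of V S] by simp
  then show "dim_at_most V m" using S by (auto simp: dim_at_most_def)
qed

lemma dim_at_most_zero: "dim_at_most V 0 \<longleftrightarrow> V \<subseteq> {0}"
proof
  assume "dim_at_most V 0"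
  then obtain S where "finite S" "card S \<le> 0" "V \<subseteq> aefun.span S" unfolding dim_at_most_iff by blast
  then show "V \<subseteq> {0}" by simp
next
  assume "V \<subseteq> {0}"
  then show "dim_at_most V 0" unfolding dim_at_most_iff by (intro exI[of _ "{}"]) simp
qed

lemma dim_at_most_proper_subspace:
  assumes W: "aefun.subspace W" and WV: "W \<subseteq> V" and e: "e \<in> V" "e \<notin> W" and V: "dim_at_most V (Suc m)"
  shows "dim_at_most W m"
proof -
  obtain S where S: "finite S" "card S \<le> Suc m" "V \<subseteq> aefun.span S" using V unfolding dim_at_most_iff by blast
  obtain b where b: "b \<subseteq> W" "aefun.independent b" "W \<subseteq> aefun.span b" by (rule aefun.basis_exists)
  have "aefun.span b \<subseteq> W" using b(1) W by (rule aefun.span_minimal)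
  then have e': "e \<notin> aefun.span b" using e by blast
  have ind: "aefun.independent (insert e b)" by (rule aefun.independent_insertI[OF e' b(2)])
  have "insert e b \<subseteq> aefun.span S" using e b(1) WV S(3) by blast
  then have fin: "finite (insert e b)" "card (insert e b) \<le> card S"
    using aefun.independent_span_bound[OF S(1) ind] by auto
  have "e \<notin> b" using e' aefun.span_base by blast
  then have "card b \<le> m" using fin S(2) by simp
  then show ?thesis using fin b(3) unfolding dim_at_most_iff by auto
qed

lemma dim_at_most_extend:
  assumes W: "dim_at_most W m" and V: "\<And>f. f \<in> V \<Longrightarrow> \<exists>c. f - scale_aefun c e \<in> W"
  shows "dim_at_most V (Suc m)"
proof -
  obtain S where S: "finite S" "card S \<le> m" "W \<subseteq> aefun.span S" using W unfolding dim_at_most_iff by blast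
  have "V \<subseteq> aefun.span (insert e S)"
  proof
    fix f assume "f \<in> V"
    then obtain c where "f - scale_aefun c e \<in> aefun.span S" using V S(3) by blast
    then show "f \<in> aefun.span (insert e S)" unfolding aefun.span_insert by blast
  qed
  moreover have "card (insert e S) \<le> Suc m" using S card_insert_le_m1[of "Suc m" S e] by simp
  ultimately show ?thesis using S(1) unfolding dim_at_most_iff by (intro exI[of _ "insert e S"]) simp
qed

lemma dim_at_most_mult:
  assumes W: "dim_at_most W m" and V: "\<And>f. f \<in> V \<Longrightarrow> \<exists>w\<in>W. f = c * w"
  shows "dim_at_most V m"
proof -
  obtain S where S: "finite S" "card S \<le> m" "W \<subseteq> aefun.span S" using W unfolding dim_at_most_iff by blast
  have "c * x \<in> aefun.span ((*) c ` S)" if "x \<in> aefun.span S" for x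
    using that
  proof (induct rule: aefun.span_induct_alt)
    case base show ?case by (simp add: aefun.span_zero)
  next
    case (step k x y)
    have "scale_aefun k (c * x) \<in> aefun.span ((*) c ` S)"
      using step(1) by (intro aefun.span_scale aefun.span_base) auto
    then show ?case using step(2) by (simp add: distrib_left scale_mult aefun.span_add)
  qed
  then have "V \<subseteq> aefun.span ((*) c ` S)" using V S(3) by blast
  moreover have "card ((*) c ` S) \<le> m" using card_image_le[OF S(1), of "(*) c"] S(2) by linarith
  ultimately show ?thesis using S(1) unfolding dim_at_most_iff by (intro exI[of _ "(*) c ` S"]) simp
qed

section \<open>Multiplication by Blaschke factors\<close>

context
  fixes p :: real
  assumes p: "1 < p"
begin

lemmas H_add = hardy_add[OF _ p] and H_diff = hardy_diff[OF _ p] and H_scale = hardy_scale[OF _ p]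
  and H_recip = hardy_recip[OF _ p] and H_lin_recip = hardy_lin_recip[OF _ p]

lemma H_plus_blaschke_factor: "f \<in> H_plus p \<Longrightarrow> 0 < Im w \<Longrightarrow> blaschke_factor w * f \<in> H_plus p"
  unfolding blaschke_factor_eq by (rule H_lin_recip) auto

lemma H_minus_blaschke_inv_factor: "f \<in> H_minus p \<Longrightarrow> 0 < Im w \<Longrightarrow> lin (cnj w) * recip w * f \<in> H_minus p"
  by (rule H_lin_recip) auto

lemma H_plus_blaschke: "f \<in> H_plus p \<Longrightarrow> set ws \<subseteq> upper \<Longrightarrow> blaschke ws * f \<in> H_plus p"
  by (induct ws) (auto simp: mult.assoc intro: H_plus_blaschke_factor)

lemma H_minus_blaschke_inv:
  "f \<in> H_minus p \<Longrightarrow> set ws \<subseteq> upper \<Longrightarrow> blaschke_inv ws * f \<in> H_minus p"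
proof (induct ws)
  case (Cons w ws)
  then have "lin (cnj w) * recip w * (blaschke_inv ws * f) \<in> H_minus p"
    by (intro H_minus_blaschke_inv_factor) auto
  then show ?case by (simp add: mult_ac)
qed simp

lemma kernel_subspace: "aefun.subspace (toeplitz_kernel p g)"
  unfolding aefun.subspace_def
  by (auto simp: mem_kernel distrib_left scale_mult intro!: H_add H_scale zero_mem_hardy)

lemma kernel_blaschke_subset:
  assumes "set ws \<subseteq> upper"
  shows "toeplitz_kernel p (blaschke ws * g) \<subseteq> toeplitz_kernel p g"
proof
  fix f assume f: "f \<in> toeplitz_kernel p (blaschke ws * g)"
  have "blaschke_inv ws * (blaschke ws * g * f) \<in> H_minus p"
    using f assms by (intro H_minus_blaschke_inv) (auto simp: mem_kernel)
  moreover have "blaschke_inv ws * (blaschke ws * g * f) = (blaschke ws * blaschke_inv ws) * (g * f)"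
    by (simp only: mult_ac)
  ultimately show "f \<in> toeplitz_kernel p g" using f by (simp add: mem_kernel blaschke_cancel)
qed

text \<open>An additional Blaschke factor in the symbol has its pole at \<open>cnj w\<close>, which a zero of \<open>g f\<close> must
compensate.\<close>

lemma kernel_blaschke_factor_iff:
  assumes w: "0 < Im w" and f: "f \<in> toeplitz_kernel p g"
  shows "f \<in> toeplitz_kernel p (blaschke_factor w * g) \<longleftrightarrow> val p (g * f) (cnj w) = 0"
proof
  assume "f \<in> toeplitz_kernel p (blaschke_factor w * g)"
  then have h: "blaschke_factor w * g * f \<in> H_minus p" by (simp add: mem_kernel)
  have eq: "lin (cnj w) * recip w * (blaschke_factor w * g * f) = g * f"
  proof -
    have "lin (cnj w) * recip w * (blaschke_factor w * g * f) = blaschke_factor w * (lin (cnj w) * recip w) * (g * f)"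
      by (simp only: mult_ac)
    then show ?thesis by (simp add: blaschke_conj_cancel)
  qed
  have "val p (lin (cnj w) * recip w * (blaschke_factor w * g * f)) (cnj w) = val p (blaschke_factor w * g * f) (cnj w) * (cnj w - cnj w) / (cnj w - w)"
    by (rule val_lin_recip[OF _ p h]) (use w in auto)
  then show "val p (g * f) (cnj w) = 0" unfolding eq by simp
next
  assume "val p (g * f) (cnj w) = 0"
  then have d: "recip (cnj w) * (g * f) \<in> H_minus p"
    using f w by (intro hardy_divide_zero[OF _ p]) (auto simp: mem_kernel)
  have gf: "g * f \<in> H_minus p" using f by (simp add: mem_kernel)
  have "lin w * recip (cnj w) * (g * f) = g * f + scale_aefun (cnj w - w) (recip (cnj w) * (g * f))"
    by (simp add: lin_recip distrib_right scale_mult)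
  moreover have "\<dots> \<in> H_minus p" by (intro H_add H_scale d gf) auto
  ultimately show "f \<in> toeplitz_kernel p (blaschke_factor w * g)"
    using f by (simp add: mem_kernel blaschke_factor_eq mult_ac)
qed

section \<open>Dimensions of Toeplitz kernels\<close>

text \<open>A zero at \<open>w\<close> can be divided out within the kernel, because the reciprocal Blaschke factor acts on
\<open>H\<^sup>-\<close>. If all elements vanished at \<open>w\<close>, this could be repeated for ever.\<close>

lemma exists_nonvanishing_in_kernel:
  assumes w: "0 < Im w" and f: "f \<in> toeplitz_kernel p g" "f \<noteq> 0"
  shows "\<exists>e\<in>toeplitz_kernel p g. val p e w \<noteq> 0"
proof (rule ccontr)
  assume "\<not> ?thesis"
  then have zero: "val p e w = 0" if "e \<in> toeplitz_kernel p g" for e using that by blast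
  have "(lin (cnj w) * recip w) ^ n * f \<in> toeplitz_kernel p g" for n
  proof (induct n)
    case (Suc n)
    define h where "h = (lin (cnj w) * recip w) ^ n * f"
    have h: "h \<in> H_plus p" "g * h \<in> H_minus p" "val p h w = 0" using Suc zero by (auto simp: h_def mem_kernel)
    have "recip w * h \<in> H_plus p" using h w by (intro hardy_divide_zero[OF _ p]) auto
    then have "h + scale_aefun (w - cnj w) (recip w * h) \<in> H_plus p" by (intro H_add H_scale h) auto
    then have 1: "lin (cnj w) * recip w * h \<in> H_plus p" by (simp add: lin_recip distrib_right scale_mult)
    have "lin (cnj w) * recip w * (g * h) \<in> H_minus p" by (rule H_minus_blaschke_inv_factor[OF h(2) w])
    then show ?case using 1 by (simp add: mem_kernel h_def mult_ac)
  qed (use f in simp)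
  then have "f = 0" using w by (intro hardy_all_zeros[of 1 p w f] p) (auto simp: mem_kernel)
  then show False using f by simp
qed

text \<open>Multiplication by the Blaschke factor embeds the smaller kernel into the elements of the larger one that
vanish at \<open>w\<close>, and these form a proper subspace.\<close>

lemma dim_kernel_step_down:
  assumes w: "0 < Im w" and ne: "toeplitz_kernel p (blaschke_factor w * g) \<noteq> {0}"
    and dim: "dim_at_most (toeplitz_kernel p g) (Suc m)"
  shows "dim_at_most (toeplitz_kernel p (blaschke_factor w * g)) m"
proof -
  let ?N = "toeplitz_kernel p (blaschke_factor w * g)"
  have sub: "?N \<subseteq> toeplitz_kernel p g" using kernel_blaschke_subset[of "[w]" g] w by simp
  have "0 \<in> ?N" by (rule aefun.subspace_0[OF kernel_subspace])
  then obtain f where f: "f \<in> ?N" "f \<noteq> 0" using ne by blast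
  obtain e where e: "e \<in> toeplitz_kernel p g" "val p e w \<noteq> 0"
    using exists_nonvanishing_in_kernel[OF w, of f g] f sub by blast
  define W where "W = {f \<in> toeplitz_kernel p g. val p f w = 0}"
  have Wsub: "aefun.subspace W"
  proof -
    have "val p 0 w = 0" using val_scale[of 1 p 0 w 0] p w zero_mem_hardy by simp
    then show ?thesis
      using kernel_subspace[of g] w p val_add[of 1 p] val_scale[of 1 p]
      unfolding W_def aefun.subspace_def by (auto simp: mem_kernel)
  qed
  have "dim_at_most W m"
    by (rule dim_at_most_proper_subspace[OF Wsub _ e(1) _ dim]) (use e in \<open>auto simp: W_def\<close>)
  then show ?thesis
  proof (rule dim_at_most_mult[where c = "lin (cnj w) * recip w"])
    fix f assume f: "f \<in> ?N"
    then have h: "f \<in> H_plus p" "blaschke_factor w * g * f \<in> H_minus p" by (auto simp: mem_kernel)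
    have rf: "blaschke_factor w * f \<in> H_plus p" by (rule H_plus_blaschke_factor[OF h(1) w])
    have "val p (blaschke_factor w * f) w = val p f w * (w - w) / (w - cnj w)"
      unfolding blaschke_factor_eq by (rule val_lin_recip[OF _ p h(1)]) (use w in auto)
    then have "blaschke_factor w * f \<in> W" using rf h by (simp add: W_def mem_kernel mult_ac)
    moreover have "lin (cnj w) * recip w * (blaschke_factor w * f) = blaschke_factor w * (lin (cnj w) * recip w) * f"
      by (simp only: mult_ac)
    then have "f = lin (cnj w) * recip w * (blaschke_factor w * f)" by (simp add: blaschke_conj_cancel)
    ultimately show "\<exists>x\<in>W. f = lin (cnj w) * recip w * x" by blast
  qed
qed

text \<open>The smaller kernel is the null space of a linear functional on the larger one.\<close>

lemma dim_kernel_step_up: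
  assumes w: "0 < Im w" and dim: "dim_at_most (toeplitz_kernel p (blaschke_factor w * g)) m"
  shows "dim_at_most (toeplitz_kernel p g) (Suc m)"
proof (cases "\<exists>e\<in>toeplitz_kernel p g. val p (g * e) (cnj w) \<noteq> 0")
  case True
  then obtain e where e: "e \<in> toeplitz_kernel p g" "val p (g * e) (cnj w) \<noteq> 0" by blast
  show ?thesis
  proof (rule dim_at_most_extend[OF dim])
    fix f assume f: "f \<in> toeplitz_kernel p g"
    define c where "c = val p (g * f) (cnj w) / val p (g * e) (cnj w)"
    have d: "f - scale_aefun c e \<in> toeplitz_kernel p g"
      using f e kernel_subspace by (intro aefun.subspace_diff aefun.subspace_scale) auto
    have ge: "g * e \<in> H_minus p" "g * f \<in> H_minus p" using e f by (auto simp: mem_kernel)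
    have "val p (g * (f - scale_aefun c e)) (cnj w) = val p (g * f) (cnj w) - c * val p (g * e) (cnj w)"
      unfolding right_diff_distrib scale_mult
      using val_diff[of "-1" p "g * f" "scale_aefun c (g * e)" "cnj w"] val_scale[of "-1" p "g * e" "cnj w" c]
        H_scale[of "-1" "g * e" c] ge w p by simp
    then have "val p (g * (f - scale_aefun c e)) (cnj w) = 0" using e by (simp add: c_def)
    then show "\<exists>c. f - scale_aefun c e \<in> toeplitz_kernel p (blaschke_factor w * g)"
      using kernel_blaschke_factor_iff[OF w d] by blast
  qed
next
  case False
  then have "toeplitz_kernel p g \<subseteq> toeplitz_kernel p (blaschke_factor w * g)"
    using kernel_blaschke_factor_iff[OF w] by blast
  then show ?thesis
    by (intro dim_at_most_extend[OF dim, of _ 0]) auto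
qed

lemma dim_kernel_blaschke_up:
  assumes "set ws \<subseteq> upper" "dim_at_most (toeplitz_kernel p (blaschke ws * g)) m"
  shows "dim_at_most (toeplitz_kernel p g) (m + length ws)"
  using assms
proof (induct ws arbitrary: g)
  case (Cons w ws)
  have eq: "blaschke (w # ws) * g = blaschke ws * (blaschke_factor w * g)" by (simp add: mult_ac)
  have "dim_at_most (toeplitz_kernel p (blaschke_factor w * g)) (m + length ws)"
    using Cons(2,3) unfolding eq by (intro Cons(1)) auto
  then show ?case using dim_kernel_step_up[of w g "m + length ws"] Cons(2) by simp
qed simp

lemma dim_kernel_blaschke_down:
  assumes "set ws \<subseteq> upper" "toeplitz_kernel p (blaschke ws * g) \<noteq> {0}" "dim_at_most (toeplitz_kernel p g) (m + length ws)"
  shows "dim_at_most (toeplitz_kernel p (blaschke ws * g)) m"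
  using assms
proof (induct ws arbitrary: g)
  case (Cons w ws)
  have eq: "blaschke (w # ws) * g = blaschke ws * (blaschke_factor w * g)" by (simp add: mult_ac)
  have "toeplitz_kernel p (blaschke ws * (blaschke_factor w * g)) \<subseteq> toeplitz_kernel p (blaschke_factor w * g)"
    using Cons(2) by (intro kernel_blaschke_subset) auto
  moreover have "0 \<in> toeplitz_kernel p (blaschke (w # ws) * g)" by (rule aefun.subspace_0[OF kernel_subspace])
  ultimately have "toeplitz_kernel p (blaschke_factor w * g) \<noteq> {0}" using Cons(3) unfolding eq by blast
  then have "dim_at_most (toeplitz_kernel p (blaschke_factor w * g)) (m + length ws)"
    using Cons(2,4) by (intro dim_kernel_step_down) auto
  then show ?case unfolding eq using Cons(2) Cons(3)[unfolded eq] by (intro Cons(1)) auto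
qed simp

section \<open>Maximal functions\<close>

text \<open>With \<open>cnj (G f0) = \<iota> u\<close> the choice \<open>\<phi> = \<iota> f0\<close> moves the inner factor from \<open>G f0\<close> into \<open>\<phi>\<close>. Then \<open>G \<phi>\<close> is
the conjugate of an outer function, which can be cancelled.\<close>

theorem maximal_function_exists:
  assumes G: "G \<in> Linf" "G \<noteq> 0" and ne: "toeplitz_kernel p G \<noteq> {0}"
  shows "\<exists>\<phi>. maximal_function p \<phi> (toeplitz_kernel p G)"
proof -
  have "0 \<in> toeplitz_kernel p G" by (rule aefun.subspace_0[OF kernel_subspace])
  then obtain f0 where f0: "f0 \<in> toeplitz_kernel p G" "f0 \<noteq> 0" using ne by blast
  then have f0H: "f0 \<in> H_plus p" "G * f0 \<in> H_minus p" by (auto simp: mem_kernel)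
  define v where "v = conj_aefun (G * f0)"
  have vH: "v \<in> H_plus p" using f0H by (simp add: v_def H_minus_iff)
  have "v \<noteq> 0"
    using hardy_cancel[OF f0H(1) f0(2) p, of G] G(2) by (auto simp: v_def)
  obtain \<iota> u where iu: "v = \<iota> * u" "\<iota> * conj_aefun \<iota> = 1" "u \<in> H_plus p" "\<And>f. f \<in> H_plus p \<Longrightarrow> \<iota> * f \<in> H_plus p"
    and quot: "\<And>a b q. a \<in> H_plus p \<Longrightarrow> b \<in> H_plus p \<Longrightarrow> q \<in> Lp p \<Longrightarrow> q * u = a * b \<Longrightarrow> q \<in> H_plus p"
    using inner_outer[OF vH \<open>v \<noteq> 0\<close> p] by blast
  define \<phi> where "\<phi> = \<iota> * f0"
  have G\<phi>: "G * \<phi> = conj_aefun u"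
  proof -
    have "conj_aefun v = conj_aefun \<iota> * conj_aefun u" by (simp add: iu(1) conj_mult)
    then have "G * f0 = conj_aefun \<iota> * conj_aefun u" by (simp add: v_def)
    moreover have "G * \<phi> = \<iota> * (G * f0)" by (simp only: \<phi>_def mult_ac)
    ultimately have "G * \<phi> = (\<iota> * conj_aefun \<iota>) * conj_aefun u" by (simp only: mult.assoc)
    then show ?thesis by (simp add: iu(2))
  qed
  have \<phi>K: "\<phi> \<in> toeplitz_kernel p G"
    using iu(3,4) f0H(1) G\<phi> by (simp add: mem_kernel \<phi>_def H_minus_iff)
  have "\<phi> \<noteq> 0"
  proof
    assume "\<phi> = 0"
    then have "conj_aefun \<iota> * (\<iota> * f0) = 0" by (simp add: \<phi>_def)
    then have "(\<iota> * conj_aefun \<iota>) * f0 = 0" by (simp add: mult_ac)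
    then show False using iu(2) f0(2) by simp
  qed
  moreover have "toeplitz_kernel p G \<subseteq> toeplitz_kernel p h" if h: "h \<in> Linf" "\<phi> \<in> toeplitz_kernel p h" for h
  proof
    fix f assume f: "f \<in> toeplitz_kernel p G"
    define q where "q = conj_aefun (h * f)"
    have "q \<in> H_plus p"
    proof (rule quot)
      show "conj_aefun (h * \<phi>) \<in> H_plus p" using h(2) by (simp add: mem_kernel H_minus_iff)
      show "conj_aefun (G * f) \<in> H_plus p" using f by (simp add: mem_kernel H_minus_iff)
      have "f \<in> Lp p" using f by (simp add: mem_kernel hardy_def)
      then show "q \<in> Lp p" unfolding q_def using h(1) p by (intro Lp_conj Lp_conj_mult_Linf) auto
      have "q * u = conj_aefun (h * f * (G * \<phi>))" by (simp add: q_def G\<phi> conj_mult)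
      also have "\<dots> = conj_aefun (h * \<phi>) * conj_aefun (G * f)" by (simp add: conj_mult mult_ac)
      finally show "q * u = conj_aefun (h * \<phi>) * conj_aefun (G * f)" .
    qed
    then show "f \<in> toeplitz_kernel p h" using f by (simp add: mem_kernel q_def H_minus_iff)
  qed
  ultimately show ?thesis
    using \<phi>K G(1) by (auto simp: maximal_function_def is_K_min_def T_kernel_def mem_kernel)
qed

text \<open>At a zero of \<open>G \<phi>\<close> the symbol could be multiplied by a Blaschke factor, so by minimality multiplication by
that factor maps the kernel into itself. Minimality against the symbol that maps \<open>\<phi>\<close> to its conjugate turns
this into a zero of infinite order of \<open>cnj \<phi>\<close>.\<close>

theorem maximal_function_nonvanishing:
  assumes G: "G \<in> Linf" and max: "maximal_function p \<phi> (toeplitz_kernel p G)" and z: "0 < Im z"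
  shows "val p (G * \<phi>) (cnj z) \<noteq> 0"
proof
  assume zero: "val p (G * \<phi>) (cnj z) = 0"
  have \<phi>: "\<phi> \<in> H_plus p" "\<phi> \<noteq> 0" "\<phi> \<in> toeplitz_kernel p G"
    and min: "\<And>h. h \<in> Linf \<Longrightarrow> \<phi> \<in> toeplitz_kernel p h \<Longrightarrow> toeplitz_kernel p G \<subseteq> toeplitz_kernel p h"
    using max by (auto simp: maximal_function_def is_K_min_def)
  have "\<phi> \<in> toeplitz_kernel p (blaschke_factor z * G)"
    using kernel_blaschke_factor_iff[OF z \<phi>(3)] zero by simp
  then have sub: "toeplitz_kernel p G \<subseteq> toeplitz_kernel p (blaschke_factor z * G)"
    by (intro min Linf_mult Linf_blaschke G)
  have pw: "blaschke_factor z ^ n * \<phi> \<in> toeplitz_kernel p G" for n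
  proof (induct n)
    case (Suc n)
    define e where "e = blaschke_factor z ^ n * \<phi>"
    have "e \<in> H_plus p" "blaschke_factor z * G * e \<in> H_minus p" using Suc sub by (auto simp: e_def mem_kernel)
    then have "blaschke_factor z * e \<in> toeplitz_kernel p G"
      using H_plus_blaschke_factor[OF _ z] by (simp add: mem_kernel mult_ac)
    then show ?case by (simp add: e_def mult.assoc)
  qed (use \<phi> in simp)
  obtain h where h: "h \<in> Linf" "h * \<phi> = conj_aefun \<phi>" using unimodular_conjugation by blast
  have "\<phi> \<in> toeplitz_kernel p h" using \<phi> h by (simp add: mem_kernel H_minus_iff)
  then have sub': "toeplitz_kernel p G \<subseteq> toeplitz_kernel p h" by (rule min[OF h(1)])
  have "conj_aefun \<phi> = 0"
  proof (rule hardy_all_zeros[of "-1" p "cnj z"])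
    fix n
    have "h * (blaschke_factor z ^ n * \<phi>) \<in> H_minus p" using pw[of n] sub' by (auto simp: mem_kernel)
    moreover have "h * (blaschke_factor z ^ n * \<phi>) = blaschke_factor z ^ n * (h * \<phi>)" by (simp only: mult_ac)
    ultimately show "(lin (cnj (cnj z)) * recip (cnj z)) ^ n * conj_aefun \<phi> \<in> H_minus p"
      by (simp only: h(2) blaschke_factor_eq complex_cnj_cnj)
  qed (use z p in auto)
  then show False using \<phi> by simp
qed

section \<open>Model spaces\<close>

lemma model_space_subspace: "aefun.subspace (model_space p (blaschke ws))"
  unfolding aefun.subspace_def
  by (auto simp: mem_model_space distrib_left scale_mult intro!: H_add H_scale zero_mem_hardy)

text \<open>The resolvent identity.\<close>

lemma recip_diff: "recip a = recip b + scale_aefun (a - b) (recip a * recip b)"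
proof -
  have "recip a = (lin b * recip b) * recip a" by simp
  also have "\<dots> = (lin b * recip a) * recip b" by (simp only: mult_ac)
  also have "\<dots> = recip b + scale_aefun (a - b) (recip a * recip b)"
    by (simp add: lin_recip distrib_right scale_mult)
  finally show ?thesis .
qed

text \<open>Remove from \<open>k\<close> the pole at \<open>cnj w\<close> that it has beyond those of \<open>K\<^sub>B\<close>. The constant \<open>c\<close> makes
\<open>(cnj w - w) h - c\<close> vanish at \<open>cnj w\<close>; as constants are not in \<open>H\<^sup>-\<close>, the computation is done with
\<open>d = h - c / (t - w)\<close>, which vanishes at \<open>cnj w\<close> as well.\<close>

lemma model_space_split:
  assumes ws: "set ws \<subseteq> upper" and w: "0 < Im w" and k: "k \<in> model_space p (blaschke (w # ws))"
  obtains c k1 where "k1 \<in> model_space p (blaschke ws)" "k = k1 + scale_aefun c (blaschke ws * recip (cnj w))"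
proof -
  define h where "h = blaschke_inv (w # ws) * k"
  have kH: "k \<in> H_plus p" and hM: "h \<in> H_minus p" using k unfolding h_def mem_model_space by simp_all
  define c where "c = (cnj w - w) * val p h (cnj w)"
  define k1 where "k1 = k - scale_aefun c (blaschke ws * recip (cnj w))"
  have rw: "recip w \<in> H_minus p" "recip (cnj w) \<in> H_plus p" using w p by (auto intro!: recip_mem_hardy)
  have nz: "cnj w - w \<noteq> 0" using w by (auto simp: complex_eq_iff)
  define d where "d = h - scale_aefun c (recip w)"
  have dM: "d \<in> H_minus p" unfolding d_def by (intro H_diff H_scale hM rw) auto
  have "val p d (cnj w) = val p h (cnj w) - c * (1 / (cnj w - w))"
    unfolding d_def using val_diff[of "-1" p h "scale_aefun c (recip w)" "cnj w"] val_scale[of "-1" p "recip w" "cnj w" c]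
      val_recip_self[of "-1" p w "cnj w"] H_scale[of "-1" "recip w" c] hM rw w p by simp
  then have d0: "val p d (cnj w) = 0" using nz by (simp add: c_def)
  have rd: "recip (cnj w) * d \<in> H_minus p" by (rule hardy_divide_zero[OF _ p dM _ d0]) (use w in auto)
  have u: "blaschke_inv ws * k = h + scale_aefun (cnj w - w) (recip (cnj w) * h)"
  proof -
    have "lin w * recip (cnj w) * h = (blaschke_factor w * (lin (cnj w) * recip w)) * (blaschke_inv ws * k)"
      by (simp only: h_def blaschke_simps blaschke_factor_eq mult_ac)
    then have "blaschke_inv ws * k = lin w * recip (cnj w) * h" by (simp add: blaschke_conj_cancel)
    then show ?thesis by (simp add: lin_recip distrib_right scale_mult)
  qed
  have "blaschke_inv ws * k1 = blaschke_inv ws * k - scale_aefun c ((blaschke ws * blaschke_inv ws) * recip (cnj w))"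
    by (simp add: k1_def right_diff_distrib scale_mult mult_ac)
  also have "\<dots> = h + scale_aefun (cnj w - w) (recip (cnj w) * h) - scale_aefun c (recip (cnj w))"
    by (simp add: u blaschke_cancel)
  also have "scale_aefun c (recip (cnj w)) = scale_aefun c (recip w) + scale_aefun (cnj w - w) (recip (cnj w) * scale_aefun c (recip w))"
    by (subst recip_diff[of "cnj w" w]) (simp add: aefun.scale_right_distrib scale_mult mult_ac)
  also have "h + scale_aefun (cnj w - w) (recip (cnj w) * h) - (scale_aefun c (recip w) + scale_aefun (cnj w - w) (recip (cnj w) * scale_aefun c (recip w))) =
     d + scale_aefun (cnj w - w) (recip (cnj w) * d)"
    by (simp add: d_def right_diff_distrib aefun.scale_right_diff_distrib)
  finally have "blaschke_inv ws * k1 = d + scale_aefun (cnj w - w) (recip (cnj w) * d)" .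
  moreover have "\<dots> \<in> H_minus p" by (intro H_add H_scale dM rd) auto
  moreover have "k1 \<in> H_plus p" unfolding k1_def by (intro H_diff H_scale H_plus_blaschke kH rw ws) auto
  ultimately have "k1 \<in> model_space p (blaschke ws)" by (simp add: mem_model_space)
  then show thesis by (rule that[of k1 c]) (simp add: k1_def)
qed

text \<open>The opposite direction: here the new factor multiplies the old function, and the added term is the simple pole at \<open>cnj w\<close>.\<close>

lemma model_space_extend:
  assumes ws: "set ws \<subseteq> upper" and w: "0 < Im w" and k: "k \<in> model_space p (blaschke ws)"
  shows "blaschke_factor w * k + scale_aefun c (recip (cnj w)) \<in> model_space p (blaschke (w # ws))"
proof -
  have kH: "k \<in> H_plus p" "blaschke_inv ws * k \<in> H_minus p" using k by (auto simp: mem_model_space)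
  have rw: "recip w \<in> H_minus p" "recip (cnj w) \<in> H_plus p" using w p by (auto intro!: recip_mem_hardy)
  have "blaschke_inv (w # ws) * (blaschke_factor w * k + scale_aefun c (recip (cnj w))) =
     (blaschke_factor w * (lin (cnj w) * recip w)) * (blaschke_inv ws * k) +
     scale_aefun c (blaschke_inv ws * ((lin (cnj w) * recip (cnj w)) * recip w))"
    by (simp only: blaschke_simps distrib_left scale_mult mult_ac)
  also have "\<dots> = blaschke_inv ws * k + scale_aefun c (blaschke_inv ws * recip w)"
    by (simp add: blaschke_conj_cancel)
  also have "\<dots> \<in> H_minus p" by (intro H_add H_scale H_minus_blaschke_inv kH rw ws) auto
  finally show ?thesis
    unfolding mem_model_space using kH rw w by (auto intro!: H_add H_scale H_plus_blaschke_factor)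
qed

text \<open>This is \<open>H\<^sup>+ \<inter> H\<^sup>- = {0}\<close>.\<close>

lemma model_space_Nil: "model_space p (blaschke []) = {0}"
  using H_plus_inter_H_minus[OF _ _ p] zero_mem_hardy by (auto simp: mem_model_space simp del: blaschke_simps(1))

text \<open>Elements of \<open>K\<^sub>B\<close> are rational and decay like \<open>1 / t\<close>, so multiplied by a linear function they remain
bounded on the upper half-plane, and on the lower one after division by \<open>B\<close>.\<close>

lemma model_space_multiplier:
  assumes "set ws \<subseteq> upper" "k \<in> model_space p (blaschke ws)" "f \<in> H_plus p" "h \<in> H_minus p"
  shows "lin z * k * f \<in> H_plus p" "lin z * (blaschke_inv ws * k) * h \<in> H_minus p"
proof -
  have "lin z * k * f \<in> H_plus p \<and> lin z * (blaschke_inv ws * k) * h \<in> H_minus p"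
    using assms
  proof (induct ws arbitrary: k)
    case Nil
    then have "k = 0" using model_space_Nil by simp
    then show ?case by (simp add: zero_mem_hardy)
  next
    case (Cons w ws)
    have w: "0 < Im w" "set ws \<subseteq> upper" using Cons(2) by auto
    obtain c k1 where k1: "k1 \<in> model_space p (blaschke ws)" "k = k1 + scale_aefun c (blaschke ws * recip (cnj w))"
      using model_space_split[OF w(2,1) Cons(3)] by blast
    have IH: "lin z * k1 * f \<in> H_plus p" "lin z * (blaschke_inv ws * k1) * h \<in> H_minus p"
      using Cons(1)[OF w(2) k1(1) Cons(4,5)] by auto
    have "lin z * k * f = lin z * k1 * f + scale_aefun c (blaschke ws * (lin z * recip (cnj w) * f))"
      by (simp add: k1(2) distrib_left distrib_right scale_mult mult_ac)
    moreover have "\<dots> \<in> H_plus p"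
      using IH(1) Cons(4) w by (intro H_add H_scale H_plus_blaschke H_lin_recip) auto
    ultimately have plus: "lin z * k * f \<in> H_plus p" by (simp only:)
    have "lin z * (blaschke_inv (w # ws) * k) * h = lin (cnj w) * recip w * (lin z * (blaschke_inv ws * k1) * h) +
      scale_aefun c ((blaschke ws * blaschke_inv ws) * (lin (cnj w) * recip (cnj w)) * (lin z * recip w * h))"
      by (simp only: k1(2) blaschke_simps distrib_left distrib_right scale_mult mult_ac)
    also have "\<dots> = lin (cnj w) * recip w * (lin z * (blaschke_inv ws * k1) * h) + scale_aefun c (lin z * recip w * h)"
      by (simp add: blaschke_cancel)
    also have "\<dots> \<in> H_minus p"
      using IH(2) Cons(5) w by (intro H_add H_scale H_minus_blaschke_inv_factor H_lin_recip) auto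
    finally show ?case using plus by blast
  qed
  then show "lin z * k * f \<in> H_plus p" "lin z * (blaschke_inv ws * k) * h \<in> H_minus p" by auto
qed

text \<open>The last pole of \<open>k\<close> has coefficient \<open>c\<close>. Everything else in \<open>(t - z) k \<psi> / B\<close> is regular at \<open>cnj w\<close>, whereas
\<open>(t - z) \<psi>\<close> does not vanish there; hence \<open>c = 0\<close>.\<close>

lemma model_space_independent:
  assumes z: "0 < Im z" and \<psi>: "\<psi> \<in> H_minus p" "\<And>w. 0 < Im w \<Longrightarrow> val p \<psi> (cnj w) \<noteq> 0"
    and "set ws \<subseteq> upper" "k \<in> model_space p (blaschke ws)" "lin z * k * \<psi> \<in> H_minus p"
  shows "k = 0"
  using assms(4-6)
proof (induct ws arbitrary: k)
  case Nil
  then show ?case using model_space_Nil by simp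
next
  case (Cons w ws)
  have w: "0 < Im w" "set ws \<subseteq> upper" using Cons(2) by auto
  obtain c k1 where k1: "k1 \<in> model_space p (blaschke ws)" "k = k1 + scale_aefun c (blaschke ws * recip (cnj w))"
    using model_space_split[OF w(2,1) Cons(3)] by blast
  define e where "e = scale_aefun c (lin z * recip (cnj w) * \<psi>)"
  have "blaschke_inv ws * (lin z * k * \<psi>) = lin z * (blaschke_inv ws * k1) * \<psi> +
     scale_aefun c ((blaschke ws * blaschke_inv ws) * (lin z * recip (cnj w) * \<psi>))"
    by (simp only: k1(2) distrib_left distrib_right scale_mult mult_ac)
  then have "e = blaschke_inv ws * (lin z * k * \<psi>) - lin z * (blaschke_inv ws * k1) * \<psi>"
    by (simp add: blaschke_cancel e_def)
  moreover have "\<dots> \<in> H_minus p"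
    using model_space_multiplier(2)[OF w(2) k1(1) zero_mem_hardy \<psi>(1), of z] Cons(4) w
    by (intro H_diff H_minus_blaschke_inv) auto
  ultimately have eM: "e \<in> H_minus p" by simp
  have "lin (cnj w) * recip z * e = scale_aefun c \<psi>"
  proof -
    have "lin (cnj w) * recip z * e = scale_aefun c ((lin z * recip z) * (lin (cnj w) * recip (cnj w)) * \<psi>)"
      by (simp only: e_def scale_mult mult_ac)
    then show ?thesis by simp
  qed
  moreover have "val p (lin (cnj w) * recip z * e) (cnj w) = val p e (cnj w) * (cnj w - cnj w) / (cnj w - z)"
    by (rule val_lin_recip[OF _ p eM]) (use z w in auto)
  moreover have "val p (scale_aefun c \<psi>) (cnj w) = c * val p \<psi> (cnj w)"
    by (rule val_scale[OF _ p \<psi>(1)]) (use w in auto)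
  ultimately have "c * val p \<psi> (cnj w) = 0" by simp
  then have "c = 0" using \<psi>(2)[OF w(1)] by simp
  then have "k = k1" using k1 by simp
  then show ?case using Cons(1)[OF w(2), of k1] k1(1) Cons(4) by simp
qed

text \<open>One zero of \<open>B\<close> at a time: multiplying the remainder \<open>u\<close> by the next Blaschke factor creates a pole at
\<open>cnj w\<close>, which is cancelled by a multiple \<open>d\<close> of \<open>(t - z) \<psi> / (t - cnj w)\<close>.\<close>

lemma model_space_interpolation:
  assumes z: "0 < Im z" and \<psi>: "\<psi> \<in> H_minus p" "\<And>w. 0 < Im w \<Longrightarrow> val p \<psi> (cnj w) \<noteq> 0"
    and "set ws \<subseteq> upper" "v \<in> H_minus p"
  shows "\<exists>k\<in>model_space p (blaschke ws). blaschke ws * v - lin z * k * \<psi> \<in> H_minus p"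
  using assms(4,5)
proof (induct ws)
  case Nil
  have "0 \<in> model_space p (blaschke [])" unfolding mem_model_space by (simp add: zero_mem_hardy)
  then show ?case using Nil by (intro bexI[of _ 0]) auto
next
  case (Cons w ws)
  have w: "0 < Im w" "set ws \<subseteq> upper" using Cons(2) by auto
  obtain k where k: "k \<in> model_space p (blaschke ws)" "blaschke ws * v - lin z * k * \<psi> \<in> H_minus p"
    using Cons(1)[OF w(2) Cons(3)] by blast
  define u where "u = blaschke ws * v - lin z * k * \<psi>"
  have uM: "u \<in> H_minus p" using k by (simp add: u_def)
  have nz: "val p \<psi> (cnj w) \<noteq> 0" "cnj w - z \<noteq> 0" using \<psi>(2)[OF w(1)] w z by (auto simp: complex_eq_iff)
  define d where "d = (cnj w - w) * val p u (cnj w) / ((cnj w - z) * val p \<psi> (cnj w))"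
  define x where "x = scale_aefun (cnj w - w) u - scale_aefun (d * (cnj w - z)) \<psi>"
  have xM: "x \<in> H_minus p" unfolding x_def by (intro H_diff H_scale uM \<psi>) auto
  have "val p x (cnj w) = (cnj w - w) * val p u (cnj w) - (d * (cnj w - z)) * val p \<psi> (cnj w)"
    unfolding x_def using val_diff[of "-1" p "scale_aefun (cnj w - w) u" "scale_aefun (d * (cnj w - z)) \<psi>" "cnj w"]
      val_scale[of "-1" p u "cnj w"] val_scale[of "-1" p \<psi> "cnj w"] H_scale[of "-1"] uM \<psi>(1) w p by simp
  then have x0: "val p x (cnj w) = 0" using nz by (simp add: d_def)
  have rx: "recip (cnj w) * x \<in> H_minus p" by (rule hardy_divide_zero[OF _ p xM _ x0]) (use w in auto)
  define k' where "k' = blaschke_factor w * k + scale_aefun d (recip (cnj w))"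
  have "blaschke (w # ws) * v - lin z * k' * \<psi> = lin w * recip (cnj w) * u - scale_aefun d (lin z * recip (cnj w) * \<psi>)"
    by (simp add: k'_def u_def blaschke_factor_eq distrib_left distrib_right right_diff_distrib scale_mult mult_ac)
  also have "\<dots> = u - scale_aefun d \<psi> + recip (cnj w) * x"
    by (simp add: lin_recip x_def distrib_right right_diff_distrib scale_mult aefun.scale_right_distrib)
  also have "\<dots> \<in> H_minus p" by (intro H_add H_diff H_scale uM \<psi> rx) auto
  finally have "blaschke (w # ws) * v - lin z * k' * \<psi> \<in> H_minus p" .
  moreover have "k' \<in> model_space p (blaschke (w # ws))" unfolding k'_def by (rule model_space_extend[OF w(2,1) k(1)])
  ultimately show ?case by blast
qed

section \<open>The decomposition\<close>

text \<open>For \<open>f\<close> in \<open>ker T\<^sub>g\<close> the interpolation is applied to \<open>g f\<close> and \<open>\<psi> = B g \<phi>\<close>.\<close>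

theorem kernel_decomposition:
  assumes g: "g \<in> Linf" and ws: "set ws \<subseteq> upper" and z: "0 < Im z"
    and max: "maximal_function p \<phi> (toeplitz_kernel p (blaschke ws * g))"
  shows "is_direct_sum (toeplitz_kernel p g) (toeplitz_kernel p (blaschke ws * g))
    ((lin z * \<phi>) *o model_space p (blaschke ws))"
proof -
  let ?B = "blaschke ws" and ?N = "toeplitz_kernel p (blaschke ws * g)"
  let ?W = "(lin z * \<phi>) *o model_space p (blaschke ws)"
  define \<psi> where "\<psi> = ?B * g * \<phi>"
  have \<phi>: "\<phi> \<in> H_plus p" "\<psi> \<in> H_minus p"
    using max by (auto simp: maximal_function_def is_K_min_def mem_kernel \<psi>_def)
  have nz: "val p \<psi> (cnj w) \<noteq> 0" if "0 < Im w" for w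
    unfolding \<psi>_def using maximal_function_nonvanishing[OF _ max that] g by (auto intro: Linf_mult Linf_blaschke_list)
  have Wmem: "f \<in> ?W \<longleftrightarrow> (\<exists>k\<in>model_space p ?B. f = lin z * \<phi> * k)" for f
    by (auto simp: elt_set_times_def)
  have WK: "lin z * \<phi> * k \<in> toeplitz_kernel p g" if k: "k \<in> model_space p ?B" for k
  proof -
    note m = model_space_multiplier[OF ws k \<phi>, of z]
    have "lin z * (blaschke_inv ws * k) * \<psi> = (?B * blaschke_inv ws) * (g * (lin z * \<phi> * k))"
      by (simp only: \<psi>_def mult_ac)
    then have "g * (lin z * \<phi> * k) \<in> H_minus p" using m(2) by (simp add: blaschke_cancel)
    moreover have "lin z * \<phi> * k \<in> H_plus p" using m(1) by (simp add: mult_ac)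
    ultimately show ?thesis by (simp add: mem_kernel)
  qed
  have NK: "?N \<subseteq> toeplitz_kernel p g" by (rule kernel_blaschke_subset[OF ws])
  show ?thesis
    unfolding is_direct_sum_def
  proof (intro conjI)
    show "aefun.subspace ?N" by (rule kernel_subspace)
    show "aefun.subspace ?W"
      unfolding aefun.subspace_def
    proof (intro conjI ballI allI)
      note S = model_space_subspace[of ws]
      show "0 \<in> ?W" unfolding Wmem using aefun.subspace_0[OF S] by (intro bexI[of _ 0]) auto
      fix x assume "x \<in> ?W"
      then obtain k where k: "k \<in> model_space p ?B" "x = lin z * \<phi> * k" by (auto simp: Wmem)
      show "scale_aefun c x \<in> ?W" for c
        unfolding Wmem using aefun.subspace_scale[OF S k(1), of c] by (intro bexI[of _ "scale_aefun c k"]) (auto simp: k scale_mult)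
      fix y assume "y \<in> ?W"
      then obtain l where l: "l \<in> model_space p ?B" "y = lin z * \<phi> * l" by (auto simp: Wmem)
      show "x + y \<in> ?W"
        unfolding Wmem using aefun.subspace_add[OF S k(1) l(1)] by (intro bexI[of _ "k + l"]) (auto simp: k l distrib_left)
    qed
    show "?N \<inter> ?W = {0}"
    proof
      show "{0} \<subseteq> ?N \<inter> ?W"
        unfolding Wmem[abs_def] using aefun.subspace_0[OF kernel_subspace] aefun.subspace_0[OF model_space_subspace]
        by (auto simp: Wmem intro!: bexI[of _ 0])
      show "?N \<inter> ?W \<subseteq> {0}"
      proof
        fix f assume f: "f \<in> ?N \<inter> ?W"
        then obtain k where k: "k \<in> model_space p ?B" "f = lin z * \<phi> * k" by (auto simp: Wmem)
        have "lin z * k * \<psi> = ?B * g * f" by (simp only: k \<psi>_def mult_ac)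
        then have "lin z * k * \<psi> \<in> H_minus p" using f by (simp add: mem_kernel)
        then have "k = 0" by (intro model_space_independent[OF z \<phi>(2) nz ws k(1)])
        then show "f \<in> {0}" by (simp add: k)
      qed
    qed
    show "toeplitz_kernel p g = ?N + ?W"
    proof
      show "?N + ?W \<subseteq> toeplitz_kernel p g"
      proof
        fix f assume "f \<in> ?N + ?W"
        then obtain a b where ab: "a \<in> ?N" "b \<in> ?W" "f = a + b" by (auto simp: set_plus_def)
        then have "a \<in> toeplitz_kernel p g" "b \<in> toeplitz_kernel p g" using NK WK by (auto simp: Wmem)
        then show "f \<in> toeplitz_kernel p g" unfolding ab(3) by (rule aefun.subspace_add[OF kernel_subspace])
      qed
      show "toeplitz_kernel p g \<subseteq> ?N + ?W"
      proof
        fix f assume f: "f \<in> toeplitz_kernel p g"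
        then have "g * f \<in> H_minus p" by (simp add: mem_kernel)
        then obtain k where k: "k \<in> model_space p ?B" "?B * (g * f) - lin z * k * \<psi> \<in> H_minus p"
          using model_space_interpolation[OF z \<phi>(2) nz ws] by blast
        define b where "b = lin z * \<phi> * k"
        have b: "b \<in> ?W" "b \<in> toeplitz_kernel p g" using k(1) WK by (auto simp: Wmem b_def)
        have "?B * g * (f - b) = ?B * (g * f) - lin z * k * \<psi>"
          by (simp add: b_def \<psi>_def right_diff_distrib mult_ac)
        then have "f - b \<in> ?N"
          using k(2) aefun.subspace_diff[OF kernel_subspace f b(2)] by (simp add: mem_kernel)
        then have "(f - b) + b \<in> ?N + ?W" using b(1) by (rule set_plus_intro)
        then show "f \<in> ?N + ?W" by simp
      qed
    qed
  qed
qed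

end

lemma blaschke_append: "blaschke (xs @ ys) = blaschke xs * blaschke ys"
  by (simp add: blaschke_def)

lemma blaschke_replicate: "blaschke (replicate n w) = blaschke_factor w ^ n"
  by (induct n) auto

lemma blaschke_product_list:
  assumes "finite J" "\<And>j. j \<in> J \<Longrightarrow> 0 < Im (z j)"
  shows "\<exists>ws. set ws \<subseteq> upper \<and> length ws = (\<Sum>j\<in>J. k j) \<and> blaschke ws = (\<Prod>j\<in>J. blaschke_factor (z j) ^ k j)"
  using assms
proof (induct J rule: finite_induct)
  case (insert j J)
  then obtain ws where ws: "set ws \<subseteq> upper" "length ws = (\<Sum>j\<in>J. k j)" "blaschke ws = (\<Prod>j\<in>J. blaschke_factor (z j) ^ k j)"
    by auto
  show ?case
  proof (intro exI conjI)
    show "set (replicate (k j) (z j) @ ws) \<subseteq> upper" using ws(1) insert(4)[of j] by auto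
    show "length (replicate (k j) (z j) @ ws) = (\<Sum>j\<in>insert j J. k j)" using ws(2) insert by simp
    show "blaschke (replicate (k j) (z j) @ ws) = (\<Prod>j\<in>insert j J. blaschke_factor (z j) ^ k j)"
      using ws(3) insert by (simp add: blaschke_append blaschke_replicate)
  qed
qed (intro exI[of _ "[]"], simp)

theorem theorem6p7:
  fixes p :: real and g B :: aefun and n K :: nat
    and k :: "nat \<Rightarrow> nat" and z :: "nat \<Rightarrow> complex"
  assumes "1 < p"
    and "g \<in> Linf"
    and "1 \<le> n"
    and "\<And>j. j \<in> {1..n} \<Longrightarrow> 0 < k j"
    and "\<And>j. j \<in> {1..n} \<Longrightarrow> 0 < Im (z j)"
    and "B = (\<Prod>j = 1..n. blaschke_factor (z j) ^ k j)"
    and "K = (\<Sum>j = 1..n. k j)"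
  shows "(dim_at_most (toeplitz_kernel p g) K \<longrightarrow> toeplitz_kernel p (B * g) = {0}) \<and>
    (\<not> dim_at_most (toeplitz_kernel p g) K \<longrightarrow>
      (g \<noteq> 0 \<longrightarrow> (\<exists>\<phi>. maximal_function p \<phi> (toeplitz_kernel p (B * g)))) \<and>
      (\<forall>\<phi>. maximal_function p \<phi> (toeplitz_kernel p (B * g)) \<longrightarrow>
        is_direct_sum (toeplitz_kernel p g) (toeplitz_kernel p (B * g))
          ((lin (z 1) * \<phi>) *o model_space p B)))"
proof -
  obtain ws where ws: "set ws \<subseteq> upper" "length ws = K" "blaschke ws = B"
    using blaschke_product_list[of "{1..n}" z k] assms(5-7) by auto
  have z1: "0 < Im (z 1)" using assms(3,5) by auto
  show ?thesis
  proof (intro conjI impI allI)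
    assume dim: "dim_at_most (toeplitz_kernel p g) K"
    show "toeplitz_kernel p (B * g) = {0}"
    proof (rule ccontr)
      assume ne: "toeplitz_kernel p (B * g) \<noteq> {0}"
      then have "dim_at_most (toeplitz_kernel p (B * g)) 0"
        using dim_kernel_blaschke_down[OF assms(1) ws(1), of g 0] dim ws by simp
      then show False
        using ne aefun.subspace_0[OF kernel_subspace[OF assms(1)]] by (auto simp: dim_at_most_zero)
    qed
  next
    assume dim: "\<not> dim_at_most (toeplitz_kernel p g) K" and g: "g \<noteq> 0"
    have "\<not> dim_at_most (toeplitz_kernel p (B * g)) 0"
      using dim_kernel_blaschke_up[OF assms(1) ws(1), of g 0] dim ws by auto
    then have "toeplitz_kernel p (B * g) \<noteq> {0}" by (auto simp: dim_at_most_zero)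
    moreover have "B * g \<noteq> 0"
    proof
      assume "B * g = 0"
      moreover have "(blaschke ws * blaschke_inv ws) * g = blaschke_inv ws * (B * g)" by (simp only: ws(3) mult_ac)
      ultimately show False using g by (simp add: blaschke_cancel)
    qed
    moreover have "B * g \<in> Linf" using assms(2) Linf_blaschke_list[of ws] ws(3) by (auto intro: Linf_mult)
    ultimately show "\<exists>\<phi>. maximal_function p \<phi> (toeplitz_kernel p (B * g))"
      by (intro maximal_function_exists[OF assms(1)])
  next
    fix \<phi> assume "maximal_function p \<phi> (toeplitz_kernel p (B * g))"
    then show "is_direct_sum (toeplitz_kernel p g) (toeplitz_kernel p (B * g)) ((lin (z 1) * \<phi>) *o model_space p B)"
      using kernel_decomposition[OF assms(1,2) ws(1) z1] ws(3) by simp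
  qed
qed

end
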